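(* Let $c:\mathcal{C}^{(d)}\to\mathbb{R}^d$ be measurable with $c(K+x)=c(K)+x$ for all $K\in\mathcal{C}^{(d)}$, $x\in\mathbb{R}^d$, and put $\mathcal{C}^{(d)}_0=\{K\in\mathcal{C}^{(d)}:c(K)=0\}$. Let $\mathbb{Q}$ be a probability measure on $\mathcal{C}^{(d)}$ with $\mathbb{Q}(\mathcal{C}^{(d)}_0)=1$ and $$\int_{\mathcal{C}^{(d)}}\mathcal{L}^d\big(L+(-C)\big)\,\mathrm{d}\mathbb{Q}(L)<\infty,\qquad C\in\mathcal{C}^{(d)}.$$ For fixed $z>0$ consider on $\mathcal{C}^{(d)}$ the (locally finite) measure $$\lambda(\cdot)=z\int_{\mathbb{R}^d}\int_{\mathcal{C}^{(d)}}\mathbf{1}\{L+x\in\cdot\,\}\,\mathrm{d}\mathbb{Q}(L)\,\mathrm{d}x.$$ For each $n\ge2$ let $V_n:(\mathcal{C}^{(d)})^n\to(-\infty,\infty]$ be a measurable and symmetric function. Assume that there exists some $R_V>0$ such that $V_n(K_1,\dots,K_n)=0$ for all $n\ge2$ and all $K_1,\dots,K_n\in\mathcal{C}^{(d)}$ with $\max\{d_H(K_i,K_j):1\le i<j\le n\}>R_V$, and that $$\sum_{n=2}^\infty\frac1{(n-1)!}\max\Big\{-\int_{(\mathcal{C}^{(d)})^{n-1}}V_n(K,L_1,\dots,L_{n-1})\,\mathrm{d}\mu^{(n-1)}(L_1,\dots,L_{n-1}),\,0\Big\}<\infty$$ for all $K\in\mathcal{C}^{(d)}$ and $\mu\in\mathbf{N}(\mathcal{C}^{(d)})$.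 Define $\kappa:\mathcal{C}^{(d)}\times\mathbf{N}(\mathcal{C}^{(d)})\to[0,\infty)$ by $$\kappa(K,\mu)=\exp\Big(-\sum_{n=2}^\infty\frac1{(n-1)!}\int_{(\mathcal{C}^{(d)})^{n-1}}V_n(K,L_1,\dots,L_{n-1})\,\mathrm{d}\mu^{(n-1)}(L_1,\dots,L_{n-1})\Big).$$ Assume that $\kappa$ is locally stable, that is, $\sup_{\mu\in\mathbf{N}(\mathcal{C}^{(d)})}\kappa(K,\mu)\le\vartheta(K)$ for $\lambda$-a.e. $K\in\mathcal{C}^{(d)}$ and some locally $\lambda$-integrable function $\vartheta:\mathcal{C}^{(d)}\to[0,\infty)$. Then there exists a Gibbs particle process with PI $\kappa$, i.e. a Gibbs process in $\mathcal{C}^{(d)}$ with PI $\kappa$ and reference measure $\lambda$.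
   Context: $\mathcal{C}^{(d)}$ is the space of non-empty compact subsets of $\mathbb{R}^d$ with the Hausdorff metric $d_H$ and its Borel $\sigma$-field. $\mathcal{L}^d$ is Lebesgue measure on $\mathbb{R}^d$; sums of sets are Minkowski sums, $L+x=\{y+x:y\in L\}$, $-C=\{-y:y\in C\}$. Locally finite / locally $\lambda$-integrable means finite / $\lambda$-integrable on $d_H$-bounded Borel sets. The convention $e^{-\infty}=0$ is used. $\mathbf{N}(\mathcal{C}^{(d)})$ is the set of all measures $\mu$ on $\mathcal{C}^{(d)}$ with $\mu(B)\in\{0,1,2,\dots\}$ for every $d_H$-bounded Borel set $B$, with the $\sigma$-field generated by the maps $\mu\mapsto\mu(B)$, $B$ Borel. A point process in $\mathcal{C}^{(d)}$ is a random element of $\mathbf{N}(\mathcal{C}^{(d)})$ on some probability space. $\delta_K$ is the Dirac measure in $K$. Every $\mu\in\mathbf{N}(\mathcal{C}^{(d)})$ is a sum $\mu=\sum_{j=1}^k\delta_{K_j}$, $k\in\{0,1,\dots\}\cup\{\infty\}$, and its $m$-th factorial measure is $\mu^{(m)}=\sum\delta_{(K_{j_1},\dots,K_{j_m})}$, where the sum is over all $m$-tuples of pairwise distinct indices $j_1,\dots,j_m$ (an empty sum being the zero measure). Gibbs process. A point process $\eta$ in $\mathcal{C}^{(d)}$ is a Gibbs process with Papangelou intensity (PI) $\kappa$ and reference measure $\lambda$ if $$\mathbb{E}\Big[\int f(K,\eta)\,\mathrm{d}\eta(K)\Big]=\mathbb{E}\Big[\int f(K,\eta+\delta_K)\,\kappa(K,\eta)\,\mathrm{d}\lambda(K)\Big]$$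 for all measurable $f:\mathcal{C}^{(d)}\times\mathbf{N}(\mathcal{C}^{(d)})\to[0,\infty]$. *)

theory Defs
  imports "HOL-Probability.Probability"
begin

section \<open>Non-empty compact sets with the Hausdorff metric\<close>

typedef (overloaded) 'a compacts = "{K :: 'a::metric_space set. compact K \<and> K \<noteq> {}}"
  morphisms set_of_compacts Compacts
  by (intro exI[of _ "{undefined}"]) auto

setup_lifting type_definition_compacts

lemma compact_set_of_compacts: "compact (set_of_compacts K)"
  and set_of_compacts_nonempty: "set_of_compacts K \<noteq> {}"
  using set_of_compacts[of K] by auto

instantiation compacts :: (metric_space) metric_space
begin

definition dist_compacts :: "'a compacts \<Rightarrow> 'a compacts \<Rightarrow> real" where
  "dist_compacts K L =
     max (SUP x\<in>set_of_compacts K. infdist x (set_of_compacts L))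
         (SUP y\<in>set_of_compacts L. infdist y (set_of_compacts K))"

definition uniformity_compacts :: "('a compacts \<times> 'a compacts) filter" where
  "uniformity_compacts = (INF e\<in>{0<..}. principal {(x, y). dist x y < e})"

definition open_compacts :: "'a compacts set \<Rightarrow> bool" where
  "open_compacts U \<longleftrightarrow> (\<forall>x\<in>U. \<forall>\<^sub>F (x', y) in uniformity. x' = x \<longrightarrow> y \<in> U)"

instance
proof
  have bdd: "bdd_above ((\<lambda>x. infdist x (set_of_compacts L)) ` set_of_compacts K)"
    for K L :: "'a compacts"
    by (intro bounded_imp_bdd_above compact_imp_bounded compact_continuous_image
        continuous_intros compact_set_of_compacts)
  have le: "dist K L \<le> e \<longleftrightarrow>
      (\<forall>x\<in>set_of_compacts K. infdist x (set_of_compacts L) \<le> e) \<and>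
      (\<forall>y\<in>set_of_compacts L. infdist y (set_of_compacts K) \<le> e)" for K L :: "'a compacts" and e
    unfolding dist_compacts_def
    by (simp add: cSUP_le_iff[OF set_of_compacts_nonempty bdd])
  have infdist_attained: "\<exists>y\<in>set_of_compacts L. infdist x (set_of_compacts L) = dist x y"
    for x and L :: "'a compacts"
  proof -
    obtain y where y: "y \<in> set_of_compacts L" "\<forall>z\<in>set_of_compacts L. dist x y \<le> dist x z"
      using continuous_attains_inf[OF compact_set_of_compacts set_of_compacts_nonempty,
          of L "dist x"] continuous_on_dist[OF continuous_on_const continuous_on_id] by blast
    then have "dist x y \<le> infdist x (set_of_compacts L)"
      by (auto simp: infdist_notempty[OF set_of_compacts_nonempty] set_of_compacts_nonempty
          intro!: cINF_greatest)
    then show ?thesis using y infdist_le[of y "set_of_compacts L" x] by (intro bexI[of _ y]) auto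
  qed
  have nonneg: "0 \<le> dist K L" for K L :: "'a compacts"
    using le[of K L "dist K L"] set_of_compacts_nonempty[of K] infdist_nonneg
    by (metis all_not_in_conv order.refl order.trans)
  have sub: "set_of_compacts K \<subseteq> set_of_compacts L" if "dist K L \<le> 0" for K L :: "'a compacts"
  proof
    fix x assume x: "x \<in> set_of_compacts K"
    then have "infdist x (set_of_compacts L) \<le> 0" using le that by blast
    then show "x \<in> set_of_compacts L"
      using infdist_attained[of L x] infdist_nonneg[of x "set_of_compacts L"] by auto
  qed
  have comm: "dist K L = dist L K" for K L :: "'a compacts"
    by (simp add: dist_compacts_def max.commute)
  show "dist K L = 0 \<longleftrightarrow> K = L" for K L :: "'a compacts"
  proof
    assume "dist K L = 0"
    then show "K = L" using sub[of K L] sub[of L K] comm[of K L]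
      by (auto simp: set_of_compacts_inject[symmetric])
  next
    assume "K = L"
    then have "dist K L \<le> 0" by (simp add: le)
    then show "dist K L = 0" using nonneg[of K L] by simp
  qed
  have half: "infdist x (set_of_compacts L) \<le> dist K M + dist L M"
    if x: "x \<in> set_of_compacts K" for x and K L M :: "'a compacts"
  proof -
    obtain y where y: "y \<in> set_of_compacts M" "infdist x (set_of_compacts M) = dist x y"
      using infdist_attained by blast
    have "infdist x (set_of_compacts L) \<le> infdist y (set_of_compacts L) + dist x y"
      by (rule infdist_triangle)
    moreover have "infdist x (set_of_compacts M) \<le> dist K M" using x le by blast
    moreover have "infdist y (set_of_compacts L) \<le> dist L M" using y le by blast
    ultimately show ?thesis using y by linarith
  qed
  show "dist K L \<le> dist K M + dist L M" for K L M :: "'a compacts"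
    using half[of _ K L M] half[of _ L K M] by (auto simp: le add.commute)
qed (simp_all add: uniformity_compacts_def open_compacts_def)

end

lift_definition translate :: "'a::real_normed_vector compacts \<Rightarrow> 'a \<Rightarrow> 'a compacts"
  is "\<lambda>K x. (\<lambda>y. y + x) ` K"
  by (auto intro!: compact_continuous_image continuous_intros)


section \<open>Locally finite counting measures and their factorial measures\<close>

definition counting_measures :: "'b::metric_space measure set" where
  "counting_measures =
     {\<mu>. sets \<mu> = sets borel \<and> (\<forall>B\<in>sets borel. bounded B \<longrightarrow> emeasure \<mu> B \<in> \<nat>)}"

text \<open>The \<open>\<sigma>\<close>-field generated by the evaluation maps, following \<^const>\<open>subprob_algebra\<close>.\<close>

definition counting_measure_algebra :: "'b::metric_space measure measure" where
  "counting_measure_algebra =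
     (SUP B\<in>sets borel. vimage_algebra counting_measures (\<lambda>\<mu>. emeasure \<mu> B) borel)"

definition point_process :: "'w measure \<Rightarrow> ('w \<Rightarrow> 'b::metric_space measure) \<Rightarrow> bool" where
  "point_process P \<eta> \<longleftrightarrow> prob_space P \<and> \<eta> \<in> measurable P counting_measure_algebra"

text \<open>
  Sums of Dirac measures are written as images of the counting measure on the index set, so
  \<open>enumerates k K \<mu>\<close> says that \<open>\<mu>\<close> is the sum of the Dirac measures in the points \<open>K j\<close>, \<open>j < k\<close>.
  Every member of \<^const>\<open>counting_measures\<close> on a separable space has such an enumeration, and
  the factorial measures do not depend on which one is chosen.
\<close>

definition enumerates :: "enat \<Rightarrow> (nat \<Rightarrow> 'b::metric_space) \<Rightarrow> 'b measure \<Rightarrow> bool" where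
  "enumerates k K \<mu> \<longleftrightarrow> \<mu> = distr (count_space {j. enat j < k}) borel K"

text \<open>
  An \<open>m\<close>-tuple is an element of the extensional function space underlying
  \<open>PiM {..<m} (\<lambda>_. borel)\<close>.
\<close>

definition factorial_measure :: "nat \<Rightarrow> 'b::metric_space measure \<Rightarrow> (nat \<Rightarrow> 'b) measure" where
  "factorial_measure m \<mu> =
     (let (k, K) = (SOME (k, K). enumerates k K \<mu>) in
        distr (count_space {t \<in> {..<m} \<rightarrow>\<^sub>E {j. enat j < k}. inj_on t {..<m}})
          (PiM {..<m} (\<lambda>_. borel)) (\<lambda>t. \<lambda>i\<in>{..<m}. K (t i)))"


section \<open>Gibbs processes\<close>

definition add_measure :: "'b measure \<Rightarrow> 'b measure \<Rightarrow> 'b measure" where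
  "add_measure \<mu> \<nu> = measure_of (space \<mu>) (sets \<mu>) (\<lambda>B. emeasure \<mu> B + emeasure \<nu> B)"

definition gibbs_process ::
  "'w measure \<Rightarrow> ('w \<Rightarrow> 'b::metric_space measure) \<Rightarrow> ('b \<Rightarrow> 'b measure \<Rightarrow> ennreal) \<Rightarrow> 'b measure \<Rightarrow> bool"
where
  "gibbs_process P \<eta> \<kappa> \<Lambda> \<longleftrightarrow> point_process P \<eta> \<and>
     (\<forall>f :: 'b \<Rightarrow> 'b measure \<Rightarrow> ennreal.
        case_prod f \<in> borel_measurable (borel \<Otimes>\<^sub>M counting_measure_algebra) \<longrightarrow>
        (\<integral>\<^sup>+\<omega>. (\<integral>\<^sup>+K. f K (\<eta> \<omega>) \<partial>\<eta> \<omega>) \<partial>P) =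
        (\<integral>\<^sup>+\<omega>. (\<integral>\<^sup>+K. f K (add_measure (\<eta> \<omega>) (return borel K)) * \<kappa> K (\<eta> \<omega>) \<partial>\<Lambda>) \<partial>P))"

definition locally_integrable :: "'b::metric_space measure \<Rightarrow> ('b \<Rightarrow> real) \<Rightarrow> bool" where
  "locally_integrable \<Lambda> f \<longleftrightarrow> (\<forall>B\<in>sets borel. bounded B \<longrightarrow> set_integrable \<Lambda> B f)"

definition locally_stable ::
  "('b::metric_space \<Rightarrow> 'b measure \<Rightarrow> ennreal) \<Rightarrow> 'b measure \<Rightarrow> bool" where
  "locally_stable \<kappa> \<Lambda> \<longleftrightarrow>
     (\<exists>\<theta> :: 'b \<Rightarrow> real. (\<forall>K. 0 \<le> \<theta> K) \<and> locally_integrable \<Lambda> \<theta> \<and>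
        (AE K in \<Lambda>. (SUP \<mu>\<in>counting_measures. \<kappa> K \<mu>) \<le> ennreal (\<theta> K)))"


section \<open>Particle reference measure and Papangelou intensity of a family of potentials\<close>

definition particle_measure ::
  "real \<Rightarrow> 'a::euclidean_space compacts measure \<Rightarrow> 'a compacts measure" where
  "particle_measure z Q = measure_of UNIV (sets borel)
     (\<lambda>B. ennreal z * (\<integral>\<^sup>+x. (\<integral>\<^sup>+L. indicator B (translate L x) \<partial>Q) \<partial>lborel))"

text \<open>
  \<^const>\<open>e2ennreal\<close> maps negative numbers to \<open>0\<close>, so this is the integral of the positive part
  minus that of the negative part. It is only used where the latter is finite.
\<close>

definition ereal_integral :: "'b measure \<Rightarrow> ('b \<Rightarrow> ereal) \<Rightarrow> ereal" where
  "ereal_integral M f =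
     enn2ereal (\<integral>\<^sup>+x. e2ennreal (f x) \<partial>M) - enn2ereal (\<integral>\<^sup>+x. e2ennreal (- f x) \<partial>M)"

definition ereal_exp :: "ereal \<Rightarrow> ennreal" where
  "ereal_exp x =
     (if x = \<infinity> then \<infinity> else if x = -\<infinity> then 0 else ennreal (exp (real_of_ereal x)))"

text \<open>
  \<open>V n\<close> is a function of \<open>n\<close>-tuples. If \<open>L\<close> is an \<open>(n - 1)\<close>-tuple, then \<open>case_nat K L\<close> is
  the \<open>n\<close>-tuple with entry \<open>K\<close> at index \<open>0\<close> followed by the entries of \<open>L\<close>.
\<close>

definition interaction ::
  "(nat \<Rightarrow> (nat \<Rightarrow> 'b::metric_space) \<Rightarrow> ereal) \<Rightarrow> nat \<Rightarrow> 'b \<Rightarrow> 'b measure \<Rightarrow> ereal" where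
  "interaction V n K \<mu> =
     ereal_integral (factorial_measure (n - 1) \<mu>) (\<lambda>L. V n (case_nat K L))"

text \<open>The sums over \<open>n \<ge> 2\<close> are indexed by \<open>n - 2\<close>.\<close>

definition papangelou ::
  "(nat \<Rightarrow> (nat \<Rightarrow> 'b::metric_space) \<Rightarrow> ereal) \<Rightarrow> 'b \<Rightarrow> 'b measure \<Rightarrow> ennreal" where
  "papangelou V K \<mu> =
     ereal_exp (- (\<Sum>n. ereal (1 / fact (n + 1)) * interaction V (n + 2) K \<mu>))"

end

theory Submission
  imports Defs "HOL-Combinatorics.Multiset_Permutations"
begin

text \<open>
  The proof rests on three properties of the intensity \<open>\<kappa>\<close>. By the finite range of the potentials,
  \<open>\<kappa>(K, \<mu>)\<close> is determined by the finitely many points of \<open>\<mu>\<close> within distance \<open>R\<close> of \<open>K\<close>. By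
  their symmetry, adding two points to a finite configuration gives the same product of intensities
  in either order, so \<open>\<kappa>\<close> is the quotient of successive Boltzmann factors. By local stability
  \<open>\<kappa>(K, \<cdot>) \<le> \<theta>(K)\<close>; replacing the reference measure \<open>\<Lambda>\<close> by \<open>M = \<theta>\<Lambda>\<close> and \<open>\<kappa>\<close> by \<open>\<kappa>/\<theta>\<close> gives
  an intensity bounded by 1 with respect to a locally finite measure.

  The space is cut into bounded shells \<open>D k\<close>, and a configuration is coded by the sequence of its
  restrictions to the shells, so that the Poisson process with intensity \<open>M\<close> is a product measure;
  it satisfies the Mecke formula (\<open>mecke\<close>). Weighting it with the Boltzmann factor of the first
  \<open>n\<close> shells gives a finite-volume Gibbs measure, which inherits the Gibbs equation in these shells
  (\<open>gibbs_gnz\<close>). Deleting points only increases the Boltzmann factor because the intensity is at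
  most 1, and therefore the first \<open>m\<close> shells have, under every later finite-volume measure, a law
  that is at most a fixed multiple of the Poisson law (\<open>gibbs_dominated\<close>).

  By compactness of a product of unit intervals, the finite-volume probabilities of all events
  converge simultaneously along some filter. The uniform domination turns the finitely additive
  limits on finitely many shells into measures with Poisson densities, and the conditional
  densities are kernels from which the theorem of Ionescu-Tulcea builds one measure on the space of
  all codes (\<open>extend_projective_density\<close>, \<open>infinite_volume_limit\<close>). For local events on which the
  number of points in a shell is bounded, both sides of the Gibbs equation are expectations of
  bounded local functions, by finite range, and so the equation passes to the limit; a generator
  argument extends it to all test functions (\<open>limit_gnz_shell\<close>).

  It remains to see that the Papangelou intensity given by factorial measures is the one computed
  from finite multisets of points (\<open>papangelou_eq_activity\<close>).
\<close>


section \<open>Consistent families with densities, and cluster points\<close>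

text \<open>
  Each \<open>N m\<close> has a density \<open>p m\<close>. Given the first \<open>m\<close> coordinates, the density of the next one is
  \<open>p (Suc m)\<close> divided by its integral \<open>q m\<close> over that coordinate. These
  quotients are regular conditional distributions, so the theorem of Ionescu-Tulcea applies.
\<close>

lemma extend_projective_density:
  fixes \<pi> :: "nat \<Rightarrow> 'a measure" and N :: "nat \<Rightarrow> (nat \<Rightarrow> 'a) measure"
  assumes \<pi>: "\<And>k. prob_space (\<pi> k)"
    and N: "\<And>m. prob_space (N m)"
    and sets_N: "\<And>m. sets (N m) = sets (PiM {0..<m} \<pi>)"
    and ac: "\<And>m. absolutely_continuous (PiM {0..<m} \<pi>) (N m)"
    and proj: "\<And>m. distr (N (Suc m)) (PiM {0..<m} \<pi>) (\<lambda>w. restrict w {0..<m}) = N m"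
  shows "\<exists>P. prob_space P \<and> sets P = sets (PiM UNIV \<pi>) \<and>
    (\<forall>m. distr P (PiM {0..<m} \<pi>) (\<lambda>w. restrict w {0..<m}) = N m)"
proof -
  interpret \<pi>: prob_space "\<pi> k" for k by (rule \<pi>)
  interpret PP: product_prob_space \<pi> UNIV by unfold_locales
  let ?T = "\<lambda>m. PiM {0..<m} \<pi>"
  interpret T: prob_space "?T m" for m by (rule prob_space_PiM) (rule \<pi>)
  have "\<exists>f\<in>borel_measurable (?T m). density (?T m) f = N m" for m
    by (rule T.Radon_Nikodym[OF ac sets_N])
  then obtain p where p[measurable]: "\<And>m. p m \<in> borel_measurable (?T m)"
    and pN: "\<And>m. density (?T m) (p m) = N m" by metis
  have upd[measurable]: "(\<lambda>x. (fst x)(m := snd x)) \<in> measurable (?T m \<Otimes>\<^sub>M \<pi> m) (?T (Suc m))" for m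
    by (rule measurable_fun_upd[where J="{0..<m}"]) auto
  have upd2[measurable]: "(\<lambda>y. w(m := y)) \<in> measurable (\<pi> m) (?T (Suc m))"
    if "w \<in> space (?T m)" for m w
    using that by (intro measurable_fun_upd[where J="{0..<m}"]) auto
  define q where "q m w = (\<integral>\<^sup>+y. p (Suc m) (w(m := y)) \<partial>\<pi> m)" for m w
  have q[measurable]: "q m \<in> borel_measurable (?T m)" for m
    unfolding q_def by measurable
  have split: "(\<integral>\<^sup>+w. f w \<partial>N (Suc m)) = (\<integral>\<^sup>+w. \<integral>\<^sup>+y. f (w(m := y)) * p (Suc m) (w(m := y)) \<partial>\<pi> m \<partial>?T m)"
    if f[measurable]: "f \<in> borel_measurable (?T (Suc m))" for f m
  proof -
    have e: "{0..<Suc m} = insert m {0..<m}" by auto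
    have "(\<integral>\<^sup>+w. f w \<partial>N (Suc m)) = (\<integral>\<^sup>+w. p (Suc m) w * f w \<partial>?T (Suc m))"
      unfolding pN[symmetric] by (subst nn_integral_density) auto
    also have "\<dots> = (\<integral>\<^sup>+w. \<integral>\<^sup>+y. p (Suc m) (w(m := y)) * f (w(m := y)) \<partial>\<pi> m \<partial>?T m)"
      unfolding e
      by (rule PP.product_nn_integral_insert) (auto simp: e[symmetric])
    finally show ?thesis by (simp add: mult.commute)
  qed
  have Nq: "density (?T m) (q m) = N m" for m
  proof (rule measure_eqI)
    show "sets (density (?T m) (q m)) = sets (N m)" by (simp add: sets_N)
    fix A assume "A \<in> sets (density (?T m) (q m))"
    then have A[measurable]: "A \<in> sets (?T m)" by simp
    have r[measurable]: "(\<lambda>w. restrict w {0..<m}) \<in> measurable (?T (Suc m)) (?T m)"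
      by (intro measurable_restrict) auto
    have r': "(\<lambda>w. restrict w {0..<m}) \<in> measurable (N (Suc m)) (?T m)"
      using r measurable_cong_sets[OF sets_N refl] by blast
    have "emeasure (N m) A = (\<integral>\<^sup>+w. indicator A w \<partial>distr (N (Suc m)) (?T m) (\<lambda>w. restrict w {0..<m}))"
      unfolding proj by (simp add: sets_N)
    also have "\<dots> = (\<integral>\<^sup>+w. indicator A (restrict w {0..<m}) \<partial>N (Suc m))"
      by (subst nn_integral_distr) (auto intro: r')
    also have "\<dots> = (\<integral>\<^sup>+w. \<integral>\<^sup>+y. indicator A (restrict (w(m := y)) {0..<m}) * p (Suc m) (w(m := y)) \<partial>\<pi> m \<partial>?T m)"
      by (rule split) measurable
    also have "\<dots> = (\<integral>\<^sup>+w. indicator A w * q m w \<partial>?T m)"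
    proof (rule nn_integral_cong)
      fix w assume w[measurable]: "w \<in> space (?T m)"
      have "restrict (w(m := y)) {0..<m} = w" for y
        using w by (auto simp: space_PiM PiE_iff restrict_def extensional_def)
      then show "(\<integral>\<^sup>+y. indicator A (restrict (w(m := y)) {0..<m}) * p (Suc m) (w(m := y)) \<partial>\<pi> m) = indicator A w * q m w"
        unfolding q_def by (simp add: nn_integral_cmult)
    qed
    also have "\<dots> = emeasure (density (?T m) (q m)) A"
      by (subst emeasure_density) (auto simp: mult.commute)
    finally show "emeasure (density (?T m) (q m)) A = emeasure (N m) A" by simp
  qed
  \<comment> \<open>This set has probability zero under \<open>N m\<close>, so any value of the kernel there will do.\<close>
  define bad where "bad m = {w \<in> space (?T m). q m w = 0 \<or> q m w = \<infinity>}" for m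
  have [measurable]: "bad m \<in> sets (?T m)" for m unfolding bad_def by measurable
  define K where "K m w = (if w \<in> bad m then \<pi> m else density (\<pi> m) (\<lambda>y. p (Suc m) (w(m := y)) / q m w))" for m w
  have K_prob: "prob_space (K m w)" if w[measurable]: "w \<in> space (?T m)" for m w
  proof (cases "w \<in> bad m")
    case True then show ?thesis by (simp add: K_def \<pi>)
  next
    case False
    then have q0: "q m w \<noteq> 0" "q m w \<noteq> \<infinity>" using w by (auto simp: bad_def)
    have "emeasure (density (\<pi> m) (\<lambda>y. p (Suc m) (w(m := y)) / q m w)) (space (\<pi> m)) =
       (\<integral>\<^sup>+y. p (Suc m) (w(m := y)) / q m w \<partial>\<pi> m)"
      by (subst emeasure_density) (auto intro!: nn_integral_cong)
    also have "\<dots> = 1"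
      using q0 by (subst nn_integral_divide) (auto simp: q_def[symmetric] ennreal_divide_self less_top)
    finally show ?thesis using False by (auto intro!: prob_spaceI simp: K_def)
  qed
  have K_sets: "sets (K m w) = sets (\<pi> m)" for m w by (simp add: K_def)
  have K_meas: "K m \<in> measurable (?T m) (subprob_algebra (\<pi> m))" for m
  proof (rule measurable_subprob_algebra)
    show "subprob_space (K m w)" if "w \<in> space (?T m)" for w
      using K_prob[OF that] by (rule prob_space_imp_subprob_space)
    show "sets (K m w) = sets (\<pi> m)" for w by (rule K_sets)
    fix A assume A[measurable]: "A \<in> sets (\<pi> m)"
    have "(\<lambda>w. if w \<in> bad m then emeasure (\<pi> m) A
        else \<integral>\<^sup>+y. p (Suc m) (w(m := y)) / q m w * indicator A y \<partial>\<pi> m) \<in> borel_measurable (?T m)"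
      by measurable
    moreover have "(\<lambda>w. emeasure (K m w) A) \<in> borel_measurable (?T m) \<longleftrightarrow>
       (\<lambda>w. if w \<in> bad m then emeasure (\<pi> m) A
        else \<integral>\<^sup>+y. p (Suc m) (w(m := y)) / q m w * indicator A y \<partial>\<pi> m) \<in> borel_measurable (?T m)"
    proof (rule measurable_cong)
      fix w assume [measurable]: "w \<in> space (?T m)"
      show "emeasure (K m w) A = (if w \<in> bad m then emeasure (\<pi> m) A
        else \<integral>\<^sup>+y. p (Suc m) (w(m := y)) / q m w * indicator A y \<partial>\<pi> m)"
        by (auto simp: K_def emeasure_density)
    qed
    ultimately show "(\<lambda>w. emeasure (K m w) A) \<in> borel_measurable (?T m)"
      by blast
  qed
  interpret IT: Ionescu_Tulcea K \<pi>
    by (rule Ionescu_Tulcea.intro) (rule K_meas, rule K_prob)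
  have C: "IT.C 0 m (\<lambda>_. undefined) = N m" for m
  proof (induction m)
    case 0
    interpret N0: prob_space "N 0" by (rule N)
    show ?case
    proof (rule measure_eqI)
      show "sets (IT.C 0 0 (\<lambda>_. undefined)) = sets (N 0)" by (simp add: sets_N)
      fix A assume "A \<in> sets (IT.C 0 0 (\<lambda>_. undefined))"
      then have A: "A \<in> sets (?T 0)" by simp
      have sp: "space (N 0) = {\<lambda>_. undefined}" using sets_eq_imp_space_eq[OF sets_N[of 0]] by (simp add: space_PiM)
      have "A \<subseteq> {\<lambda>_. undefined}" using sets.sets_into_space[OF A] by (simp add: space_PiM)
      then have "A = {} \<or> A = {\<lambda>_. undefined}" by auto
      then show "emeasure (IT.C 0 0 (\<lambda>_. undefined)) A = emeasure (N 0) A"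
        using N0.emeasure_space_1 A by (auto simp: sp)
    qed
  next
    case (Suc m)
    show ?case
    proof (rule measure_eqI)
      have w0: "(\<lambda>_. undefined) \<in> space (?T 0)" by (simp add: space_PiM)
      show "sets (IT.C 0 (Suc m) (\<lambda>_. undefined)) = sets (N (Suc m))"
        using IT.sets_C[OF w0, of "Suc m"] sets_N by auto
      fix A assume "A \<in> sets (IT.C 0 (Suc m) (\<lambda>_. undefined))"
      then have A[measurable]: "A \<in> sets (?T (Suc m))"
        using IT.sets_C[OF w0, of "Suc m"] by auto
      have eP: "IT.eP m \<in> measurable (N m) (subprob_algebra (?T (Suc m)))"
        using IT.measurable_eP[of m] measurable_cong_sets[OF sets_N refl] by blast
      have ne: "space (N m) \<noteq> {}" using prob_space.not_empty[OF N] .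
      have "emeasure (IT.C 0 (Suc m) (\<lambda>_. undefined)) A = (\<integral>\<^sup>+w. emeasure (IT.eP m w) A \<partial>N m)"
        using Suc by (simp add: emeasure_bind[OF ne eP A])
      also have "\<dots> = (\<integral>\<^sup>+w. q m w * emeasure (IT.eP m w) A \<partial>?T m)"
        unfolding Nq[symmetric]
        by (subst nn_integral_density) auto
      also have "\<dots> = (\<integral>\<^sup>+w. \<integral>\<^sup>+y. indicator A (w(m := y)) * p (Suc m) (w(m := y)) \<partial>\<pi> m \<partial>?T m)"
      proof (rule nn_integral_cong_AE)
        have "(\<integral>\<^sup>+w. q m w \<partial>?T m) = emeasure (density (?T m) (q m)) (space (?T m))"
          by (subst emeasure_density) (auto intro!: nn_integral_cong)
        also have "\<dots> = 1"
          unfolding Nq using prob_space.emeasure_space_1[OF N, of m] sets_eq_imp_space_eq[OF sets_N] by metis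
        finally have "AE w in ?T m. q m w \<noteq> \<infinity>"
          by (intro nn_integral_noteq_infinite) auto
        then show "AE w in ?T m. q m w * emeasure (IT.eP m w) A =
           (\<integral>\<^sup>+y. indicator A (w(m := y)) * p (Suc m) (w(m := y)) \<partial>\<pi> m)"
        proof (rule AE_mp, intro AE_I2 impI)
          fix w assume w[measurable]: "w \<in> space (?T m)" and fin: "q m w \<noteq> \<infinity>"
          have e: "emeasure (IT.eP m w) A = (\<integral>\<^sup>+y. indicator A (w(m := y)) \<partial>K m w)"
            using IT.nn_integral_eP[OF w, of "indicator A"] w by (simp add: IT.sets_eP)
          show "q m w * emeasure (IT.eP m w) A =
           (\<integral>\<^sup>+y. indicator A (w(m := y)) * p (Suc m) (w(m := y)) \<partial>\<pi> m)"
          proof (cases "q m w = 0")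
            case True
            then have "AE y in \<pi> m. p (Suc m) (w(m := y)) = 0"
              unfolding q_def by (subst (asm) nn_integral_0_iff_AE) auto
            then have "AE y in \<pi> m. indicator A (w(m := y)) * p (Suc m) (w(m := y)) = 0"
              by (rule AE_mp) auto
            then show ?thesis using True by (simp add: nn_integral_0_iff_AE)
          next
            case False
            then have nb: "w \<notin> bad m" using fin by (simp add: bad_def)
            have "q m w * emeasure (IT.eP m w) A =
              q m w * (\<integral>\<^sup>+y. p (Suc m) (w(m := y)) / q m w * indicator A (w(m := y)) \<partial>\<pi> m)"
              unfolding e using nb by (simp add: K_def nn_integral_density)
            also have "\<dots> = (\<integral>\<^sup>+y. q m w * (p (Suc m) (w(m := y)) / q m w * indicator A (w(m := y))) \<partial>\<pi> m)"
              by (subst nn_integral_cmult) auto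
            also have "\<dots> = (\<integral>\<^sup>+y. indicator A (w(m := y)) * p (Suc m) (w(m := y)) \<partial>\<pi> m)"
            proof (rule nn_integral_cong)
              fix y
              have "q m w * (p (Suc m) (w(m := y)) / q m w) = p (Suc m) (w(m := y)) * q m w / q m w"
                by (simp only: ennreal_times_divide mult.commute)
              also have "\<dots> = p (Suc m) (w(m := y))"
                using False fin by (intro mult_divide_eq_ennreal) auto
              finally show "q m w * (p (Suc m) (w(m := y)) / q m w * indicator A (w(m := y)))
                = indicator A (w(m := y)) * p (Suc m) (w(m := y))"
                by (simp only: mult.assoc[symmetric]) (simp only: mult.commute)
            qed
            finally show ?thesis .
          qed
        qed
      qed
      also have "\<dots> = (\<integral>\<^sup>+w. indicator A w \<partial>N (Suc m))"
        by (rule split[symmetric]) measurable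
      also have "\<dots> = emeasure (N (Suc m)) A" by (simp add: sets_N)
      finally show "emeasure (IT.C 0 (Suc m) (\<lambda>_. undefined)) A = emeasure (N (Suc m)) A" .
    qed
  qed
  have lim: "distr IT.PF.lim (?T m) (\<lambda>w. restrict w {0..<m}) = N m" for m
  proof -
    have "distr IT.PF.lim (?T m) (\<lambda>w. restrict w {0..<m}) = IT.CI {0..<m}"
      by (rule IT.distr_lim) simp
    also have "\<dots> = N m"
    proof (rule measure_eqI)
      show "sets (IT.CI {0..<m}) = sets (N m)" by (simp add: IT.CI_def sets_N)
      fix A assume "A \<in> sets (IT.CI {0..<m})"
      then have A: "A \<in> sets (?T m)" by (simp add: IT.CI_def)
      have "emeasure (IT.CI {0..<m}) A = emeasure (IT.C 0 m (\<lambda>_. undefined)) (prod_emb {0..<m} \<pi> {0..<m} A)"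
        using A by (intro IT.emeasure_CI) auto
      also have "prod_emb {0..<m} \<pi> {0..<m} A = A"
        using sets.sets_into_space[OF A] by (intro prod_emb_id) (auto simp: space_PiM)
      finally show "emeasure (IT.CI {0..<m}) A = emeasure (N m) A" by (simp add: C)
    qed
    finally show ?thesis .
  qed
  have "prob_space IT.PF.lim"
  proof (rule prob_space_distrD)
    show "prob_space (distr IT.PF.lim (?T 0) (\<lambda>w. restrict w {0..<0}))"
      unfolding lim by (rule N)
    show "(\<lambda>w. restrict w {0..<0}) \<in> measurable IT.PF.lim (?T 0)"
      unfolding measurable_cong_sets[OF IT.PF.sets_lim refl] by (intro measurable_restrict) auto
  qed
  then show ?thesis using lim IT.PF.sets_lim by blast
qed

text \<open>
  Tychonoff's theorem replaces a diagonal argument: the index set may be uncountable, at the price of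
  convergence along a filter instead of a subsequence.
\<close>

lemma cluster_filter:
  fixes a :: "nat \<Rightarrow> 'i \<Rightarrow> real"
  assumes a: "\<And>n i. 0 \<le> a n i \<and> a n i \<le> 1"
  shows "\<exists>F l. F \<noteq> bot \<and> F \<le> sequentially \<and> (\<forall>i. ((\<lambda>n. a n i) \<longlongrightarrow> l i) F)"
proof -
  have "compactin (product_topology (\<lambda>_. euclidean) UNIV) (PiE UNIV (\<lambda>_::'i. {0..1::real}))"
    by (subst compactin_PiE) auto
  then have c: "compact (PiE UNIV (\<lambda>_::'i. {0..1::real}))"
    by (simp add: euclidean_product_topology)
  have "eventually (\<lambda>x. x \<in> PiE UNIV (\<lambda>_::'i. {0..1::real})) (filtermap a sequentially)"
    using a by (auto simp: eventually_filtermap PiE_iff)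
  moreover have "filtermap a sequentially \<noteq> bot" by (simp add: filtermap_bot_iff)
  ultimately obtain x where x: "inf (nhds x) (filtermap a sequentially) \<noteq> bot"
    using c unfolding compact_filter by blast
  define F where "F = inf (filtercomap a (nhds x)) sequentially"
  have "F \<noteq> bot"
  proof
    assume "F = bot"
    then have "eventually (\<lambda>_. False) F" by simp
    then obtain Q R where Q: "eventually Q (filtercomap a (nhds x))" and R: "eventually R sequentially"
      and QR: "\<And>n. Q n \<Longrightarrow> R n \<Longrightarrow> False"
      unfolding F_def eventually_inf by blast
    obtain Q' where Q': "eventually Q' (nhds x)" "\<And>n. Q' (a n) \<Longrightarrow> Q n"
      using Q unfolding eventually_filtercomap by blast
    have "eventually (\<lambda>y. \<not> Q' y) (filtermap a sequentially)"
      unfolding eventually_filtermap using R by eventually_elim (use Q' QR in blast)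
    then have "eventually (\<lambda>_. False) (inf (nhds x) (filtermap a sequentially))"
      unfolding eventually_inf using Q'(1) by blast
    then show False using x by (simp add: trivial_limit_def[symmetric])
  qed
  moreover have "F \<le> sequentially" by (simp add: F_def)
  moreover have "((\<lambda>n. a n i) \<longlongrightarrow> x i) F" for i
  proof -
    have "filterlim a (nhds x) F"
      unfolding F_def filterlim_iff_le_filtercomap by simp
    then have lim: "(a \<longlongrightarrow> x) F" .
    show ?thesis
    proof (rule topological_tendstoI)
      fix S :: "real set" assume S: "open S" "x i \<in> S"
      have "open ((\<lambda>y. y i) -` S)"
        using open_vimage[OF S(1) continuous_on_product_coordinates[of i]] .
      then have "eventually (\<lambda>n. a n \<in> (\<lambda>y. y i) -` S) F"
        using S by (intro topological_tendstoD[OF lim]) auto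
      then show "eventually (\<lambda>n. a n i \<in> S) F" by simp
    qed
  qed
  ultimately show ?thesis by blast
qed

section \<open>Poisson processes and the Mecke formula\<close>

lemma measurable_PiM_mix:
  "(\<lambda>(w, w') i. if i \<in> S then w i else w' i) \<in> measurable (PiM UNIV N \<Otimes>\<^sub>M PiM UNIV N) (PiM UNIV N)"
proof (rule measurable_PiM_single')
  show "(\<lambda>x. (case x of (w, w') \<Rightarrow> \<lambda>i. if i \<in> S then w i else w' i) i)
      \<in> measurable (PiM UNIV N \<Otimes>\<^sub>M PiM UNIV N) (N i)" for i
    by (cases "i \<in> S") (simp_all add: case_prod_beta')
  show "(\<lambda>(w, w') i. if i \<in> S then w i else w' i)
      \<in> space (PiM UNIV N \<Otimes>\<^sub>M PiM UNIV N) \<rightarrow> (\<Pi>\<^sub>E i\<in>UNIV. space (N i))"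
    by (auto simp: space_pair_measure space_PiM PiE_iff)
qed

text \<open>
  Taking the coordinates in \<open>S\<close> from one sample and the others from an independent sample does not
  change the law of a product measure. With a singleton this resamples one coordinate, with an initial
  segment it separates the first coordinates from the later ones.
\<close>

lemma PiM_mix:
  fixes N :: "'i \<Rightarrow> 'a measure"
  assumes N: "\<And>i. prob_space (N i)"
  shows "distr (PiM UNIV N \<Otimes>\<^sub>M PiM UNIV N) (PiM UNIV N) (\<lambda>(w, w') i. if i \<in> S then w i else w' i) = PiM UNIV N"
    (is "?D = ?P")
proof -
  interpret N: prob_space "N i" for i by (rule N)
  interpret PP: product_prob_space N UNIV by unfold_locales
  let ?f = "\<lambda>(w, w') i. if i \<in> S then w i else w' i"
  note f = measurable_PiM_mix[of S N]
  show ?thesis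
  proof (rule PP.PiM_eq)
    show "sets ?D = sets ?P" by simp
    fix J F assume J: "finite J" "J \<subseteq> UNIV" and F: "\<And>j. j \<in> J \<Longrightarrow> F j \<in> sets (N j)"
    let ?X = "prod_emb UNIV N J (Pi\<^sub>E J F)"
    let ?E = "prod_emb UNIV N (J \<inter> S) (Pi\<^sub>E (J \<inter> S) F)"
    let ?G = "prod_emb UNIV N (J - S) (Pi\<^sub>E (J - S) F)"
    have sub: "j \<in> J \<Longrightarrow> x \<in> F j \<Longrightarrow> x \<in> space (N j)" for j x
      using F sets.sets_into_space by blast
    have X: "?X \<in> sets ?P" using J F by (intro sets_PiM_I) auto
    have "emeasure ?D ?X = emeasure (?P \<Otimes>\<^sub>M ?P) (?f -` ?X \<inter> space (?P \<Otimes>\<^sub>M ?P))"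
      by (rule emeasure_distr[OF f X])
    also have "?f -` ?X \<inter> space (?P \<Otimes>\<^sub>M ?P) = ?E \<times> ?G"
      using sub by (auto simp: prod_emb_def space_pair_measure space_PiM PiE_iff split: if_splits)
    also have "emeasure (?P \<Otimes>\<^sub>M ?P) (?E \<times> ?G) = emeasure ?P ?E * emeasure ?P ?G"
      using J F by (intro PP.P.emeasure_pair_measure_Times sets_PiM_I) auto
    also have "\<dots> = (\<Prod>j\<in>J \<inter> S. emeasure (N j) (F j)) * (\<Prod>j\<in>J - S. emeasure (N j) (F j))"
      using J F by (intro arg_cong2[where f="(*)"] PP.emeasure_PiM_emb) auto
    also have "\<dots> = (\<Prod>j\<in>J. emeasure (N j) (F j))"
      using J(1) by (rule prod.Int_Diff[symmetric])
    finally show "emeasure ?D ?X = (\<Prod>j\<in>J. emeasure (N j) (F j))" .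
  qed
qed

lemma nn_integral_PiM_mix:
  fixes N :: "'i \<Rightarrow> 'a measure"
  assumes N: "\<And>i. prob_space (N i)" and h[measurable]: "h \<in> borel_measurable (PiM UNIV N)"
  shows "(\<integral>\<^sup>+w. h w \<partial>PiM UNIV N) =
    (\<integral>\<^sup>+w. \<integral>\<^sup>+w'. h (\<lambda>i. if i \<in> S then w i else w' i) \<partial>PiM UNIV N \<partial>PiM UNIV N)"
proof -
  let ?P = "PiM UNIV N"
  interpret P: prob_space ?P by (rule prob_space_PiM) (rule N)
  let ?f = "\<lambda>(w, w') i. if i \<in> S then w i else w' i"
  note measurable_PiM_mix[of S N, measurable]
  have "(\<integral>\<^sup>+w. h w \<partial>?P) = (\<integral>\<^sup>+x. h (?f x) \<partial>(?P \<Otimes>\<^sub>M ?P))"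
    by (subst PiM_mix[where S=S, OF N, symmetric], subst nn_integral_distr) auto
  also have "\<dots> = (\<integral>\<^sup>+w. \<integral>\<^sup>+w'. h (?f (w, w')) \<partial>?P \<partial>?P)"
    by (rule P.nn_integral_fst[symmetric]) measurable
  finally show ?thesis by simp
qed

lemma nn_integral_PiM_resample:
  fixes N :: "'i \<Rightarrow> 'a measure"
  assumes N: "\<And>i. prob_space (N i)" and h[measurable]: "h \<in> borel_measurable (PiM UNIV N)"
  shows "(\<integral>\<^sup>+w. h w \<partial>PiM UNIV N) = (\<integral>\<^sup>+w. \<integral>\<^sup>+y. h (w(k := y)) \<partial>N k \<partial>PiM UNIV N)"
proof -
  let ?P = "PiM UNIV N"
  interpret N: prob_space "N i" for i by (rule N)
  have *: "(\<lambda>i. if i \<in> - {k} then w i else w' i) = w(k := w' k)" for w w' :: "'i \<Rightarrow> 'a"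
    by auto
  have "(\<integral>\<^sup>+w. h w \<partial>?P) = (\<integral>\<^sup>+w. \<integral>\<^sup>+w'. h (w(k := w' k)) \<partial>?P \<partial>?P)"
    using nn_integral_PiM_mix[where S="- {k}", OF N h] by (simp only: *)
  also have "\<dots> = (\<integral>\<^sup>+w. \<integral>\<^sup>+y. h (w(k := y)) \<partial>N k \<partial>?P)"
  proof (rule nn_integral_cong)
    fix w assume w[measurable]: "w \<in> space ?P"
    have [measurable]: "(\<lambda>y. w(k := y)) \<in> measurable (N k) ?P"
      using w by (intro measurable_fun_upd[where J="UNIV"]) auto
    have "(\<integral>\<^sup>+y. h (w(k := y)) \<partial>N k) = (\<integral>\<^sup>+y. h (w(k := y)) \<partial>distr ?P (N k) (\<lambda>w. w k))"
      by (subst distr_PiM_component[OF N]) auto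
    also have "\<dots> = (\<integral>\<^sup>+w'. h (w(k := w' k)) \<partial>?P)"
      by (subst nn_integral_distr) auto
    finally show "(\<integral>\<^sup>+w'. h (w(k := w' k)) \<partial>?P) = (\<integral>\<^sup>+y. h (w(k := y)) \<partial>N k)" ..
  qed
  finally show ?thesis .
qed

text \<open>
  A finite list of points, coded by its length and an infinite sequence of which only an initial
  segment is read. A Poisson process in a bounded set then is a Poisson number together with an
  independent sequence of independent points.
\<close>

type_synonym 'b code = "nat \<times> (nat \<Rightarrow> 'b)"

abbreviation code_space :: "'b::metric_space code measure" where
  "code_space \<equiv> count_space UNIV \<Otimes>\<^sub>M PiM UNIV (\<lambda>_. borel)"

lemma space_code_space[simp]: "space code_space = UNIV"
  by (simp add: space_pair_measure space_PiM)

text \<open>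
  The points outside \<open>C\<close> are discarded, so that every code is meaningful even on null sets.
\<close>

definition shell :: "'b set \<Rightarrow> 'b code \<Rightarrow> 'b multiset" where
  "shell C y = filter_mset (\<lambda>x. x \<in> C) (mset (map (snd y) [0..<fst y]))"

definition add_point :: "'b \<Rightarrow> 'b code \<Rightarrow> 'b code" where
  "add_point x y = (Suc (fst y), case_nat x (snd y))"

lemma shell_add_point: "shell C (add_point x y) = (if x \<in> C then add_mset x (shell C y) else shell C y)"
proof -
  have "map (case_nat x xs) [0..<Suc n] = x # map xs [0..<n]" for xs :: "nat \<Rightarrow> 'a" and n
    by (subst map_upt_Suc) simp
  then show ?thesis by (simp add: shell_def add_point_def)
qed

lemma shell_permute:
  assumes "\<tau> permutes {..<n}"
  shows "shell C (n, \<lambda>i. xs (\<tau> i)) = shell C (n, xs)"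
proof -
  have m: "mset (map f [0..<n]) = image_mset f (mset_set {..<n})" for f :: "nat \<Rightarrow> 'a"
    by (metis mset_map mset_upt atLeast0LessThan mset_set_upto_eq_mset_upto)
  have "image_mset (\<lambda>i. xs (\<tau> i)) (mset_set {..<n}) = image_mset xs (image_mset \<tau> (mset_set {..<n}))"
    by (simp add: multiset.map_comp comp_def)
  also have "image_mset \<tau> (mset_set {..<n}) = mset_set {..<n}"
    using assms by (subst image_mset_mset_set) (auto simp: permutes_image permutes_inj_on)
  finally show ?thesis by (simp only: shell_def m fst_conv snd_conv)
qed

lemma size_filter_shell:
  "(of_nat (size (filter_mset (\<lambda>x. x \<in> A) (shell C y))) :: ennreal) = (\<Sum>i<fst y. indicator (A \<inter> C) (snd y i))"
proof -
  have "(of_nat (size (filter_mset (\<lambda>x. x \<in> A) (filter_mset (\<lambda>x. x \<in> C) (mset (map f [0..<n]))))) :: ennreal)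
     = (\<Sum>i<n. indicator (A \<inter> C) (f i))" for f :: "nat \<Rightarrow> 'a" and n
    by (induction n) (auto split: split_indicator)
  then show ?thesis by (simp add: shell_def)
qed

lemma measurable_size_filter_shell[measurable]:
  assumes [measurable]: "A \<in> sets borel" "C \<in> sets borel"
  shows "(\<lambda>y. of_nat (size (filter_mset (\<lambda>x. x \<in> A) (shell C y))) :: ennreal) \<in> borel_measurable code_space"
proof -
  have "(\<lambda>y. (\<lambda>n y. \<Sum>i<n. indicator (A \<inter> C) (snd y i) :: ennreal) (fst y) y) \<in> borel_measurable code_space"
    by (rule measurable_compose_countable) measurable
  then show ?thesis by (simp add: size_filter_shell)
qed

lemma measurable_add_point[measurable (raw)]:
  assumes [measurable]: "f \<in> measurable N borel" "g \<in> measurable N code_space"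
  shows "(\<lambda>w. add_point (f w) (g w)) \<in> measurable N code_space"
  unfolding add_point_def
proof (rule measurable_Pair)
  show "(\<lambda>w. Suc (fst (g w))) \<in> measurable N (count_space UNIV)" by measurable
  show "(\<lambda>w. case_nat (f w) (snd (g w))) \<in> measurable N (PiM UNIV (\<lambda>_. borel))"
    by (rule measurable_case_nat') measurable
qed

locale shells =
  fixes M :: "'b::metric_space measure" and D :: "nat \<Rightarrow> 'b set"
  assumes sets_M[measurable_cong]: "sets M = sets borel"
    and D[measurable]: "\<And>k. D k \<in> sets borel"
    and disj: "disjoint_family D"
    and cover: "(\<Union>k. D k) = UNIV"
    and finite_D: "\<And>k. emeasure M (D k) < \<infinity>"
begin

lemma space_M: "space M = UNIV"
  using sets_eq_imp_space_eq[OF sets_M] by simp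

sublocale M: sigma_finite_measure M
proof
  show "\<exists>A. countable A \<and> A \<subseteq> sets M \<and> \<Union>A = space M \<and> (\<forall>a\<in>A. emeasure M a \<noteq> \<infinity>)"
    using finite_D D cover by (intro exI[of _ "range D"]) (auto simp: sets_M space_M less_top)
qed

text \<open>
  A shell of measure zero carries no points, so that any probability measure will do there.
\<close>

definition point_law :: "nat \<Rightarrow> 'b measure" where
  "point_law k = (if emeasure M (D k) = 0 then return borel undefined
     else density M (\<lambda>x. indicator (D k) x / emeasure M (D k)))"

lemma sets_point_law[simp, measurable_cong]: "sets (point_law k) = sets borel"
  by (simp add: point_law_def sets_M)

lemma prob_space_point_law: "prob_space (point_law k)"
proof (cases "emeasure M (D k) = 0")
  case True then show ?thesis by (simp add: point_law_def prob_space_return)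
next
  case False
  have "emeasure (density M (\<lambda>x. indicator (D k) x / emeasure M (D k))) (space M)
     = (\<integral>\<^sup>+x. indicator (D k) x / emeasure M (D k) \<partial>M)"
    by (subst emeasure_density) (auto intro!: nn_integral_cong)
  also have "\<dots> = 1"
    using False finite_D[of k] by (subst nn_integral_divide) (auto simp: ennreal_divide_self sets_M)
  finally show ?thesis using False by (auto intro!: prob_spaceI simp: point_law_def)
qed

lemma nn_integral_point_law:
  assumes f[measurable]: "f \<in> borel_measurable borel"
  shows "emeasure M (D k) * (\<integral>\<^sup>+x. f x \<partial>point_law k) = (\<integral>\<^sup>+x. f x * indicator (D k) x \<partial>M)"
proof (cases "emeasure M (D k) = 0")
  case True
  then have "AE x in M. x \<notin> D k"
    by (subst AE_iff_measurable[where N="D k"]) (auto simp: sets_M space_M)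
  then have "(\<integral>\<^sup>+x. f x * indicator (D k) x \<partial>M) = (\<integral>\<^sup>+x. 0 \<partial>M)"
    by (intro nn_integral_cong_AE) (auto elim!: AE_mp)
  then show ?thesis using True by simp
next
  case False
  have "emeasure M (D k) * (\<integral>\<^sup>+x. f x \<partial>point_law k)
    = (\<integral>\<^sup>+x. emeasure M (D k) * (indicator (D k) x / emeasure M (D k) * f x) \<partial>M)"
    using False by (simp add: point_law_def nn_integral_density nn_integral_cmult)
  also have "\<dots> = (\<integral>\<^sup>+x. f x * indicator (D k) x \<partial>M)"
    using False finite_D[of k]
    by (intro nn_integral_cong)
       (auto split: split_indicator simp: ennreal_times_divide mult.assoc[symmetric] ennreal_divide_self)
  finally show ?thesis .
qed

text \<open>
  The Poisson distribution with parameter \<open>M (D k)\<close>, which may be zero.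
\<close>

definition poisson_weight :: "nat \<Rightarrow> nat \<Rightarrow> real" where
  "poisson_weight k n = exp (- measure M (D k)) * measure M (D k) ^ n / fact n"

lemma poisson_weight_nonneg[simp]: "0 \<le> poisson_weight k n" by (simp add: poisson_weight_def)

text \<open>
  This identity between successive Poisson weights is what makes the Mecke formula hold.
\<close>

lemma poisson_weight_Suc: "ennreal (poisson_weight k (Suc n)) * of_nat (Suc n) = emeasure M (D k) * ennreal (poisson_weight k n)"
proof -
  have "emeasure M (D k) = ennreal (measure M (D k))"
    using finite_D[of k] by (intro emeasure_eq_ennreal_measure) auto
  moreover have "poisson_weight k (Suc n) * real (Suc n) = measure M (D k) * poisson_weight k n"
    by (simp add: poisson_weight_def field_simps del: of_nat_Suc)
  ultimately show ?thesis
    by (metis ennreal_mult'' ennreal_of_nat_eq_real_of_nat of_nat_0_le_iff poisson_weight_nonneg)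
qed

lemma poisson_weight_sum: "(\<Sum>n. ennreal (poisson_weight k n)) = 1"
proof -
  have "(\<lambda>n. exp (- measure M (D k)) * (measure M (D k) ^ n /\<^sub>R fact n)) sums
     (exp (- measure M (D k)) * exp (measure M (D k)))"
    by (intro sums_mult exp_converges)
  then have "(\<lambda>n. poisson_weight k n) sums 1"
    by (simp add: poisson_weight_def divide_inverse mult_ac exp_minus)
  then show ?thesis
    by (metis ennreal_1 suminf_ennreal_eq poisson_weight_nonneg)
qed

definition shell_law :: "nat \<Rightarrow> 'b code measure" where
  "shell_law k = density (count_space UNIV \<Otimes>\<^sub>M PiM UNIV (\<lambda>_. point_law k)) (\<lambda>y. ennreal (poisson_weight k (fst y)))"

lemma sets_shell_law[simp, measurable_cong]: "sets (shell_law k) = sets code_space"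
  unfolding shell_law_def by (auto intro!: sets_pair_measure_cong sets_PiM_cong)

lemma space_shell_law[simp]: "space (shell_law k) = UNIV"
  using sets_eq_imp_space_eq[OF sets_shell_law] by simp

lemma nn_integral_shell_law:
  assumes f[measurable]: "f \<in> borel_measurable code_space"
  shows "(\<integral>\<^sup>+y. f y \<partial>shell_law k) =
    (\<Sum>n. ennreal (poisson_weight k n) * (\<integral>\<^sup>+xs. f (n, xs) \<partial>PiM UNIV (\<lambda>_. point_law k)))"
proof -
  interpret S: prob_space "PiM UNIV (\<lambda>_::nat. point_law k)"
    by (intro prob_space_PiM prob_space_point_law)
  have f': "f \<in> borel_measurable (count_space UNIV \<Otimes>\<^sub>M PiM UNIV (\<lambda>_. point_law k))"
    using f by (subst measurable_cong_sets[where M'=code_space]) (auto intro!: sets_pair_measure_cong sets_PiM_cong)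
  have f''[measurable]: "(\<lambda>xs. f (n, xs)) \<in> borel_measurable (PiM UNIV (\<lambda>_. point_law k))" for n
    using f' by measurable
  have "(\<integral>\<^sup>+y. f y \<partial>shell_law k) =
    (\<integral>\<^sup>+y. ennreal (poisson_weight k (fst y)) * f y \<partial>(count_space UNIV \<Otimes>\<^sub>M PiM UNIV (\<lambda>_. point_law k)))"
    unfolding shell_law_def using f' by (subst nn_integral_density) auto
  also have "\<dots> = (\<integral>\<^sup>+n. \<integral>\<^sup>+xs. ennreal (poisson_weight k (fst (n, xs))) * f (n, xs) \<partial>PiM UNIV (\<lambda>_. point_law k) \<partial>count_space UNIV)"
    using f' by (subst S.nn_integral_fst[symmetric]) auto
  also have "\<dots> = (\<Sum>n. ennreal (poisson_weight k n) * (\<integral>\<^sup>+xs. f (n, xs) \<partial>PiM UNIV (\<lambda>_. point_law k)))"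
    by (simp add: nn_integral_count_space_nat nn_integral_cmult)
  finally show ?thesis .
qed

lemma prob_space_shell_law: "prob_space (shell_law k)"
proof
  interpret S: prob_space "PiM UNIV (\<lambda>_::nat. point_law k)"
    by (intro prob_space_PiM prob_space_point_law)
  have "emeasure (shell_law k) (space (shell_law k)) = (\<integral>\<^sup>+y. 1 \<partial>shell_law k)" by simp
  also have "\<dots> = 1"
    by (subst nn_integral_shell_law) (auto simp: S.emeasure_space_1 poisson_weight_sum)
  finally show "emeasure (shell_law k) (space (shell_law k)) = 1" .
qed

lemma emeasure_shell_law_empty: "emeasure (shell_law k) {y. fst y = 0} > 0"
proof -
  interpret S: prob_space "PiM UNIV (\<lambda>_::nat. point_law k)"
    by (intro prob_space_PiM prob_space_point_law)
  have [measurable]: "{y. fst y = 0} \<in> sets code_space"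
    using measurable_sets[of fst code_space "count_space UNIV" "{0}"] by (auto simp: vimage_def)
  have "ennreal (poisson_weight k 0) = (\<Sum>n. if n = 0 then ennreal (poisson_weight k 0) else 0)"
    using suminf_finite[of "{0}" "\<lambda>n. if n = 0 then ennreal (poisson_weight k 0) else 0"] by auto
  also have "\<dots> = (\<integral>\<^sup>+y. indicator {y. fst y = 0} y \<partial>shell_law k)"
    by (subst nn_integral_shell_law) (auto intro!: suminf_cong simp: S.emeasure_space_1)
  also have "\<dots> = emeasure (shell_law k) {y. fst y = 0}" by simp
  finally have "emeasure (shell_law k) {y. fst y = 0} = ennreal (poisson_weight k 0)" ..
  then show ?thesis by (simp add: poisson_weight_def)
qed

text \<open>
  Given the number of points, the sequence of points is exchangeable, so each of the \<open>n\<close> points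
  contributes as much as the first one. Splitting off the first point leaves a sequence with the same
  law, and the factor \<open>n\<close> lowers the Poisson weight from \<open>n\<close> to \<open>n - 1\<close>.
\<close>

lemma mecke_shell:
  assumes u[measurable]: "u \<in> borel_measurable code_space"
    and inv: "\<And>y y'. shell (D k) y = shell (D k) y' \<Longrightarrow> u y = u y'"
    and A[measurable]: "A \<in> sets borel"
  shows "(\<integral>\<^sup>+y. of_nat (size (filter_mset (\<lambda>x. x \<in> A) (shell (D k) y))) * u y \<partial>shell_law k) =
    (\<integral>\<^sup>+y. \<integral>\<^sup>+x. u (add_point x y) * indicator (A \<inter> D k) x \<partial>M \<partial>shell_law k)"
proof -
  let ?S = "PiM UNIV (\<lambda>_::nat. point_law k)"
  interpret PL: prob_space "point_law k" by (rule prob_space_point_law)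
  interpret SS: sequence_space "point_law k" by unfold_locales
  let ?i = "\<lambda>x. indicator (A \<inter> D k) x :: ennreal"
  have un[measurable]: "(\<lambda>xs. u (n, xs)) \<in> borel_measurable ?S" for n
    using u by measurable
  have [measurable]: "(\<lambda>y. \<integral>\<^sup>+x. u (add_point x y) * indicator (A \<inter> D k) x \<partial>M) \<in> borel_measurable code_space"
    by measurable
  define J where "J n = (\<integral>\<^sup>+xs. ?i (xs 0) * u (n, xs) \<partial>?S)" for n
  have swap: "(\<integral>\<^sup>+xs. ?i (xs i) * u (n, xs) \<partial>?S) = J n" if i: "i < n" for i n
  proof -
    let ?t = "Transposition.transpose 0 i"
    have perm: "?t permutes {..<n}" using i by (intro permutes_swap_id) auto
    have d: "distr ?S ?S (\<lambda>w. \<lambda>j\<in>UNIV. w (?t j)) = ?S"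
      by (rule distr_PiM_reindex[OF prob_space_point_law]) (auto intro: permutes_inj_on[OF perm])
    have m: "(\<lambda>w j. w (?t j)) \<in> measurable ?S ?S"
      by (intro measurable_PiM_single') (auto simp: space_PiM)
    have "J n = (\<integral>\<^sup>+xs. ?i (xs 0) * u (n, xs) \<partial>distr ?S ?S (\<lambda>w. \<lambda>j\<in>UNIV. w (?t j)))"
      unfolding d J_def ..
    also have "\<dots> = (\<integral>\<^sup>+xs. ?i (xs (?t 0)) * u (n, \<lambda>j. xs (?t j)) \<partial>?S)"
      using m by (subst nn_integral_distr) (auto simp: restrict_UNIV)
    also have "\<dots> = (\<integral>\<^sup>+xs. ?i (xs i) * u (n, xs) \<partial>?S)"
      using inv[OF shell_permute[OF perm]] by simp
    finally show ?thesis ..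
  qed
  have J_Suc: "J (Suc n) = (\<integral>\<^sup>+xs. \<integral>\<^sup>+x. ?i x * u (add_point x (n, xs)) \<partial>point_law k \<partial>?S)" for n
  proof -
    have [measurable]: "(\<lambda>(x, xs). case_nat x xs) \<in> measurable (point_law k \<Otimes>\<^sub>M ?S) ?S"
      unfolding case_prod_beta' by (rule measurable_case_nat') measurable
    have "J (Suc n) = (\<integral>\<^sup>+z. ?i ((\<lambda>(x, xs). case_nat x xs) z 0) * u (Suc n, (\<lambda>(x, xs). case_nat x xs) z) \<partial>(point_law k \<Otimes>\<^sub>M ?S))"
      unfolding J_def by (subst SS.PiM_iter[symmetric], subst nn_integral_distr) auto
    also have "\<dots> = (\<integral>\<^sup>+z. ?i (fst z) * u (add_point (fst z) (n, snd z)) \<partial>(point_law k \<Otimes>\<^sub>M ?S))"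
      by (intro nn_integral_cong) (auto simp: add_point_def)
    also have "\<dots> = (\<integral>\<^sup>+x. \<integral>\<^sup>+xs. ?i x * u (add_point x (n, xs)) \<partial>?S \<partial>point_law k)"
      by (subst SS.P.nn_integral_fst[symmetric]) auto
    also have "\<dots> = (\<integral>\<^sup>+xs. \<integral>\<^sup>+x. ?i x * u (add_point x (n, xs)) \<partial>point_law k \<partial>?S)"
    proof -
      interpret pair_sigma_finite "point_law k" ?S by unfold_locales
      show ?thesis by (rule Fubini'[symmetric]) measurable
    qed
    finally show ?thesis .
  qed
  have "(\<integral>\<^sup>+y. of_nat (size (filter_mset (\<lambda>x. x \<in> A) (shell (D k) y))) * u y \<partial>shell_law k) =
    (\<Sum>n. ennreal (poisson_weight k n) * (\<integral>\<^sup>+xs. (\<Sum>i<n. ?i (xs i) * u (n, xs)) \<partial>?S))"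
    by (subst nn_integral_shell_law) (auto simp: size_filter_shell sum_distrib_right)
  also have "\<dots> = (\<Sum>n. ennreal (poisson_weight k n) * (of_nat n * J n))"
    by (subst nn_integral_sum) (auto simp: swap)
  also have "\<dots> = (\<Sum>n. ennreal (poisson_weight k (Suc n)) * (of_nat (Suc n) * J (Suc n)))"
  proof -
    have "(\<lambda>n. ennreal (poisson_weight k n) * (of_nat n * J n)) sums
      ((\<Sum>n. ennreal (poisson_weight k (Suc n)) * (of_nat (Suc n) * J (Suc n))) + ennreal (poisson_weight k 0) * (of_nat 0 * J 0))"
      by (rule sums_Suc) (intro summable_sums summableI)
    then show ?thesis by (simp add: sums_unique[symmetric])
  qed
  also have "\<dots> = (\<Sum>n. ennreal (poisson_weight k n) * (emeasure M (D k) * J (Suc n)))"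
    by (simp only: mult.assoc[symmetric] poisson_weight_Suc) (simp only: mult.commute)
  also have "\<dots> = (\<Sum>n. ennreal (poisson_weight k n) * (\<integral>\<^sup>+xs. \<integral>\<^sup>+x. u (add_point x (n, xs)) * ?i x \<partial>M \<partial>?S))"
  proof (intro suminf_cong arg_cong2[where f="(*)"] refl)
    fix n
    have "emeasure M (D k) * J (Suc n) = (\<integral>\<^sup>+xs. emeasure M (D k) * (\<integral>\<^sup>+x. ?i x * u (add_point x (n, xs)) \<partial>point_law k) \<partial>?S)"
      unfolding J_Suc by (rule nn_integral_cmult[symmetric]) measurable
    also have "\<dots> = (\<integral>\<^sup>+xs. \<integral>\<^sup>+x. u (add_point x (n, xs)) * ?i x \<partial>M \<partial>?S)"
    proof (rule nn_integral_cong)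
      fix xs :: "nat \<Rightarrow> 'b"
      have "emeasure M (D k) * (\<integral>\<^sup>+x. ?i x * u (add_point x (n, xs)) \<partial>point_law k)
         = (\<integral>\<^sup>+x. ?i x * u (add_point x (n, xs)) * indicator (D k) x \<partial>M)"
        by (rule nn_integral_point_law) measurable
      also have "\<dots> = (\<integral>\<^sup>+x. u (add_point x (n, xs)) * ?i x \<partial>M)"
        by (intro nn_integral_cong) (auto split: split_indicator)
      finally show "emeasure M (D k) * (\<integral>\<^sup>+x. ?i x * u (add_point x (n, xs)) \<partial>point_law k) = (\<integral>\<^sup>+x. u (add_point x (n, xs)) * ?i x \<partial>M)" .
    qed
    finally show "emeasure M (D k) * J (Suc n) = (\<integral>\<^sup>+xs. \<integral>\<^sup>+x. u (add_point x (n, xs)) * ?i x \<partial>M \<partial>?S)" .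
  qed
  also have "\<dots> = (\<integral>\<^sup>+y. \<integral>\<^sup>+x. u (add_point x y) * indicator (A \<inter> D k) x \<partial>M \<partial>shell_law k)"
    by (subst nn_integral_shell_law) auto
  finally show ?thesis .
qed

abbreviation config_space :: "(nat \<Rightarrow> 'b code) measure" where
  "config_space \<equiv> PiM UNIV (\<lambda>_. code_space)"

abbreviation poisson :: "(nat \<Rightarrow> 'b code) measure" where
  "poisson \<equiv> PiM UNIV shell_law"

lemma sets_poisson[measurable_cong]: "sets poisson = sets config_space"
  by (intro sets_PiM_cong) auto

lemma space_config_space[simp]: "space config_space = UNIV"
  by (simp add: space_PiM)

definition insert_at :: "nat \<Rightarrow> 'b \<Rightarrow> (nat \<Rightarrow> 'b code) \<Rightarrow> (nat \<Rightarrow> 'b code)" where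
  "insert_at k x w = w(k := add_point x (w k))"

lemma measurable_upd_code[measurable (raw)]:
  assumes [measurable]: "f \<in> measurable N config_space" "g \<in> measurable N code_space"
  shows "(\<lambda>z. (f z)(k := g z)) \<in> measurable N config_space"
  by (rule measurable_fun_upd[where J=UNIV]) auto

lemma measurable_insert_at[measurable (raw)]:
  assumes [measurable]: "f \<in> measurable N config_space" "g \<in> measurable N borel"
  shows "(\<lambda>z. insert_at k (g z) (f z)) \<in> measurable N config_space"
  unfolding insert_at_def by measurable

lemma mecke:
  assumes u[measurable]: "u \<in> borel_measurable config_space"
    and inv: "\<And>w w'. (\<And>j. shell (D j) (w j) = shell (D j) (w' j)) \<Longrightarrow> u w = u w'"
    and A[measurable]: "A \<in> sets borel"
  shows "(\<integral>\<^sup>+w. of_nat (size (filter_mset (\<lambda>x. x \<in> A) (shell (D k) (w k)))) * u w \<partial>poisson) =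
    (\<integral>\<^sup>+w. \<integral>\<^sup>+x. u (insert_at k x w) * indicator (A \<inter> D k) x \<partial>M \<partial>poisson)"
proof -
  have "(\<integral>\<^sup>+w. of_nat (size (filter_mset (\<lambda>x. x \<in> A) (shell (D k) (w k)))) * u w \<partial>poisson) =
   (\<integral>\<^sup>+w. \<integral>\<^sup>+y. of_nat (size (filter_mset (\<lambda>x. x \<in> A) (shell (D k) y))) * u (w(k := y)) \<partial>shell_law k \<partial>poisson)"
    by (subst nn_integral_PiM_resample[OF prob_space_shell_law, where k=k]) auto
  also have "\<dots> = (\<integral>\<^sup>+w. \<integral>\<^sup>+y. \<integral>\<^sup>+x. u (w(k := add_point x y)) * indicator (A \<inter> D k) x \<partial>M \<partial>shell_law k \<partial>poisson)"
    by (intro nn_integral_cong mecke_shell) (auto intro!: inv)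
  also have "\<dots> = (\<integral>\<^sup>+w. \<integral>\<^sup>+x. u (insert_at k x w) * indicator (A \<inter> D k) x \<partial>M \<partial>poisson)"
    by (subst (2) nn_integral_PiM_resample[OF prob_space_shell_law, where k=k]) (auto simp: insert_at_def)
  finally show ?thesis .
qed

end

section \<open>Counting measures and Gibbs measures in finite volume\<close>

lemma space_counting_measure_algebra[simp]: "space counting_measure_algebra = counting_measures"
  by (auto simp: counting_measure_algebra_def space_Sup_eq_UN)

lemma measurable_emeasure_counting[measurable]:
  "B \<in> sets borel \<Longrightarrow> (\<lambda>\<mu>. emeasure \<mu> B) \<in> borel_measurable counting_measure_algebra"
  by (auto intro!: measurable_Sup1 measurable_vimage_algebra1 simp: counting_measure_algebra_def)

lemma measurable_counting_measure_algebra: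
  assumes "\<And>a. a \<in> space N \<Longrightarrow> f a \<in> counting_measures"
    and "\<And>B. B \<in> sets borel \<Longrightarrow> (\<lambda>a. emeasure (f a) B) \<in> borel_measurable N"
  shows "f \<in> measurable N counting_measure_algebra"
  using assms by (auto intro!: measurable_Sup2 measurable_vimage_algebra2 simp: counting_measure_algebra_def)

lemma sets_add_measure[simp]: "sets (add_measure \<mu> \<nu>) = sets \<mu>"
  by (simp add: add_measure_def sets.space_closed sets.sigma_sets_eq)

lemma emeasure_add_measure:
  assumes "sets \<mu> = sets \<nu>" "B \<in> sets \<mu>"
  shows "emeasure (add_measure \<mu> \<nu>) B = emeasure \<mu> B + emeasure \<nu> B"
proof (rule emeasure_measure_of[OF add_measure_def])
  show "sets \<mu> \<subseteq> Pow (space \<mu>)" by (rule sets.space_closed)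
  show "B \<in> sets (add_measure \<mu> \<nu>)" using assms by simp
  show "positive (sets (add_measure \<mu> \<nu>)) (\<lambda>B. emeasure \<mu> B + emeasure \<nu> B)"
    by (simp add: positive_def)
  show "countably_additive (sets (add_measure \<mu> \<nu>)) (\<lambda>B. emeasure \<mu> B + emeasure \<nu> B)"
  proof (rule countably_additiveI)
    fix A :: "nat \<Rightarrow> 'a set"
    assume A: "range A \<subseteq> sets (add_measure \<mu> \<nu>)" "disjoint_family A" "\<Union> (range A) \<in> sets (add_measure \<mu> \<nu>)"
    then have "range A \<subseteq> sets \<mu>" "range A \<subseteq> sets \<nu>" using assms(1) by auto
    then show "(\<Sum>i. emeasure \<mu> (A i) + emeasure \<nu> (A i)) = emeasure \<mu> (\<Union> (range A)) + emeasure \<nu> (\<Union> (range A))"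
      using A(2) by (simp add: suminf_add[symmetric] suminf_emeasure)
  qed
qed

lemma enumerates_countable_image:
  fixes X :: "'i \<Rightarrow> 'b::metric_space"
  assumes "countable I"
  shows "\<exists>k K. enumerates k K (distr (count_space I) borel X)"
proof -
  have *: "enumerates k (X \<circ> h) (distr (count_space I) borel X)" if h: "bij_betw h {j. enat j < k} I" for k h
  proof -
    have "distr (count_space I) borel X = distr (distr (count_space {j. enat j < k}) (count_space I) h) borel X"
      by (simp only: distr_bij_count_space[OF h])
    also have "\<dots> = distr (count_space {j. enat j < k}) borel (X \<circ> h)"
      using h by (subst distr_distr) (auto simp: bij_betw_def)
    finally show ?thesis unfolding enumerates_def .
  qed
  show ?thesis
  proof (cases "finite I")
    case True
    have e: "{j. enat j < enat (card I)} = {0..<card I}" by auto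
    show ?thesis using ex_bij_betw_nat_finite[OF True] *[of _ "enat (card I)"] unfolding e by blast
  next
    case False
    have "{j. enat j < \<infinity>} = UNIV" by auto
    then show ?thesis using bij_betw_from_nat_into[OF assms False] *[of _ \<infinity>] by metis
  qed
qed

locale bounded_shells = shells M D for M :: "'b::metric_space measure" and D +
  assumes bounded_D: "\<And>k. bounded (D k)"
    and bounded_cover: "\<And>B. bounded B \<Longrightarrow> \<exists>m. B \<subseteq> (\<Union>k<m. D k)"
begin

text \<open>
  A multiset, so that quantities computed from it do not depend on the order of the points in the
  codes.
\<close>

definition cfg :: "nat \<Rightarrow> (nat \<Rightarrow> 'b code) \<Rightarrow> 'b multiset" where
  "cfg m w = (\<Sum>k<m. shell (D k) (w k))"

definition points :: "(nat \<Rightarrow> 'b code) \<Rightarrow> 'b measure" where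
  "points w = distr (count_space {(k, i). i < fst (w k) \<and> snd (w k) i \<in> D k}) borel (\<lambda>(k, i). snd (w k) i)"

lemma sets_points[simp, measurable_cong]: "sets (points w) = sets borel"
  by (simp add: points_def)

lemma nn_integral_points:
  assumes f[measurable]: "f \<in> borel_measurable borel"
  shows "(\<integral>\<^sup>+x. f x \<partial>points w) = (\<Sum>k. \<Sum>i<fst (w k). f (snd (w k) i) * indicator (D k) (snd (w k) i))"
proof -
  let ?I = "{(k, i). i < fst (w k) \<and> snd (w k) i \<in> D k}"
  have "(\<integral>\<^sup>+x. f x \<partial>points w) = (\<integral>\<^sup>+z. f (case z of (k, i) \<Rightarrow> snd (w k) i) \<partial>count_space ?I)"
    unfolding points_def by (subst nn_integral_distr) auto
  also have "\<dots> = (\<integral>\<^sup>+z. f (case z of (k, i) \<Rightarrow> snd (w k) i) * indicator ?I z \<partial>count_space UNIV)"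
    by (rule nn_integral_count_space_indicator) auto
  also have "\<dots> = (\<integral>\<^sup>+k. \<integral>\<^sup>+i. f (snd (w k) i) * indicator ?I (k, i) \<partial>count_space UNIV \<partial>count_space UNIV)"
    by (subst nn_integral_fst_count_space[symmetric]) simp
  also have "\<dots> = (\<Sum>k. \<integral>\<^sup>+i. f (snd (w k) i) * indicator ?I (k, i) \<partial>count_space UNIV)"
    by (rule nn_integral_count_space_nat)
  also have "\<dots> = (\<Sum>k. \<Sum>i<fst (w k). f (snd (w k) i) * indicator (D k) (snd (w k) i))"
  proof (intro suminf_cong)
    fix k
    have "(\<integral>\<^sup>+i. f (snd (w k) i) * indicator ?I (k, i) \<partial>count_space UNIV)
      = (\<Sum>i<fst (w k). f (snd (w k) i) * indicator ?I (k, i))"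
      by (rule nn_integral_count_space') auto
    also have "\<dots> = (\<Sum>i<fst (w k). f (snd (w k) i) * indicator (D k) (snd (w k) i))"
      by (intro sum.cong) (auto split: split_indicator)
    finally show "(\<integral>\<^sup>+i. f (snd (w k) i) * indicator ?I (k, i) \<partial>count_space UNIV)
      = (\<Sum>i<fst (w k). f (snd (w k) i) * indicator (D k) (snd (w k) i))" .
  qed
  finally show ?thesis .
qed

lemma emeasure_points:
  assumes B[measurable]: "B \<in> sets borel"
  shows "emeasure (points w) B = (\<Sum>k. of_nat (size (filter_mset (\<lambda>x. x \<in> B) (shell (D k) (w k)))))"
proof -
  have "emeasure (points w) B = (\<integral>\<^sup>+x. indicator B x \<partial>points w)" by simp
  also have "\<dots> = (\<Sum>k. of_nat (size (filter_mset (\<lambda>x. x \<in> B) (shell (D k) (w k)))))"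
    by (subst nn_integral_points) (auto simp: size_filter_shell indicator_inter_arith)
  finally show ?thesis .
qed

lemma filter_cfg_size:
  "size (filter_mset P (cfg m w)) = (\<Sum>k<m. size (filter_mset P (shell (D k) (w k))))"
  unfolding cfg_def by (induction m) auto

lemma set_shell: "x \<in># shell C y \<Longrightarrow> x \<in> C"
  by (simp add: shell_def)

lemma not_in_later:
  assumes "x \<in> D k" "m \<le> k" shows "x \<notin> (\<Union>j<m. D j)"
proof
  assume "x \<in> (\<Union>j<m. D j)"
  then obtain j where "j < m" "x \<in> D j" by blast
  moreover have "D j \<inter> D k = {}"
    using disj \<open>j < m\<close> assms(2) by (simp add: disjoint_family_on_def)
  ultimately show False using assms(1) by blast
qed

lemma emeasure_points_bounded:
  assumes B: "B \<in> sets borel" "B \<subseteq> (\<Union>k<m. D k)"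
  shows "emeasure (points w) B = of_nat (size (filter_mset (\<lambda>x. x \<in> B) (cfg m w)))"
proof -
  have "size (filter_mset (\<lambda>x. x \<in> B) (shell (D k) (w k))) = 0" if "k \<notin> {..<m}" for k
  proof -
    have "x \<notin> B" if "x \<in># shell (D k) (w k)" for x
      using not_in_later[OF set_shell[OF that], of m] \<open>k \<notin> {..<m}\<close> B(2) by auto
    then have "filter_mset (\<lambda>x. x \<in> B) (shell (D k) (w k)) = {#}"
      unfolding filter_mset_eq_mempty_iff by blast
    then show ?thesis by simp
  qed
  then have "emeasure (points w) B = (\<Sum>k<m. of_nat (size (filter_mset (\<lambda>x. x \<in> B) (shell (D k) (w k)))))"
    unfolding emeasure_points[OF B(1)] by (intro suminf_finite) auto
  then show ?thesis by (simp add: filter_cfg_size)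
qed

lemma points_counting: "points w \<in> counting_measures"
  unfolding counting_measures_def
proof (safe; simp?)
  fix B :: "'b set" assume B: "B \<in> sets borel" "bounded B"
  then obtain m where "B \<subseteq> (\<Union>k<m. D k)" using bounded_cover by blast
  then show "emeasure (points w) B \<in> \<nat>" using emeasure_points_bounded[OF B(1)] by simp
qed

lemma measurable_shell_count[measurable]:
  assumes [measurable]: "A \<in> sets borel"
  shows "(\<lambda>w. of_nat (size (filter_mset (\<lambda>x. x \<in> A) (shell (D k) (w k)))) :: ennreal) \<in> borel_measurable config_space"
proof -
  have "(\<lambda>w. w k) \<in> measurable config_space code_space" by simp
  from measurable_compose[OF this measurable_size_filter_shell[OF assms D]] show ?thesis .
qed

lemma measurable_points[measurable]: "points \<in> measurable config_space counting_measure_algebra"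
proof (rule measurable_counting_measure_algebra)
  show "points w \<in> counting_measures" for w by (rule points_counting)
  fix B :: "'b set" assume [measurable]: "B \<in> sets borel"
  show "(\<lambda>w. emeasure (points w) B) \<in> borel_measurable config_space"
    by (subst emeasure_points) (auto intro!: borel_measurable_suminf_order)
qed

lemma points_cong:
  assumes "\<And>j. shell (D j) (w j) = shell (D j) (w' j)" shows "points w = points w'"
  by (rule measure_eqI) (auto simp: emeasure_points assms)

lemma shell_insert_at:
  assumes "x \<in> D k"
  shows "shell (D j) (insert_at k x w j) = (if j = k then add_mset x (shell (D j) (w j)) else shell (D j) (w j))"
  using assms by (simp add: insert_at_def shell_add_point)

lemma points_insert_at:
  assumes x: "x \<in> D k"
  shows "points (insert_at k x w) = add_measure (points w) (return borel x)"
proof (rule measure_eqI)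
  show "sets (points (insert_at k x w)) = sets (add_measure (points w) (return borel x))" by simp
  fix B assume "B \<in> sets (points (insert_at k x w))"
  then have B[measurable]: "B \<in> sets borel" by simp
  let ?a = "\<lambda>j. of_nat (size (filter_mset (\<lambda>x. x \<in> B) (shell (D j) (w j)))) :: ennreal"
  have "emeasure (points (insert_at k x w)) B = (\<Sum>j. ?a j + (if j = k then indicator B x else 0))"
    unfolding emeasure_points[OF B]
    by (intro suminf_cong) (auto simp: shell_insert_at[OF x] split: split_indicator)
  also have "\<dots> = (\<Sum>j. ?a j) + (\<Sum>j. if j = k then indicator B x else 0)"
    by (rule suminf_add[symmetric]) auto
  also have "(\<Sum>j. if j = k then indicator B x else (0::ennreal)) = indicator B x"
    using suminf_finite[of "{k}" "\<lambda>j. if j = k then indicator B x else (0::ennreal)"] by auto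
  also have "(\<Sum>j. ?a j) + indicator B x = emeasure (add_measure (points w) (return borel x)) B"
    by (simp add: emeasure_add_measure emeasure_points)
  finally show "emeasure (points (insert_at k x w)) B = emeasure (add_measure (points w) (return borel x)) B" .
qed

lemma cfg_insert_at:
  assumes x: "x \<in> D k" and k: "k < m"
  shows "cfg m (insert_at k x w) = add_mset x (cfg m w)"
proof -
  have "cfg m (insert_at k x w) = (\<Sum>j<m. shell (D j) (w j) + (if j = k then {#x#} else {#}))"
    unfolding cfg_def by (intro sum.cong) (auto simp: shell_insert_at[OF x])
  also have "\<dots> = add_mset x (cfg m w)"
    using k by (simp add: sum.distrib cfg_def)
  finally show ?thesis .
qed

lemma enumerates_points: "\<exists>k K. enumerates k K (points w)"
  unfolding points_def by (rule enumerates_countable_image) simp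

text \<open>
  The positions of the points of \<open>cfg m w\<close>. There are countably many values, and for a fixed value
  the points depend measurably on the code; this reduces measurability in a multiset to measurability
  in tuples.
\<close>

definition idx :: "nat \<Rightarrow> (nat \<Rightarrow> 'b code) \<Rightarrow> (nat \<times> nat) list" where
  "idx m w = concat (map (\<lambda>k. map (Pair k) (filter (\<lambda>i. snd (w k) i \<in> D k) [0..<fst (w k)])) [0..<m])"

lemma cfg_idx: "cfg m w = mset (map (\<lambda>(k, i). snd (w k) i) (idx m w))"
proof (induction m)
  case 0 then show ?case by (simp add: cfg_def idx_def)
next
  case (Suc m)
  have "mset (map (\<lambda>(k, i). snd (w k) i) (map (Pair m) (filter (\<lambda>i. snd (w m) i \<in> D m) [0..<n])))
    = filter_mset (\<lambda>x. x \<in> D m) (mset (map (snd (w m)) [0..<n]))" for n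
    by (induction n) auto
  moreover have "cfg (Suc m) w = cfg m w + shell (D m) (w m)" by (simp add: cfg_def)
  moreover have "idx (Suc m) w = idx m w @ map (Pair m) (filter (\<lambda>i. snd (w m) i \<in> D m) [0..<fst (w m)])"
    by (simp add: idx_def)
  ultimately show ?case using Suc by (simp only: shell_def map_append mset_append)
qed

lemma measurable_append[measurable (raw)]:
  fixes f g :: "'z \<Rightarrow> ('i::countable) list"
  assumes f: "f \<in> measurable N (count_space UNIV)" and g: "g \<in> measurable N (count_space UNIV)"
  shows "(\<lambda>z. f z @ g z) \<in> measurable N (count_space UNIV)"
  by (rule measurable_compose_countable[where f="\<lambda>l z. l @ g z" and g=f])
     (auto intro: f measurable_compose[OF g])

lemma measurable_idx[measurable]: "idx m \<in> measurable config_space (count_space UNIV)"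
proof -
  have 1[measurable]: "(\<lambda>y. filter (\<lambda>i. snd y i \<in> D k) [0..<n]) \<in> measurable code_space (count_space UNIV)" for n k
  proof (induction n)
    case (Suc n)
    note Suc[measurable]
    have "(\<lambda>y. filter (\<lambda>i. snd y i \<in> D k) [0..<n] @ (if snd y n \<in> D k then [n] else [])) \<in> measurable code_space (count_space UNIV)"
      by measurable
    moreover have e: "filter (\<lambda>i. snd y i \<in> D k) [0..<Suc n] = filter (\<lambda>i. snd y i \<in> D k) [0..<n] @ (if snd y n \<in> D k then [n] else [])" for y :: "'b code"
      by simp
    ultimately show ?case unfolding e by simp
  qed simp
  have 2[measurable]: "(\<lambda>y. filter (\<lambda>i. snd y i \<in> D k) [0..<fst y]) \<in> measurable code_space (count_space UNIV)" for k
    by (rule measurable_compose_countable[where f="\<lambda>n y. filter (\<lambda>i. snd y i \<in> D k) [0..<n]" and g=fst]) measurable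
  have 3[measurable]: "(\<lambda>w. map (Pair k) (filter (\<lambda>i. snd (w k) i \<in> D k) [0..<fst (w k)])) \<in> measurable config_space (count_space UNIV)" for k
    by (rule measurable_compose[OF _ measurable_count_space[where f="map (Pair k)"]]) measurable
  show ?thesis
  proof (induction m)
    case 0 then show ?case by (simp add: idx_def[abs_def])
  next
    case (Suc m)
    note Suc[measurable]
    have "idx (Suc m) = (\<lambda>w. idx m w @ map (Pair m) (filter (\<lambda>i. snd (w m) i \<in> D m) [0..<fst (w m)]))"
      by (simp add: idx_def fun_eq_iff)
    then show ?case by (simp only:) measurable
  qed
qed

lemma measurable_cfg:
  assumes F: "\<And>l. (\<lambda>(a, ys). F a (mset (map ys [0..<l]))) \<in> measurable (N \<Otimes>\<^sub>M PiM UNIV (\<lambda>_::nat. borel)) L"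
    and f[measurable]: "f \<in> measurable R N" and g[measurable]: "g \<in> measurable R config_space"
  shows "(\<lambda>z. F (f z) (cfg m (g z))) \<in> measurable R L"
proof -
  have "(\<lambda>z. F (f z) (mset (map (\<lambda>(k, i). snd (g z k) i) l))) \<in> measurable R L" for l :: "(nat \<times> nat) list"
  proof -
    have "(\<lambda>z. (f z, \<lambda>j. snd (g z (fst (l ! j))) (snd (l ! j)))) \<in> measurable R (N \<Otimes>\<^sub>M PiM UNIV (\<lambda>_::nat. borel))"
      by (intro measurable_Pair f measurable_PiM_single') (auto simp: PiE_iff)
    from measurable_compose[OF this F[of "length l"]]
    have "(\<lambda>z. F (f z) (mset (map (\<lambda>j. snd (g z (fst (l ! j))) (snd (l ! j))) [0..<length l]))) \<in> measurable R L"
      by simp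
    moreover have "map (\<lambda>j. snd (g z (fst (l ! j))) (snd (l ! j))) [0..<length l] = map (\<lambda>(k, i). snd (g z k) i) l" for z
      by (rule nth_equalityI) (auto simp: case_prod_beta)
    ultimately show ?thesis by simp
  qed
  moreover have "(\<lambda>z. idx m (g z)) \<in> measurable R (count_space UNIV)" by measurable
  ultimately show ?thesis unfolding cfg_idx
    by (rule measurable_compose_countable[where f="\<lambda>l z. F (f z) (mset (map (\<lambda>(k, i). snd (g z k) i) l))"])
qed

end

text \<open>
  An intensity on finite configurations with the properties on which the construction rests: it is at
  most 1, it satisfies the cocycle identity of quotients of Boltzmann factors, and a point only
  interacts with finitely many shells.
\<close>

locale gibbs_shells = bounded_shells M D for M :: "'b::metric_space measure" and D +
  fixes \<kappa> :: "'b \<Rightarrow> 'b multiset \<Rightarrow> ennreal"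
  assumes \<kappa>_le_1: "\<kappa> x S \<le> 1"
    and cocycle: "\<kappa> x S * \<kappa> y (add_mset x S) = \<kappa> y S * \<kappa> x (add_mset y S)"
    and finite_range: "\<exists>m. \<forall>x\<in>D k. \<forall>S y. y \<notin> (\<Union>j<m. D j) \<longrightarrow> \<kappa> x (add_mset y S) = \<kappa> x S"
    and \<kappa>_measurable: "\<And>l. (\<lambda>(x, ys). \<kappa> x (mset (map ys [0..<l])))
          \<in> borel_measurable (borel \<Otimes>\<^sub>M PiM UNIV (\<lambda>_::nat. borel))"
begin

text \<open>
  The product of the intensities met when the points are inserted one after the other, together with
  the configuration built so far. The cocycle identity makes the insertion steps commute, as the fold
  over a multiset requires.
\<close>

definition boltzmann :: "'b multiset \<Rightarrow> ennreal" where
  "boltzmann S = snd (fold_mset (\<lambda>x (T, g). (add_mset x T, \<kappa> x T * g)) ({#}, 1) S)"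

lemma boltzmann_empty[simp]: "boltzmann {#} = 1" by (simp add: boltzmann_def)

lemma boltzmann_add: "boltzmann (add_mset x S) = \<kappa> x S * boltzmann S"
proof -
  let ?f = "\<lambda>x (T, g). (add_mset x T, \<kappa> x T * g)"
  interpret comp_fun_commute ?f
  proof
    have "\<kappa> y (add_mset x T) * (\<kappa> x T * g) = \<kappa> x (add_mset y T) * (\<kappa> y T * g)" for x y T g
      using cocycle[of x T y] by (metis mult.assoc mult.commute)
    then show "?f y \<circ> ?f x = ?f x \<circ> ?f y" for x y
      by (auto simp: fun_eq_iff)
  qed
  have add: "fold_mset ?f ({#}, 1) (add_mset x S) = ?f x (fold_mset ?f ({#}, 1) S)" for x S
    by (rule fold_mset_add_mset)
  have "fst (fold_mset ?f ({#}, 1) S) = S"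
  proof (induction S)
    case (add y S) then show ?case
      by (cases "fold_mset ?f ({#}, 1) S") (simp add: \<open>\<And>x S. fold_mset ?f ({#}, 1) (add_mset x S) = ?f x (fold_mset ?f ({#}, 1) S)\<close>)
  qed simp
  then show ?thesis
    unfolding boltzmann_def add by (cases "fold_mset ?f ({#}, 1) S") simp
qed

lemma boltzmann_le_1: "boltzmann S \<le> 1"
proof (induction S)
  case (add x S) then show ?case using mult_mono[OF \<kappa>_le_1 add, of x S] by (simp add: boltzmann_add)
qed simp

text \<open>
  Deleting points can only increase the Boltzmann factor, because intensities are at most 1.
\<close>

lemma boltzmann_add_le: "boltzmann (S + T) \<le> boltzmann T"
proof (induction S)
  case (add x S) then show ?case using mult_mono[OF \<kappa>_le_1 add, of x "S + T"] by (simp add: boltzmann_add)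
qed simp

lemma measurable_boltzmann_cfg[measurable (raw)]:
  assumes g: "g \<in> measurable R config_space"
  shows "(\<lambda>z. boltzmann (cfg m (g z))) \<in> borel_measurable R"
proof (rule measurable_cfg[where F="\<lambda>_::unit. boltzmann" and f="\<lambda>_. ()" and N="count_space UNIV", OF _ _ g])
  fix l
  have "(\<lambda>ys. boltzmann (mset (map ys [0..<l]))) \<in> borel_measurable (PiM UNIV (\<lambda>_::nat. borel))"
  proof (induction l)
    case (Suc l)
    note Suc[measurable]
    have "(\<lambda>ys. (ys l, ys)) \<in> measurable (PiM UNIV (\<lambda>_::nat. borel)) (borel \<Otimes>\<^sub>M PiM UNIV (\<lambda>_::nat. borel))"
      by measurable
    from measurable_compose[OF this \<kappa>_measurable[of l]]
    have [measurable]: "(\<lambda>ys. \<kappa> (ys l) (mset (map ys [0..<l]))) \<in> borel_measurable (PiM UNIV (\<lambda>_::nat. borel))"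
      by simp
    have "mset (map ys [0..<Suc l]) = add_mset (ys l) (mset (map ys [0..<l]))" for ys :: "nat \<Rightarrow> 'b" by simp
    then show ?case by (simp only: boltzmann_add) measurable
  qed simp
  from measurable_compose[OF measurable_snd this]
  show "(\<lambda>(a::unit, ys). boltzmann (mset (map ys [0..<l]))) \<in> borel_measurable (count_space UNIV \<Otimes>\<^sub>M PiM UNIV (\<lambda>_::nat. borel))"
    by (simp add: case_prod_beta')
qed simp

lemma measurable_\<kappa>_cfg[measurable (raw)]:
  assumes f: "f \<in> measurable R borel" and g: "g \<in> measurable R config_space"
  shows "(\<lambda>z. \<kappa> (f z) (cfg m (g z))) \<in> borel_measurable R"
  by (rule measurable_cfg[OF \<kappa>_measurable f g])

lemma \<kappa>_add_outside:
  assumes "\<And>S y. y \<notin> U \<Longrightarrow> \<kappa> x (add_mset y S) = \<kappa> x S" and "\<And>y. y \<in># T \<Longrightarrow> y \<notin> U"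
  shows "\<kappa> x (S + T) = \<kappa> x S"
  using assms(2) by (induction T) (auto simp: assms(1))

lemma in_sum_mset:
  assumes "finite I" "y \<in># (\<Sum>i\<in>I. f i)" shows "\<exists>i\<in>I. y \<in># f i"
  using assms by (induction I) auto

lemma \<kappa>_cfg_stable:
  "\<exists>r. \<forall>m\<ge>r. \<forall>n\<ge>m. \<forall>x\<in>D k. \<forall>w. \<kappa> x (cfg n w) = \<kappa> x (cfg m w)"
proof -
  obtain r where "\<forall>x\<in>D k. \<forall>S y. y \<notin> (\<Union>j<r. D j) \<longrightarrow> \<kappa> x (add_mset y S) = \<kappa> x S"
    using finite_range[of k] by (elim exE)
  then have r: "\<kappa> x (add_mset y S) = \<kappa> x S" if "x \<in> D k" "y \<notin> (\<Union>j<r. D j)" for x S y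
    using that by (simp only: simp_thms)
  have "\<kappa> x (cfg n w) = \<kappa> x (cfg m w)" if "r \<le> m" "m \<le> n" "x \<in> D k" for m n x w
  proof -
    have "cfg n w = cfg m w + (\<Sum>k\<in>{m..<n}. shell (D k) (w k))"
    proof -
      have "{..<n} = {..<m} \<union> {m..<n}" using that(2) by auto
      moreover have "(\<Sum>k\<in>{..<m} \<union> {m..<n}. shell (D k) (w k)) = (\<Sum>k\<in>{..<m}. shell (D k) (w k)) + (\<Sum>k\<in>{m..<n}. shell (D k) (w k))"
        by (rule sum.union_disjoint) auto
      ultimately show ?thesis unfolding cfg_def by (simp only:)
    qed
    moreover have "\<kappa> x (cfg m w + (\<Sum>k\<in>{m..<n}. shell (D k) (w k))) = \<kappa> x (cfg m w)"
    proof (rule \<kappa>_add_outside)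
      show "\<kappa> x (add_mset y S) = \<kappa> x S" if "y \<notin> (\<Union>j<r. D j)" for S y
        using \<open>x \<in> D k\<close> that by (rule r)
      show "y \<notin> (\<Union>j<r. D j)" if y: "y \<in># (\<Sum>k\<in>{m..<n}. shell (D k) (w k))" for y
      proof -
        obtain j where "j \<in> {m..<n}" "y \<in># shell (D j) (w j)"
          using in_sum_mset[OF finite_atLeastLessThan y] by blast
        then show ?thesis using not_in_later[OF set_shell, of y j "w j" r] \<open>r \<le> m\<close> by simp
      qed
    qed
    ultimately show ?thesis by simp
  qed
  then show ?thesis by (intro exI[of _ r] allI impI ballI)
qed

definition partition_function :: "nat \<Rightarrow> ennreal" where
  "partition_function n = (\<integral>\<^sup>+w. boltzmann (cfg n w) \<partial>poisson)"

definition gibbs :: "nat \<Rightarrow> (nat \<Rightarrow> 'b code) measure" where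
  "gibbs n = density poisson (\<lambda>w. boltzmann (cfg n w) / partition_function n)"

lemma sets_gibbs[simp, measurable_cong]: "sets (gibbs n) = sets config_space"
  by (simp add: gibbs_def sets_poisson)

lemma space_gibbs[simp]: "space (gibbs n) = UNIV"
  using sets_eq_imp_space_eq[OF sets_gibbs] by simp

sublocale poisson: prob_space poisson
  by (intro prob_space_PiM prob_space_shell_law)

lemma space_poisson[simp]: "space poisson = UNIV"
  using sets_eq_imp_space_eq[OF sets_poisson] by simp

definition void :: "nat \<Rightarrow> (nat \<Rightarrow> 'b code) set" where
  "void m = {w. \<forall>k<m. fst (w k) = 0}"

lemma void_measurable[measurable]: "void m \<in> sets config_space"
proof -
  have "{w \<in> space config_space. \<forall>k<m. fst (w k) = 0} \<in> sets config_space" by measurable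
  then show ?thesis by (simp add: void_def)
qed

lemma emeasure_void_pos: "emeasure poisson (void m) > 0"
proof -
  interpret S: prob_space "shell_law k" for k by (rule prob_space_shell_law)
  interpret PP: product_prob_space shell_law UNIV by unfold_locales
  have [measurable]: "{y. fst y = 0} \<in> sets code_space"
    using measurable_sets[of fst code_space "count_space UNIV" "{0}"] by (auto simp: vimage_def)
  have "void m = {w \<in> space poisson. \<forall>k\<in>{..<m}. w k \<in> {y. fst y = 0}}"
    by (auto simp: void_def)
  then have "emeasure poisson (void m) = (\<Prod>k<m. emeasure (shell_law k) {y. fst y = 0})"
    by (simp only:) (rule PP.emeasure_PiM_Collect, auto)
  also have "\<dots> > 0"
    using emeasure_shell_law_empty by (auto simp: zero_less_iff_neq_zero)
  finally show ?thesis .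
qed

lemma cfg_void: "w \<in> void n \<Longrightarrow> cfg n w = {#}"
  by (auto simp: cfg_def void_def shell_def)

text \<open>
  Let \<open>I\<close> be the integral of the Boltzmann factor of the shells from \<open>m\<close> to \<open>n\<close> alone. Deleting the
  points in the first \<open>m\<close> shells bounds the left integral by \<open>I\<close> times the Poisson probability of
  \<open>A\<close>, and restricting to empty first shells bounds the partition function from below by \<open>I\<close> times
  the void probability.
\<close>

lemma local_mass_le:
  assumes "m \<le> n" and A[measurable]: "A \<in> sets config_space"
    and loc: "\<And>w w'. (\<And>k. k < m \<Longrightarrow> w k = w' k) \<Longrightarrow> w \<in> A \<longleftrightarrow> w' \<in> A"
  shows "(\<integral>\<^sup>+w. indicator A w * boltzmann (cfg n w) \<partial>poisson) * emeasure poisson (void m) \<le> emeasure poisson A * partition_function n"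
proof -
  let ?mix = "\<lambda>w w' i. if i \<in> {..<m} then w i else w' i"
  let ?o = "\<lambda>_. (0, \<lambda>_. undefined) :: 'b code"
  let ?I = "\<integral>\<^sup>+w'. boltzmann (cfg n (?mix ?o w')) \<partial>poisson"
  have mm[measurable]: "(\<lambda>w'. ?mix w w') \<in> measurable config_space config_space" for w
    by (rule measurable_PiM_single') (auto simp: PiE_iff)
  have cfgmix: "cfg n (?mix w w') = cfg m w + cfg n (?mix ?o w')" for w w'
  proof -
    have "cfg n (?mix w w') = (\<Sum>k<n. (if k < m then shell (D k) (w k) else {#}) + shell (D k) (?mix ?o w' k))"
      unfolding cfg_def by (intro sum.cong) (auto simp: shell_def)
    also have "\<dots> = (\<Sum>k<n. (if k < m then shell (D k) (w k) else {#})) + cfg n (?mix ?o w')"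
      unfolding sum.distrib cfg_def ..
    also have "(\<Sum>k<n. (if k < m then shell (D k) (w k) else {#})) = cfg m w"
      unfolding cfg_def using \<open>m \<le> n\<close> by (intro sum.mono_neutral_cong_right) auto
    finally show ?thesis .
  qed
  have G_mix: "boltzmann (cfg n (?mix w w')) \<le> boltzmann (cfg n (?mix ?o w'))" for w w'
    by (subst cfgmix) (rule boltzmann_add_le)
  have G_void: "boltzmann (cfg n (?mix w w')) = boltzmann (cfg n (?mix ?o w'))" if "w \<in> void m" for w w'
    by (subst cfgmix) (simp add: cfg_void[OF that])
  have A_mix: "?mix w w' \<in> A \<longleftrightarrow> w \<in> A" for w w' by (rule loc) auto
  have "(\<integral>\<^sup>+w. indicator A w * boltzmann (cfg n w) \<partial>poisson) =
    (\<integral>\<^sup>+w. \<integral>\<^sup>+w'. indicator A (?mix w w') * boltzmann (cfg n (?mix w w')) \<partial>poisson \<partial>poisson)"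
    by (rule nn_integral_PiM_mix[OF prob_space_shell_law]) measurable
  also have "\<dots> \<le> (\<integral>\<^sup>+w. \<integral>\<^sup>+w'. indicator A w * boltzmann (cfg n (?mix ?o w')) \<partial>poisson \<partial>poisson)"
    by (intro nn_integral_mono mult_mono G_mix) (auto simp: indicator_def A_mix[unfolded lessThan_iff])
  also have "\<dots> = (\<integral>\<^sup>+w. indicator A w * ?I \<partial>poisson)"
    by (intro nn_integral_cong nn_integral_cmult) measurable
  also have "\<dots> = emeasure poisson A * ?I"
    by (subst nn_integral_multc) (auto simp: sets_poisson)
  finally have 1: "(\<integral>\<^sup>+w. indicator A w * boltzmann (cfg n w) \<partial>poisson) \<le> emeasure poisson A * ?I" .
  have "emeasure poisson (void m) * ?I = (\<integral>\<^sup>+w. indicator (void m) w * ?I \<partial>poisson)"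
    by (subst nn_integral_multc) (auto simp: sets_poisson)
  also have "\<dots> = (\<integral>\<^sup>+w. \<integral>\<^sup>+w'. indicator (void m) w * boltzmann (cfg n (?mix ?o w')) \<partial>poisson \<partial>poisson)"
    by (intro nn_integral_cong nn_integral_cmult[symmetric]) measurable
  also have "\<dots> \<le> (\<integral>\<^sup>+w. \<integral>\<^sup>+w'. boltzmann (cfg n (?mix w w')) \<partial>poisson \<partial>poisson)"
    by (intro nn_integral_mono) (auto simp: G_void[unfolded lessThan_iff] split: split_indicator)
  also have "\<dots> = partition_function n"
    unfolding partition_function_def by (rule nn_integral_PiM_mix[OF prob_space_shell_law, symmetric]) measurable
  finally have 2: "emeasure poisson (void m) * ?I \<le> partition_function n" .
  have "(\<integral>\<^sup>+w. indicator A w * boltzmann (cfg n w) \<partial>poisson) * emeasure poisson (void m)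
    \<le> emeasure poisson A * ?I * emeasure poisson (void m)"
    by (intro mult_right_mono 1) simp
  also have "\<dots> = emeasure poisson A * (emeasure poisson (void m) * ?I)"
    by (simp add: mult_ac)
  also have "\<dots> \<le> emeasure poisson A * partition_function n"
    by (intro mult_left_mono 2) simp
  finally show ?thesis .
qed

lemma partition_function_pos: "partition_function n > 0"
proof -
  have "emeasure poisson (void n) = (\<integral>\<^sup>+w. indicator (void n) w \<partial>poisson)" by (simp add: sets_poisson)
  also have "\<dots> \<le> partition_function n"
    unfolding partition_function_def by (intro nn_integral_mono) (auto simp: cfg_void split: split_indicator)
  finally show ?thesis using emeasure_void_pos[of n] by simp
qed

lemma partition_function_le_1: "partition_function n \<le> 1"
proof -
  have "partition_function n \<le> (\<integral>\<^sup>+w. 1 \<partial>poisson)" unfolding partition_function_def by (intro nn_integral_mono boltzmann_le_1)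
  then show ?thesis by (simp add: poisson.emeasure_space_1[simplified])
qed

lemma partition_function_finite: "partition_function n \<noteq> \<infinity>" using partition_function_le_1[of n] by (auto simp: top_unique)

lemma nn_integral_gibbs:
  assumes [measurable]: "f \<in> borel_measurable config_space"
  shows "(\<integral>\<^sup>+w. f w \<partial>gibbs n) = (\<integral>\<^sup>+w. f w * boltzmann (cfg n w) \<partial>poisson) / partition_function n"
proof -
  have "(\<integral>\<^sup>+w. f w \<partial>gibbs n) = (\<integral>\<^sup>+w. (f w * boltzmann (cfg n w)) / partition_function n \<partial>poisson)"
    unfolding gibbs_def by (subst nn_integral_density) (auto simp: ennreal_times_divide mult.commute)
  then show ?thesis by (simp add: nn_integral_divide)
qed

sublocale gibbs: prob_space "gibbs n" for n
proof
  have "emeasure (gibbs n) (space (gibbs n)) = (\<integral>\<^sup>+w. 1 \<partial>gibbs n)" by simp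
  also have "\<dots> = 1" using partition_function_pos[of n] partition_function_finite[of n]
    by (subst nn_integral_gibbs) (auto simp: partition_function_def[symmetric] ennreal_divide_self less_top)
  finally show "emeasure (gibbs n) (space (gibbs n)) = 1" .
qed

text \<open>
  The bound does not depend on \<open>n\<close>; this is the compactness of the finite-volume measures.
\<close>

lemma gibbs_dominated:
  assumes "m \<le> n" and A[measurable]: "A \<in> sets config_space"
    and loc: "\<And>w w'. (\<And>k. k < m \<Longrightarrow> w k = w' k) \<Longrightarrow> w \<in> A \<longleftrightarrow> w' \<in> A"
  shows "emeasure (gibbs n) A \<le> emeasure poisson A / emeasure poisson (void m)"
proof -
  have v: "emeasure poisson (void m) \<noteq> 0" "emeasure poisson (void m) \<noteq> \<infinity>"
    using emeasure_void_pos[of m] by (auto simp: poisson.emeasure_finite)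
  have "emeasure (gibbs n) A = (\<integral>\<^sup>+w. indicator A w * boltzmann (cfg n w) \<partial>poisson) / partition_function n"
    by (subst nn_integral_gibbs[symmetric]) auto
  also have "\<dots> = ((\<integral>\<^sup>+w. indicator A w * boltzmann (cfg n w) \<partial>poisson) * emeasure poisson (void m) / emeasure poisson (void m)) / partition_function n"
    using v by (subst mult_divide_eq_ennreal) auto
  also have "\<dots> \<le> (emeasure poisson A * partition_function n / emeasure poisson (void m)) / partition_function n"
    by (intro divide_right_mono_ennreal local_mass_le assms)
  also have "\<dots> = emeasure poisson A / emeasure poisson (void m)"
  proof -
    have "emeasure poisson A * partition_function n / emeasure poisson (void m) = emeasure poisson A / emeasure poisson (void m) * partition_function n"
      by (simp add: divide_ennreal_def mult_ac)
    then show ?thesis using partition_function_pos[of n] partition_function_finite[of n] by (simp add: mult_divide_eq_ennreal)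
  qed
  finally show ?thesis .
qed

text \<open>
  The Mecke formula for \<open>u\<close> times the Boltzmann factor: inserting \<open>x\<close> multiplies that factor by
  \<open>\<kappa> x\<close>.
\<close>

lemma gibbs_gnz:
  assumes u[measurable]: "u \<in> borel_measurable config_space"
    and inv: "\<And>w w'. (\<And>j. shell (D j) (w j) = shell (D j) (w' j)) \<Longrightarrow> u w = u w'"
    and A[measurable]: "A \<in> sets borel" and k: "k < n"
  shows "(\<integral>\<^sup>+w. of_nat (size (filter_mset (\<lambda>x. x \<in> A) (shell (D k) (w k)))) * u w \<partial>gibbs n) =
    (\<integral>\<^sup>+w. \<integral>\<^sup>+x. u (insert_at k x w) * \<kappa> x (cfg n w) * indicator (A \<inter> D k) x \<partial>M \<partial>gibbs n)"
proof -
  have "(\<integral>\<^sup>+w. of_nat (size (filter_mset (\<lambda>x. x \<in> A) (shell (D k) (w k)))) * u w * boltzmann (cfg n w) \<partial>poisson) =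
    (\<integral>\<^sup>+w. of_nat (size (filter_mset (\<lambda>x. x \<in> A) (shell (D k) (w k)))) * (u w * boltzmann (cfg n w)) \<partial>poisson)"
    by (simp only: mult.assoc)
  also have "\<dots> = (\<integral>\<^sup>+w. \<integral>\<^sup>+x. u (insert_at k x w) * boltzmann (cfg n (insert_at k x w)) * indicator (A \<inter> D k) x \<partial>M \<partial>poisson)"
  proof (rule mecke)
    fix w w' :: "nat \<Rightarrow> 'b code" assume e: "\<And>j. shell (D j) (w j) = shell (D j) (w' j)"
    then have "cfg n w = cfg n w'" by (simp add: cfg_def)
    then show "u w * boltzmann (cfg n w) = u w' * boltzmann (cfg n w')" using inv[OF e] by simp
  qed measurable
  also have "\<dots> = (\<integral>\<^sup>+w. (\<integral>\<^sup>+x. u (insert_at k x w) * \<kappa> x (cfg n w) * indicator (A \<inter> D k) x \<partial>M) * boltzmann (cfg n w) \<partial>poisson)"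
    by (intro nn_integral_cong, subst nn_integral_multc[symmetric])
       (auto intro!: nn_integral_cong simp: cfg_insert_at k boltzmann_add mult_ac split: split_indicator)
  finally show ?thesis
    by (subst (1 2) nn_integral_gibbs) auto
qed

end

section \<open>The infinite-volume limit\<close>

text \<open>
  A bounded function is uniformly close to the simple function obtained by rounding its values down to
  multiples of \<open>1 / j\<close>, whose integral is a finite combination of probabilities of level sets.
\<close>

lemma integral_limit_from_level_sets:
  fixes h :: "'a \<Rightarrow> real"
  assumes Q: "\<And>n. prob_space (Q n)" "prob_space P" and sets: "\<And>n. sets (Q n) = sets S" "sets P = sets S"
    and h[measurable]: "h \<in> borel_measurable S" and bnd: "\<And>x. 0 \<le> h x" "\<And>x. h x \<le> C"
    and lim: "\<And>B. B \<in> sets borel \<Longrightarrow> ((\<lambda>n. measure (Q n) (h -` B \<inter> space S)) \<longlongrightarrow> measure P (h -` B \<inter> space S)) F"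
  shows "((\<lambda>n. \<integral>x. h x \<partial>Q n) \<longlongrightarrow> (\<integral>x. h x \<partial>P)) F"
proof (rule tendstoI)
  fix e :: real assume e: "e > 0"
  obtain j :: nat where j: "j > 0" "1 / real j < e / 3"
    using e by (metis divide_pos_pos nat_approx_posE zero_less_Suc zero_less_numeral)
  define s where "s x = of_int \<lfloor>real j * h x\<rfloor> / real j" for x
  have s_close: "\<bar>s x - h x\<bar> \<le> 1 / real j" for x
  proof -
    have "\<bar>of_int \<lfloor>real j * h x\<rfloor> - real j * h x\<bar> \<le> 1" by linarith
    then have "\<bar>(of_int \<lfloor>real j * h x\<rfloor> - real j * h x) / real j\<bar> \<le> 1 / real j"
      using j(1) by (simp add: divide_right_mono)
    then show ?thesis using j(1) by (simp add: s_def diff_divide_distrib)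
  qed
  define K where "K = {0..\<lfloor>real j * C\<rfloor>}"
  define Bi where "Bi i = {y::real. \<lfloor>real j * y\<rfloor> = i}" for i :: int
  have Bi[measurable]: "Bi i \<in> sets borel" for i unfolding Bi_def by measurable
  let ?A = "\<lambda>i. h -` Bi i \<inter> space S"
  have s_sum: "s x = (\<Sum>i\<in>K. of_int i / real j * indicator (?A i) x)" if "x \<in> space S" for x
  proof -
    have "\<lfloor>real j * h x\<rfloor> \<in> K"
      unfolding K_def using bnd by (auto intro!: floor_mono mult_left_mono)
    moreover have "(\<Sum>i\<in>K. of_int i / real j * indicator (?A i) x) = (\<Sum>i\<in>K. if i = \<lfloor>real j * h x\<rfloor> then of_int i / real j else 0)"
      using that by (intro sum.cong) (auto simp: Bi_def split: split_indicator)
    ultimately show ?thesis by (simp add: s_def K_def)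
  qed
  have hi: "integrable R h" if R: "prob_space R" "sets R = sets S" for R
  proof -
    interpret R: prob_space R by fact
    show ?thesis using bnd h
      by (intro R.integrable_const_bound[where B=C]) (auto simp: measurable_cong_sets[OF R(2) refl])
  qed
  have si: "integrable R s" "(\<integral>x. s x \<partial>R) = (\<Sum>i\<in>K. of_int i / real j * measure R (?A i))"
    if R: "prob_space R" "sets R = sets S" for R
  proof -
    interpret R: prob_space R by fact
    have sp: "space R = space S" using sets_eq_imp_space_eq[OF R(2)] .
    have A: "?A i \<in> sets R" for i using R(2) by simp
    have Ii: "integrable R (\<lambda>x. of_int i / real j * indicator (?A i) x)" for i
      using A by (intro integrable_mult_right integrable_real_indicator) (auto simp: R.emeasure_finite less_top[symmetric])
    have int: "integrable R (\<lambda>x. \<Sum>i\<in>K. of_int i / real j * indicator (?A i) x)"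
      by (intro Bochner_Integration.integrable_sum Ii)
    then show "integrable R s"
      by (subst Bochner_Integration.integrable_cong[OF refl s_sum]) (auto simp: sp)
    have "(\<integral>x. s x \<partial>R) = (\<integral>x. (\<Sum>i\<in>K. of_int i / real j * indicator (?A i) x) \<partial>R)"
      by (intro Bochner_Integration.integral_cong refl s_sum) (auto simp: sp)
    also have "\<dots> = (\<Sum>i\<in>K. of_int i / real j * measure R (?A i))"
      using sets.sets_into_space[OF A]
      by (subst Bochner_Integration.integral_sum) (rule Ii, simp add: Int_absorb2)
    finally show "(\<integral>x. s x \<partial>R) = (\<Sum>i\<in>K. of_int i / real j * measure R (?A i))" .
  qed
  have close: "\<bar>(\<integral>x. h x \<partial>R) - (\<integral>x. s x \<partial>R)\<bar> \<le> 1 / real j" if R: "prob_space R" "sets R = sets S" for R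
  proof -
    interpret R: prob_space R by fact
    have "\<bar>(\<integral>x. h x \<partial>R) - (\<integral>x. s x \<partial>R)\<bar> = \<bar>\<integral>x. h x - s x \<partial>R\<bar>"
      using hi[OF R] si(1)[OF R] by simp
    also have "\<dots> \<le> (\<integral>x. \<bar>h x - s x\<bar> \<partial>R)" by (rule integral_abs_bound)
    also have "\<dots> \<le> (\<integral>x. 1 / real j \<partial>R)"
      using hi[OF R] si(1)[OF R] s_close by (intro integral_mono) (auto simp: abs_minus_commute)
    finally show ?thesis by (simp add: R.prob_space)
  qed
  have "((\<lambda>n. \<integral>x. s x \<partial>Q n) \<longlongrightarrow> (\<integral>x. s x \<partial>P)) F"
    unfolding si(2)[OF Q(1) sets(1)] si(2)[OF Q(2) sets(2)]
    by (intro tendsto_sum tendsto_mult tendsto_const lim Bi)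
  then have "eventually (\<lambda>n. dist (\<integral>x. s x \<partial>Q n) (\<integral>x. s x \<partial>P) < e / 3) F"
    using e by (intro tendstoD) auto
  then show "eventually (\<lambda>n. dist (\<integral>x. h x \<partial>Q n) (\<integral>x. h x \<partial>P) < e) F"
  proof eventually_elim
    case (elim n)
    then show ?case
      using close[OF Q(1) sets(1), of n] close[OF Q(2) sets(2)] j(2) unfolding dist_real_def by linarith
  qed
qed

lemma nn_integral_limit_from_level_sets:
  fixes u :: "'a \<Rightarrow> ennreal"
  assumes Q: "\<And>n. prob_space (Q n)" "prob_space P" and sets: "\<And>n. sets (Q n) = sets S" "sets P = sets S"
    and u[measurable]: "u \<in> borel_measurable S" and bnd: "\<And>x. u x \<le> ennreal C"
    and lim: "\<And>B. B \<in> sets borel \<Longrightarrow> ((\<lambda>n. measure (Q n) (u -` B \<inter> space S)) \<longlongrightarrow> measure P (u -` B \<inter> space S)) F"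
  shows "((\<lambda>n. \<integral>\<^sup>+x. u x \<partial>Q n) \<longlongrightarrow> (\<integral>\<^sup>+x. u x \<partial>P)) F"
proof -
  define h where "h x = enn2real (u x)" for x
  define C' where "C' = max C 0"
  have u_h: "u x = ennreal (h x)" for x
    unfolding h_def using bnd[of x] by (metis ennreal_enn2real_if ennreal_less_top neq_top_trans less_top)
  have h[measurable]: "h \<in> borel_measurable S" unfolding h_def by measurable
  have b: "0 \<le> h x" "h x \<le> C'" for x
  proof -
    have "u x \<le> ennreal C'" unfolding C'_def by (rule order_trans[OF bnd ennreal_leI]) simp
    then show "0 \<le> h x" "h x \<le> C'" by (auto simp: h_def C'_def intro!: enn2real_leI)
  qed
  have "((\<lambda>n. \<integral>x. h x \<partial>Q n) \<longlongrightarrow> (\<integral>x. h x \<partial>P)) F"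
  proof (rule integral_limit_from_level_sets[OF Q sets h b])
    fix B :: "real set" assume [measurable]: "B \<in> sets borel"
    have "enn2real -` B \<in> sets borel"
      using measurable_sets[of enn2real borel borel B] by simp
    from lim[OF this] show "((\<lambda>n. measure (Q n) (h -` B \<inter> space S)) \<longlongrightarrow> measure P (h -` B \<inter> space S)) F"
      by (simp add: h_def[abs_def] vimage_def)
  qed
  then have "((\<lambda>n. ennreal (\<integral>x. h x \<partial>Q n)) \<longlongrightarrow> ennreal (\<integral>x. h x \<partial>P)) F"
    by (rule tendsto_ennrealI)
  moreover have "(\<integral>\<^sup>+x. u x \<partial>R) = ennreal (\<integral>x. h x \<partial>R)" if R: "prob_space R" "sets R = sets S" for R
  proof -
    interpret R: prob_space R by fact
    have "integrable R h" using b h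
      by (intro R.integrable_const_bound[where B=C']) (auto simp: measurable_cong_sets[OF R(2) refl])
    then show ?thesis unfolding u_h by (rule nn_integral_eq_integral) (simp add: b)
  qed
  ultimately show ?thesis using Q sets by simp
qed

context gibbs_shells begin

definition depends_below :: "nat \<Rightarrow> ((nat \<Rightarrow> 'b code) \<Rightarrow> 'z) \<Rightarrow> bool" where
  "depends_below m f \<longleftrightarrow> (\<forall>w w'. (\<forall>k<m. w k = w' k) \<longrightarrow> f w = f w')"

lemma depends_belowD: "depends_below m f \<Longrightarrow> (\<And>k. k < m \<Longrightarrow> w k = w' k) \<Longrightarrow> f w = f w'"
  by (auto simp: depends_below_def)

lemma depends_below_mono: "depends_below m f \<Longrightarrow> m \<le> n \<Longrightarrow> depends_below n f"
  by (auto simp: depends_below_def)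

lemma depends_below_cfg: "depends_below m (cfg m)"
  by (auto simp: depends_below_def cfg_def)

text \<open>
  Finite additivity passes to the limit, and so does the domination by a multiple of the Poisson law;
  the latter yields continuity at the empty set and absolute continuity on every block of shells.
\<close>

lemma infinite_volume_limit:
  "\<exists>P F. prob_space P \<and> sets P = sets config_space \<and> F \<noteq> bot \<and> F \<le> sequentially \<and>
    (\<forall>m B. B \<in> sets config_space \<longrightarrow> depends_below m (\<lambda>w. w \<in> B) \<longrightarrow>
      ((\<lambda>n. measure (gibbs n) B) \<longlongrightarrow> measure P B) F)"
proof -
  let ?T = "\<lambda>m. PiM {0..<m} shell_law"
  let ?o = "(0, \<lambda>_. undefined) :: 'b code"
  define cyl where "cyl m A = {w :: nat \<Rightarrow> 'b code. restrict w {0..<m} \<in> A}" for m A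
  have r[measurable]: "(\<lambda>w. restrict w {0..<m}) \<in> measurable config_space (?T m)" for m
    by (intro measurable_restrict) (auto simp: measurable_cong_sets[OF refl sets_shell_law])
  have cyl[measurable]: "cyl m A \<in> sets config_space" if "A \<in> sets (?T m)" for m A
    using measurable_sets[OF r that] by (simp add: cyl_def vimage_def)
  have cyl_dep: "depends_below m (\<lambda>w. w \<in> cyl m A)" for m A
  proof -
    have "restrict w {0..<m} = restrict w' {0..<m}" if "\<And>k. k < m \<Longrightarrow> w k = w' k" for w w' :: "nat \<Rightarrow> 'b code"
      using that by (auto simp: restrict_def)
    then show ?thesis unfolding depends_below_def cyl_def mem_Collect_eq
      by (intro allI impI arg_cong[where f="\<lambda>z. z \<in> A"]) blast
  qed
  have T_poisson: "emeasure (?T m) A = emeasure poisson (cyl m A)" if A: "A \<in> sets (?T m)" for m A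
  proof -
    interpret S: prob_space "shell_law k" for k by (rule prob_space_shell_law)
    interpret PP: product_prob_space shell_law UNIV by unfold_locales
    have "emeasure (?T m) A = emeasure (distr poisson (?T m) (\<lambda>w. restrict w {0..<m})) A"
      by (subst PP.distr_PiM_restrict_finite) auto
    also have "\<dots> = emeasure poisson (cyl m A)"
      using A by (subst emeasure_distr) (auto simp: cyl_def vimage_def measurable_cong_sets[OF sets_poisson refl])
    finally show ?thesis .
  qed
  obtain F l where F: "F \<noteq> bot" "F \<le> sequentially"
    and lim0: "\<And>i. ((\<lambda>n. measure (gibbs n) (cyl (fst i) (snd i))) \<longlongrightarrow> l i) F"
  proof -
    have "\<exists>F l. F \<noteq> bot \<and> F \<le> sequentially \<and>
      (\<forall>i. ((\<lambda>n. measure (gibbs n) (cyl (fst i) (snd i))) \<longlongrightarrow> l i) F)"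
      by (rule cluster_filter) simp
    then show thesis using that by (elim exE conjE) (rule that, assumption+, erule spec)
  qed
  have lim: "((\<lambda>n. emeasure (gibbs n) (cyl m A)) \<longlongrightarrow> ennreal (l (m, A))) F" for m A
    using tendsto_ennrealI[OF lim0[of "(m, A)"]] by (simp add: gibbs.emeasure_eq_measure)
  have ev: "eventually (\<lambda>n. m \<le> n) F" for m
    using F(2) eventually_ge_at_top[of m] by (auto simp: le_filter_def)
  let ?v = "\<lambda>m. 1 / emeasure poisson (void m)"
  have v_fin: "?v m < top" for m
    using emeasure_void_pos[of m] by (simp add: divide_ennreal_def ennreal_inverse_eq_top_iff less_top[symmetric])
  have dom: "ennreal (l (m, A)) \<le> ?v m * emeasure (?T m) A" if A: "A \<in> sets (?T m)" for m A
  proof (rule tendsto_upperbound[OF lim _ F(1)])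
    show "eventually (\<lambda>n. emeasure (gibbs n) (cyl m A) \<le> ?v m * emeasure (?T m) A) F"
      using ev[of m]
    proof eventually_elim
      case (elim n)
      have "emeasure (gibbs n) (cyl m A) \<le> emeasure poisson (cyl m A) / emeasure poisson (void m)"
        using elim cyl[OF A] by (rule gibbs_dominated) (rule depends_belowD[OF cyl_dep])
      then show ?case using T_poisson[OF A] by (simp add: divide_ennreal_def mult.commute)
    qed
  qed
  have l_empty: "ennreal (l (m, {})) = 0" for m
    using tendsto_unique[OF F(1) lim[of m "{}"], of 0] by (simp add: cyl_def)
  have l_add: "ennreal (l (m, A \<union> B)) = ennreal (l (m, A)) + ennreal (l (m, B))"
    if A: "A \<in> sets (?T m)" and B: "B \<in> sets (?T m)" and AB: "A \<inter> B = {}" for m A B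
  proof (rule tendsto_unique[OF F(1) lim])
    have "emeasure (gibbs n) (cyl m (A \<union> B)) = emeasure (gibbs n) (cyl m A) + emeasure (gibbs n) (cyl m B)" for n
    proof -
      have "cyl m (A \<union> B) = cyl m A \<union> cyl m B" "cyl m A \<inter> cyl m B = {}" using AB by (auto simp: cyl_def)
      then show ?thesis using A B by (simp add: plus_emeasure)
    qed
    then show "((\<lambda>n. emeasure (gibbs n) (cyl m (A \<union> B))) \<longlongrightarrow> ennreal (l (m, A)) + ennreal (l (m, B))) F"
      by (simp add: tendsto_add[OF lim lim])
  qed
  define N where "N m = measure_of (space (?T m)) (sets (?T m)) (\<lambda>A. ennreal (l (m, A)))" for m
  have sets_N: "sets (N m) = sets (?T m)" for m by (simp add: N_def sets.space_closed sets.sigma_sets_eq)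
  have N: "emeasure (N m) A = ennreal (l (m, A))" if A: "A \<in> sets (?T m)" for m A
  proof (rule emeasure_measure_of[OF N_def])
    show "sets (?T m) \<subseteq> Pow (space (?T m))" by (rule sets.space_closed)
    show "A \<in> sets (N m)" using A sets_N by simp
    show "positive (sets (N m)) (\<lambda>A. ennreal (l (m, A)))" by (simp add: positive_def l_empty)
    show "countably_additive (sets (N m)) (\<lambda>A. ennreal (l (m, A)))"
      unfolding sets_N
    proof (rule sets.empty_continuous_imp_countably_additive)
      show "positive (sets (?T m)) (\<lambda>A. ennreal (l (m, A)))" by (simp add: positive_def l_empty)
      show "additive (sets (?T m)) (\<lambda>A. ennreal (l (m, A)))" by (auto simp: additive_def intro!: l_add)
      show "\<forall>A\<in>sets (?T m). ennreal (l (m, A)) \<noteq> \<infinity>" by simp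
      fix A :: "nat \<Rightarrow> (nat \<Rightarrow> 'b code) set" assume A: "range A \<subseteq> sets (?T m)" "decseq A" "(\<Inter>i. A i) = {}"
      interpret T: prob_space "?T m" by (intro prob_space_PiM prob_space_shell_law)
      have "(\<lambda>i. emeasure (?T m) (A i)) \<longlonglongrightarrow> 0"
        using Lim_emeasure_decseq[OF A(1,2)] A(3) by (simp add: T.emeasure_finite)
      from ennreal_tendsto_cmult[OF v_fin[of m] this]
      have "(\<lambda>i. ?v m * emeasure (?T m) (A i)) \<longlonglongrightarrow> 0" by simp
      then show "(\<lambda>i. ennreal (l (m, A i))) \<longlonglongrightarrow> 0"
      proof (rule tendsto_sandwich[rotated 3])
        show "eventually (\<lambda>i. ennreal (l (m, A i)) \<le> ?v m * emeasure (?T m) (A i)) sequentially"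
          using A(1) by (intro always_eventually allI dom) auto
      qed auto
    qed
  qed
  have N_prob: "prob_space (N m)" for m
  proof
    have "cyl m (space (?T m)) = UNIV" by (auto simp: cyl_def space_PiM)
    then have "ennreal (l (m, space (?T m))) = 1"
      using gibbs.emeasure_space_1 by (intro tendsto_unique[OF F(1) lim]) simp
    moreover have "space (N m) = space (?T m)" using sets_eq_imp_space_eq[OF sets_N] .
    ultimately show "emeasure (N m) (space (N m)) = 1" using N[of "space (?T m)" m] by simp
  qed
  have ac: "absolutely_continuous (?T m) (N m)" for m
  proof (unfold absolutely_continuous_def, rule subsetI)
    fix A assume "A \<in> null_sets (?T m)"
    then have "A \<in> sets (?T m)" "emeasure (?T m) A = 0" by auto
    then show "A \<in> null_sets (N m)" using dom[of A m] N[of A m] by (simp add: null_sets_def sets_N)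
  qed
  have proj: "distr (N (Suc m)) (?T m) (\<lambda>w. restrict w {0..<m}) = N m" for m
  proof (rule measure_eqI)
    show "sets (distr (N (Suc m)) (?T m) (\<lambda>w. restrict w {0..<m})) = sets (N m)" by (simp add: sets_N)
    fix A assume "A \<in> sets (distr (N (Suc m)) (?T m) (\<lambda>w. restrict w {0..<m}))"
    then have A: "A \<in> sets (?T m)" by simp
    have rr: "(\<lambda>w. restrict w {0..<m}) \<in> measurable (?T (Suc m)) (?T m)"
      by (intro measurable_restrict) auto
    let ?A = "(\<lambda>w. restrict w {0..<m}) -` A \<inter> space (?T (Suc m))"
    have A': "?A \<in> sets (?T (Suc m))" using measurable_sets[OF rr A] .
    have "restrict (restrict w {0..<Suc m}) {0..<m} = restrict w {0..<m}" for w :: "nat \<Rightarrow> 'b code"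
      by (auto simp: restrict_def)
    then have "cyl (Suc m) ?A = cyl m A" by (auto simp: cyl_def space_PiM)
    then have "ennreal (l (Suc m, ?A)) = ennreal (l (m, A))"
      using tendsto_unique[OF F(1) lim[of "Suc m" ?A]] lim[of m A] by simp
    moreover have "emeasure (distr (N (Suc m)) (?T m) (\<lambda>w. restrict w {0..<m})) A = emeasure (N (Suc m)) ?A"
    proof -
      have "(\<lambda>w. restrict w {0..<m}) \<in> measurable (N (Suc m)) (?T m)"
        using rr by (simp only: measurable_cong_sets[OF sets_N refl])
      moreover have "space (N (Suc m)) = space (?T (Suc m))" by (rule sets_eq_imp_space_eq[OF sets_N])
      ultimately show ?thesis using A by (simp add: emeasure_distr)
    qed
    ultimately show "emeasure (distr (N (Suc m)) (?T m) (\<lambda>w. restrict w {0..<m})) A = emeasure (N m) A"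
      using N[OF A] N[OF A'] by simp
  qed
  obtain P where P: "prob_space P" "sets P = sets poisson"
    and PN: "\<And>m. distr P (?T m) (\<lambda>w. restrict w {0..<m}) = N m"
    using extend_projective_density[OF prob_space_shell_law N_prob sets_N ac proj] by blast
  interpret P: prob_space P by fact
  have sets_P: "sets P = sets config_space" using P(2) sets_poisson by simp
  have space_P: "space P = UNIV" using sets_eq_imp_space_eq[OF sets_P] by simp
  have "((\<lambda>n. measure (gibbs n) B) \<longlongrightarrow> measure P B) F"
    if B[measurable]: "B \<in> sets config_space" and dep: "depends_below m (\<lambda>w. w \<in> B)" for m B
  proof -
    define A where "A = {x \<in> space (?T m). (\<lambda>k. if k < m then x k else ?o) \<in> B}"
    have [measurable]: "(\<lambda>x k. if k < m then x k else ?o) \<in> measurable (?T m) config_space"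
    proof (rule measurable_PiM_single')
      fix k
      have "(\<lambda>x. x k) \<in> measurable (?T m) code_space" if "k < m"
        using that measurable_component_singleton[of k "{0..<m}" shell_law]
        by (simp add: measurable_cong_sets[OF refl sets_shell_law])
      then show "(\<lambda>x. if k < m then x k else ?o) \<in> measurable (?T m) code_space"
        by (cases "k < m") auto
    qed (auto simp: PiE_iff)
    have A: "A \<in> sets (?T m)" unfolding A_def by measurable
    have "cyl m A = B"
    proof -
      have "restrict w {0..<m} \<in> A \<longleftrightarrow> w \<in> B" for w
        unfolding A_def by (auto simp: space_PiM) (auto elim: depends_belowD[OF dep, THEN iffD1, rotated] depends_belowD[OF dep, THEN iffD2, rotated])
      then show ?thesis by (auto simp: cyl_def)
    qed
    have "emeasure P B = emeasure (distr P (?T m) (\<lambda>w. restrict w {0..<m})) A"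
    proof -
      have "(\<lambda>w. restrict w {0..<m}) \<in> measurable P (?T m)"
        using r by (simp only: measurable_cong_sets[OF sets_P refl])
      then show ?thesis using A \<open>cyl m A = B\<close> by (simp add: emeasure_distr cyl_def space_P vimage_def)
    qed
    also have "\<dots> = ennreal (l (m, A))" unfolding PN by (rule N[OF A])
    finally have "measure P B = l (m, A)"
    proof -
      assume e: "emeasure P B = ennreal (l (m, A))"
      have "0 \<le> l (m, A)"
        by (rule tendsto_lowerbound[OF lim0 _ F(1)]) simp
      then show ?thesis using e by (simp add: measure_def)
    qed
    then show ?thesis using lim0[of "(m, A)"] \<open>cyl m A = B\<close> by simp
  qed
  then show ?thesis using P(1) sets_P F by blast
qed

end

section \<open>The Gibbs equation in infinite volume\<close>

lemma counting_measure_bounded_finite: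
  assumes "\<mu> \<in> counting_measures" "B \<in> sets borel" "bounded B"
  obtains n where "emeasure \<mu> B = of_nat n"
  using assms by (auto simp: counting_measures_def Nats_def)

context gibbs_shells begin

text \<open>
  Locality is only asked for on the counting measures that come from codes.
\<close>

definition local_events :: "'b measure set set" where
  "local_events = {E \<in> sets counting_measure_algebra. \<exists>m. depends_below m (\<lambda>w. points w \<in> E)}"

lemma local_events_Int: "E \<in> local_events \<Longrightarrow> E' \<in> local_events \<Longrightarrow> E \<inter> E' \<in> local_events"
proof -
  assume "E \<in> local_events" "E' \<in> local_events"
  then obtain m m' where E: "E \<in> sets counting_measure_algebra" "E' \<in> sets counting_measure_algebra"
    and "depends_below m (\<lambda>w. points w \<in> E)" "depends_below m' (\<lambda>w. points w \<in> E')"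
    by (auto simp: local_events_def)
  then have "depends_below (max m m') (\<lambda>w. points w \<in> E)" "depends_below (max m m') (\<lambda>w. points w \<in> E')"
    by (auto intro: depends_below_mono)
  then have "depends_below (max m m') (\<lambda>w. points w \<in> E \<inter> E')"
    unfolding depends_below_def Int_iff by metis
  then show ?thesis using E by (auto simp: local_events_def)
qed

lemma local_events_count:
  assumes "B \<in> sets borel" "bounded B" and S: "S \<in> sets borel"
  shows "{\<mu> \<in> counting_measures. emeasure \<mu> B \<in> S} \<in> local_events"
proof -
  obtain m where m: "B \<subseteq> (\<Union>k<m. D k)" using bounded_cover assms by blast
  have "(emeasure (points w) B \<in> S) = (emeasure (points w') B \<in> S)" if "\<forall>k<m. w k = w' k" for w w'
    using that unfolding emeasure_points_bounded[OF assms(1) m] by (simp add: cfg_def)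
  then have "depends_below m (\<lambda>w. points w \<in> {\<mu> \<in> counting_measures. emeasure \<mu> B \<in> S})"
    unfolding depends_below_def by (simp add: points_counting)
  moreover have "{\<mu> \<in> space counting_measure_algebra. emeasure \<mu> B \<in> S} \<in> sets counting_measure_algebra"
    using assms by measurable
  ultimately show ?thesis by (auto simp: local_events_def)
qed

lemma sets_counting_measure_algebra_local:
  "sets (counting_measure_algebra :: 'b measure measure) = sigma_sets counting_measures local_events"
proof
  have sub: "local_events \<subseteq> Pow counting_measures"
    using sets.sets_into_space by (fastforce simp: local_events_def)
  show "sigma_sets counting_measures local_events \<subseteq> sets counting_measure_algebra"
    using sets.sigma_sets_subset[of local_events counting_measure_algebra] by (auto simp: local_events_def)
  let ?L = "sigma counting_measures local_events"
  have "(\<lambda>\<mu>. \<mu>) \<in> measurable ?L counting_measure_algebra"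
  proof (rule measurable_counting_measure_algebra)
    show "\<mu> \<in> counting_measures" if "\<mu> \<in> space ?L" for \<mu> using that sub by (simp add: space_measure_of_conv)
    have bdd: "(\<lambda>\<mu>. emeasure \<mu> B) \<in> borel_measurable ?L" if "B \<in> sets borel" "bounded B" for B
    proof (rule measurableI)
      fix S :: "ennreal set" assume "S \<in> sets borel"
      then have "{\<mu> \<in> counting_measures. emeasure \<mu> B \<in> S} \<in> sets ?L"
        using local_events_count[OF that] sub by (auto simp: sets_measure_of)
      moreover have "(\<lambda>\<mu>. emeasure \<mu> B) -` S \<inter> space ?L = {\<mu> \<in> counting_measures. emeasure \<mu> B \<in> S}"
        using sub by (auto simp: space_measure_of_conv)
      ultimately show "(\<lambda>\<mu>. emeasure \<mu> B) -` S \<inter> space ?L \<in> sets ?L" by simp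
    qed simp
    fix B :: "'b set" assume B: "B \<in> sets borel"
    have "(\<lambda>\<mu>. \<Sum>k. emeasure \<mu> (B \<inter> D k)) \<in> borel_measurable ?L"
      by (intro borel_measurable_suminf_order bdd) (use B bounded_D in \<open>auto intro: bounded_subset\<close>)
    moreover have "(\<Sum>k. emeasure \<mu> (B \<inter> D k)) = emeasure \<mu> B" if "\<mu> \<in> space ?L" for \<mu>
    proof -
      have s: "sets \<mu> = sets borel" using that sub by (simp add: space_measure_of_conv counting_measures_def)
      have "(\<Sum>k. emeasure \<mu> (B \<inter> D k)) = emeasure \<mu> (\<Union>k. B \<inter> D k)"
        using B disj by (intro suminf_emeasure) (auto simp: s disjoint_family_on_def)
      also have "(\<Union>k. B \<inter> D k) = B" using cover by blast
      finally show ?thesis .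
    qed
    ultimately show "(\<lambda>\<mu>. emeasure \<mu> B) \<in> borel_measurable ?L"
      using measurable_cong[of ?L "\<lambda>\<mu>. \<Sum>k. emeasure \<mu> (B \<inter> D k)" "\<lambda>\<mu>. emeasure \<mu> B"] by blast
  qed
  note id = this
  show "sets (counting_measure_algebra :: 'b measure measure) \<subseteq> sigma_sets counting_measures local_events"
  proof
    fix E :: "'b measure set" assume E: "E \<in> sets counting_measure_algebra"
    then have "E \<subseteq> counting_measures" using sets.sets_into_space by fastforce
    then have "(\<lambda>\<mu>. \<mu>) -` E \<inter> space ?L = E" using sub by (auto simp: space_measure_of_conv)
    then show "E \<in> sigma_sets counting_measures local_events"
      using measurable_sets[OF id E] sub by (simp add: sets_measure_of)
  qed
qed

text \<open>
  Both integrands are bounded, the left one by \<open>j\<close> and the right one, after integration over the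
  shell, by \<open>M (D k)\<close>; both depend on finitely many shells. Hence their finite-volume expectations,
  which agree by \<open>gibbs_gnz\<close>, converge to the infinite-volume ones.
\<close>

lemma limit_gnz_local:
  assumes P: "prob_space P" "sets P = sets config_space" and F: "F \<noteq> bot" "F \<le> sequentially"
    and lim: "\<And>m B. B \<in> sets config_space \<Longrightarrow> depends_below m (\<lambda>w. w \<in> B) \<Longrightarrow>
      ((\<lambda>n. measure (gibbs n) B) \<longlongrightarrow> measure P B) F"
    and stable: "\<And>n x w. m \<le> n \<Longrightarrow> x \<in> D k \<Longrightarrow> \<kappa> x (cfg n w) = \<kappa> x (cfg m w)"
    and E[measurable]: "E \<in> sets config_space" and dep: "depends_below m' (\<lambda>w. w \<in> E)"
    and inv: "\<And>w w'. (\<And>j. shell (D j) (w j) = shell (D j) (w' j)) \<Longrightarrow> w \<in> E \<longleftrightarrow> w' \<in> E"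
    and bnd: "\<And>w. w \<in> E \<Longrightarrow> size (shell (D k) (w k)) \<le> j"
    and A[measurable]: "A \<in> sets borel"
  shows "(\<integral>\<^sup>+w. of_nat (size (filter_mset (\<lambda>x. x \<in> A) (shell (D k) (w k)))) * indicator E w \<partial>P) =
    (\<integral>\<^sup>+w. \<integral>\<^sup>+x. indicator E (insert_at k x w) * \<kappa> x (cfg m w) * indicator (A \<inter> D k) x \<partial>M \<partial>P)"
proof -
  define u :: "(nat \<Rightarrow> 'b code) \<Rightarrow> ennreal"
    where "u w = of_nat (size (filter_mset (\<lambda>x. x \<in> A) (shell (D k) (w k)))) * indicator E w" for w
  define v where "v w = (\<integral>\<^sup>+x. indicator E (insert_at k x w) * \<kappa> x (cfg m w) * indicator (A \<inter> D k) x \<partial>M)" for w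
  have u[measurable]: "u \<in> borel_measurable config_space" unfolding u_def by measurable
  have v[measurable]: "v \<in> borel_measurable config_space" unfolding v_def by measurable
  let ?m = "max (Suc k) (max m m')"
  have dep': "indicator E w = (indicator E w' :: ennreal)" if "\<And>i. i < ?m \<Longrightarrow> w i = w' i" for w w'
    using depends_belowD[OF dep, of w w'] that by (simp add: indicator_def)
  have u_dep: "depends_below ?m u"
    unfolding depends_below_def u_def
  proof (intro allI impI)
    fix w w' :: "nat \<Rightarrow> 'b code" assume e: "\<forall>k<?m. w k = w' k"
    then have "w k = w' k" "indicator E w = (indicator E w' :: ennreal)" by (auto intro: dep')
    then show "of_nat (size (filter_mset (\<lambda>x. x \<in> A) (shell (D k) (w k)))) * (indicator E w :: ennreal) =
       of_nat (size (filter_mset (\<lambda>x. x \<in> A) (shell (D k) (w' k)))) * indicator E w'" by simp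
  qed
  have v_dep: "depends_below ?m v"
    unfolding depends_below_def v_def
  proof (intro allI impI nn_integral_cong)
    fix w w' :: "nat \<Rightarrow> 'b code" and x assume e: "\<forall>k<?m. w k = w' k"
    then have "cfg m w = cfg m w'" by (intro depends_belowD[OF depends_below_cfg]) auto
    moreover have "indicator E (insert_at k x w) = (indicator E (insert_at k x w') :: ennreal)"
      using e by (intro dep') (auto simp: insert_at_def)
    ultimately show "(indicator E (insert_at k x w) :: ennreal) * \<kappa> x (cfg m w) * indicator (A \<inter> D k) x =
       indicator E (insert_at k x w') * \<kappa> x (cfg m w') * indicator (A \<inter> D k) x" by simp
  qed
  have level: "((\<lambda>n. measure (gibbs n) (f -` B \<inter> space config_space)) \<longlongrightarrow> measure P (f -` B \<inter> space config_space)) F"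
    if "f \<in> borel_measurable config_space" "depends_below ?m f" "B \<in> sets borel" for f :: "(nat \<Rightarrow> 'b code) \<Rightarrow> ennreal" and B
  proof (rule lim[of _ ?m])
    show "f -` B \<inter> space config_space \<in> sets config_space" using that(1,3) by (rule measurable_sets)
    have "f w = f w'" if "\<forall>k<?m. w k = w' k" for w w'
      by (rule \<open>depends_below ?m f\<close>[unfolded depends_below_def, rule_format]) (rule that[rule_format])
    then show "depends_below ?m (\<lambda>w. w \<in> f -` B \<inter> space config_space)"
      unfolding depends_below_def by (intro allI impI) (simp only: vimage_eq Int_iff space_config_space UNIV_I)
  qed
  have "size (filter_mset (\<lambda>x. x \<in> A) (shell (D k) (w k))) \<le> j" if "w \<in> E" for w
    using bnd[OF that] size_filter_mset_lesseq[of "\<lambda>x. x \<in> A" "shell (D k) (w k)"] by linarith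
  then have u_le: "u w \<le> ennreal (real j)" for w
    by (auto simp: u_def indicator_def ennreal_of_nat_eq_real_of_nat)
  have v_le: "v w \<le> ennreal (measure M (D k))" for w
  proof -
    have "v w \<le> (\<integral>\<^sup>+x. indicator (D k) x \<partial>M)"
      unfolding v_def using \<kappa>_le_1
      by (intro nn_integral_mono) (auto simp: indicator_def)
    also have "\<dots> = emeasure M (D k)" by (simp add: sets_M)
    also have "\<dots> = ennreal (measure M (D k))"
      using finite_D[of k] by (intro emeasure_eq_ennreal_measure) auto
    finally show ?thesis .
  qed
  have lim_u: "((\<lambda>n. \<integral>\<^sup>+w. u w \<partial>gibbs n) \<longlongrightarrow> (\<integral>\<^sup>+w. u w \<partial>P)) F"
    by (rule nn_integral_limit_from_level_sets[where S=config_space, OF gibbs.prob_space_axioms P(1) sets_gibbs P(2) u u_le level[OF u u_dep]])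
  have lim_v: "((\<lambda>n. \<integral>\<^sup>+w. v w \<partial>gibbs n) \<longlongrightarrow> (\<integral>\<^sup>+w. v w \<partial>P)) F"
    by (rule nn_integral_limit_from_level_sets[where S=config_space, OF gibbs.prob_space_axioms P(1) sets_gibbs P(2) v v_le level[OF v v_dep]])
  have "eventually (\<lambda>n. ?m \<le> n) F"
    using F(2) eventually_ge_at_top[of ?m] by (simp only: le_filter_def)
  then have "eventually (\<lambda>n. (\<integral>\<^sup>+w. u w \<partial>gibbs n) = (\<integral>\<^sup>+w. v w \<partial>gibbs n)) F"
  proof eventually_elim
    case (elim n)
    have "(\<integral>\<^sup>+w. u w \<partial>gibbs n) =
      (\<integral>\<^sup>+w. \<integral>\<^sup>+x. indicator E (insert_at k x w) * \<kappa> x (cfg n w) * indicator (A \<inter> D k) x \<partial>M \<partial>gibbs n)"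
      unfolding u_def
    proof (rule gibbs_gnz)
      show "k < n" using elim by simp
      show "(indicator E w :: ennreal) = indicator E w'"
        if "\<And>j. shell (D j) (w j) = shell (D j) (w' j)" for w w'
        using inv[OF that] by (simp only: indicator_def)
    qed measurable
    also have "\<dots> = (\<integral>\<^sup>+w. v w \<partial>gibbs n)"
      unfolding v_def
    proof (intro nn_integral_cong)
      fix w x
      have "m \<le> n" using elim by simp
      from stable[OF this, of x w]
      show "(indicator E (insert_at k x w) :: ennreal) * \<kappa> x (cfg n w) * indicator (A \<inter> D k) x =
        indicator E (insert_at k x w) * \<kappa> x (cfg m w) * indicator (A \<inter> D k) x"
        by (cases "x \<in> D k") simp_all
    qed
    finally show ?case .
  qed
  from tendsto_cong[OF this] lim_u have "((\<lambda>n. \<integral>\<^sup>+w. v w \<partial>gibbs n) \<longlongrightarrow> (\<integral>\<^sup>+w. u w \<partial>P)) F" by simp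
  then have "(\<integral>\<^sup>+w. u w \<partial>P) = (\<integral>\<^sup>+w. v w \<partial>P)" by (rule tendsto_unique[OF F(1) _ lim_v])
  then show ?thesis by (simp only: u_def v_def)
qed

text \<open>
  Both sides are integrals of \<open>f\<close> with respect to a measure on pairs of a point and a counting
  measure. These measures agree on rectangles over local events by \<open>limit_gnz_local\<close>, once the event is
  exhausted by bounds on the number of points in the shell, and the right one is finite.
\<close>

lemma limit_gnz_shell:
  assumes P: "prob_space P" "sets P = sets config_space" and F: "F \<noteq> bot" "F \<le> sequentially"
    and lim: "\<And>m B. B \<in> sets config_space \<Longrightarrow> depends_below m (\<lambda>w. w \<in> B) \<Longrightarrow>
      ((\<lambda>n. measure (gibbs n) B) \<longlongrightarrow> measure P B) F"
    and stable: "\<And>n x w. m \<le> n \<Longrightarrow> x \<in> D k \<Longrightarrow> \<kappa> x (cfg n w) = \<kappa> x (cfg m w)"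
    and f: "case_prod f \<in> borel_measurable (borel \<Otimes>\<^sub>M counting_measure_algebra)"
  shows "(\<integral>\<^sup>+w. (\<Sum>i<fst (w k). f (snd (w k) i) (points w) * indicator (D k) (snd (w k) i)) \<partial>P) =
    (\<integral>\<^sup>+w. \<integral>\<^sup>+x. f x (points (insert_at k x w)) * \<kappa> x (cfg m w) * indicator (D k) x \<partial>M \<partial>P)"
proof -
  interpret P: prob_space P by fact
  note P(2)[measurable_cong]
  have space_P: "space P = UNIV" using sets_eq_imp_space_eq[OF P(2)] by simp
  interpret cs: sigma_finite_measure "count_space (UNIV :: nat set)"
    by (rule sigma_finite_measure_count_space)
  let ?BC = "borel \<Otimes>\<^sub>M counting_measure_algebra :: ('b \<times> 'b measure) measure"
  let ?pt = "\<lambda>z :: (nat \<Rightarrow> 'b code) \<times> nat. snd (fst z k) (snd z)"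
  have pt[measurable]: "?pt \<in> borel_measurable (P \<Otimes>\<^sub>M count_space UNIV)"
    by (rule measurable_compose_countable[where f="\<lambda>i z. snd (fst z k) i" and g=snd]) measurable
  define d1 where "d1 z = (if snd z < fst (fst z k) then indicator (D k) (?pt z) else 0 :: ennreal)"
    for z :: "(nat \<Rightarrow> 'b code) \<times> nat"
  have [measurable]: "d1 \<in> borel_measurable (P \<Otimes>\<^sub>M count_space UNIV)"
  proof -
    have N: "(\<lambda>z. fst (fst z k)) \<in> measurable (P \<Otimes>\<^sub>M count_space (UNIV :: nat set)) (count_space UNIV)" by measurable
    have [measurable]: "Measurable.pred (P \<Otimes>\<^sub>M count_space UNIV) (\<lambda>z. snd z < fst (fst z k))"
      by (rule measurable_compose_countable[where f="\<lambda>i z. i < fst (fst z k)" and g=snd])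
         (rule measurable_compose[OF N measurable_count_space], measurable)
    show ?thesis unfolding d1_def by measurable
  qed
  define d2 where "d2 z = \<kappa> (snd z) (cfg m (fst z)) * indicator (D k) (snd z)" for z
  have [measurable]: "d2 \<in> borel_measurable (P \<Otimes>\<^sub>M M)"
    unfolding d2_def by measurable
  let ?g1 = "\<lambda>z. (?pt z, points (fst z))"
  let ?g2 = "\<lambda>z. (snd z, points (insert_at k (snd z) (fst z)))"
  have g1[measurable]: "?g1 \<in> measurable (P \<Otimes>\<^sub>M count_space UNIV) ?BC" by measurable
  have g2[measurable]: "?g2 \<in> measurable (P \<Otimes>\<^sub>M M) ?BC" by measurable
  define C1 where "C1 = distr (density (P \<Otimes>\<^sub>M count_space UNIV) d1) ?BC ?g1"
  define C2 where "C2 = distr (density (P \<Otimes>\<^sub>M M) d2) ?BC ?g2"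
  have C1: "(\<integral>\<^sup>+z. g z \<partial>C1) = (\<integral>\<^sup>+w. (\<Sum>i<fst (w k). g (snd (w k) i, points w) * indicator (D k) (snd (w k) i)) \<partial>P)"
    if [measurable]: "g \<in> borel_measurable ?BC" for g
  proof -
    have "(\<integral>\<^sup>+z. g z \<partial>C1) = (\<integral>\<^sup>+z. d1 z * g (?g1 z) \<partial>(P \<Otimes>\<^sub>M count_space UNIV))"
      unfolding C1_def by (subst nn_integral_distr) (auto simp: nn_integral_density)
    also have "\<dots> = (\<integral>\<^sup>+w. \<integral>\<^sup>+i. d1 (w, i) * g (?g1 (w, i)) \<partial>count_space UNIV \<partial>P)"
      by (rule cs.nn_integral_fst[symmetric]) measurable
    also have "\<dots> = (\<integral>\<^sup>+w. (\<Sum>i<fst (w k). g (snd (w k) i, points w) * indicator (D k) (snd (w k) i)) \<partial>P)"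
    proof (intro nn_integral_cong)
      fix w :: "nat \<Rightarrow> 'b code"
      have "(\<integral>\<^sup>+i. d1 (w, i) * g (?g1 (w, i)) \<partial>count_space UNIV) = (\<Sum>i<fst (w k). d1 (w, i) * g (?g1 (w, i)))"
        by (rule nn_integral_count_space') (auto simp: d1_def)
      also have "\<dots> = (\<Sum>i<fst (w k). g (snd (w k) i, points w) * indicator (D k) (snd (w k) i))"
        by (intro sum.cong) (auto simp: d1_def mult.commute)
      finally show "(\<integral>\<^sup>+i. d1 (w, i) * g (?g1 (w, i)) \<partial>count_space UNIV)
        = (\<Sum>i<fst (w k). g (snd (w k) i, points w) * indicator (D k) (snd (w k) i))" .
    qed
    finally show ?thesis .
  qed
  have C2: "(\<integral>\<^sup>+z. g z \<partial>C2) = (\<integral>\<^sup>+w. \<integral>\<^sup>+x. g (x, points (insert_at k x w)) * \<kappa> x (cfg m w) * indicator (D k) x \<partial>M \<partial>P)"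
    if [measurable]: "g \<in> borel_measurable ?BC" for g
  proof -
    have "(\<integral>\<^sup>+z. g z \<partial>C2) = (\<integral>\<^sup>+z. d2 z * g (?g2 z) \<partial>(P \<Otimes>\<^sub>M M))"
      unfolding C2_def by (subst nn_integral_distr) (auto simp: nn_integral_density)
    also have "\<dots> = (\<integral>\<^sup>+w. \<integral>\<^sup>+x. d2 (w, x) * g (?g2 (w, x)) \<partial>M \<partial>P)"
      by (rule M.nn_integral_fst[symmetric]) measurable
    finally show ?thesis by (simp add: d2_def mult_ac)
  qed
  have sets_C: "sets C1 = sets ?BC" "sets C2 = sets ?BC" by (simp_all add: C1_def C2_def)
  have rect: "emeasure C1 (A \<times> E) = emeasure C2 (A \<times> E)" if A[measurable]: "A \<in> sets borel" and E: "E \<in> local_events" for A E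
  proof -
    \<comment> \<open>On \<open>Ej j\<close> at most \<open>j\<close> points lie in the shell, as the passage to the limit requires.\<close>
    define Ej where "Ej j = E \<inter> {\<mu> \<in> counting_measures. emeasure \<mu> (D k) \<in> {..of_nat j}}" for j :: nat
    have Ej: "Ej j \<in> local_events" for j
      unfolding Ej_def using E by (intro local_events_Int local_events_count) (auto simp: bounded_D)
    have Ejm: "A \<times> Ej j \<in> sets ?BC" for j using Ej[of j] by (auto simp: local_events_def)
    have un: "A \<times> E = (\<Union>j. A \<times> Ej j)"
    proof -
      have "\<exists>j. \<mu> \<in> Ej j" if "\<mu> \<in> E" for \<mu>
      proof -
        have \<mu>: "\<mu> \<in> counting_measures" using that E sets.sets_into_space by (fastforce simp: local_events_def)
        obtain n where "emeasure \<mu> (D k) = of_nat n"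
          using counting_measure_bounded_finite[OF \<mu> D bounded_D] .
        then show ?thesis using that \<mu> by (auto simp: Ej_def intro!: exI[of _ n])
      qed
      then show ?thesis by (auto simp: Ej_def)
    qed
    have inc: "incseq (\<lambda>j. A \<times> Ej j)"
    proof (rule incseq_SucI)
      fix j
      have "of_nat j \<le> (of_nat (Suc j) :: ennreal)" by (rule of_nat_mono) simp
      then show "A \<times> Ej j \<subseteq> A \<times> Ej (Suc j)" unfolding Ej_def by (auto intro: order_trans)
    qed
    have eq: "emeasure C1 (A \<times> Ej j) = emeasure C2 (A \<times> Ej j)" for j
    proof -
      let ?E = "{w. points w \<in> Ej j}"
      have Em[measurable]: "?E \<in> sets config_space"
        using measurable_sets[OF measurable_points, of "Ej j"] Ej[of j] by (auto simp: local_events_def vimage_def)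
      obtain m' where m': "depends_below m' (\<lambda>w. points w \<in> Ej j)" using Ej[of j] by (auto simp: local_events_def)
      have ind1: "indicator (A \<times> Ej j) (x, points w) = (indicator A x * indicator ?E w :: ennreal)" for x w
        by (auto split: split_indicator)
      have "emeasure C1 (A \<times> Ej j) = (\<integral>\<^sup>+z. indicator (A \<times> Ej j) z \<partial>C1)" using Ejm sets_C by simp
      also have "\<dots> = (\<integral>\<^sup>+w. of_nat (size (filter_mset (\<lambda>x. x \<in> A) (shell (D k) (w k)))) * indicator ?E w \<partial>P)"
        unfolding C1[OF borel_measurable_indicator[OF Ejm]] ind1 size_filter_shell sum_distrib_right
        by (intro nn_integral_cong sum.cong) (auto split: split_indicator)
      also have "\<dots> = (\<integral>\<^sup>+w. \<integral>\<^sup>+x. indicator ?E (insert_at k x w) * \<kappa> x (cfg m w) * indicator (A \<inter> D k) x \<partial>M \<partial>P)"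
      proof (rule limit_gnz_local[OF P F lim stable Em, where m'=m' and j=j])
        show "depends_below m' (\<lambda>w. w \<in> ?E)" using m' by simp
        show "w \<in> ?E \<longleftrightarrow> w' \<in> ?E" if "\<And>j. shell (D j) (w j) = shell (D j) (w' j)" for w w'
          using points_cong[OF that] by simp
        fix w assume "w \<in> ?E"
        then have "emeasure (points w) (D k) \<le> of_nat j" by (simp add: Ej_def)
        moreover have "emeasure (points w) (D k) = of_nat (size (filter_mset (\<lambda>x. x \<in> D k) (cfg (Suc k) w)))"
          by (rule emeasure_points_bounded) auto
        ultimately have "size (filter_mset (\<lambda>x. x \<in> D k) (cfg (Suc k) w)) \<le> j" by simp
        moreover have "filter_mset (\<lambda>x. x \<in> D k) (shell (D k) y) = shell (D k) y" for y
          by (simp add: shell_def filter_filter_mset)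
        ultimately show "size (shell (D k) (w k)) \<le> j"
          unfolding filter_cfg_size by simp
      qed (assumption+, rule A)
      also have "\<dots> = (\<integral>\<^sup>+z. indicator (A \<times> Ej j) z \<partial>C2)"
        unfolding C2[OF borel_measurable_indicator[OF Ejm]] ind1
        by (intro nn_integral_cong) (auto split: split_indicator)
      also have "\<dots> = emeasure C2 (A \<times> Ej j)" using Ejm sets_C by simp
      finally show ?thesis .
    qed
    have "(\<lambda>j. emeasure C1 (A \<times> Ej j)) \<longlonglongrightarrow> emeasure C1 (A \<times> E)"
      unfolding un using Ejm inc by (intro Lim_emeasure_incseq) (auto simp: sets_C)
    moreover have "(\<lambda>j. emeasure C2 (A \<times> Ej j)) \<longlonglongrightarrow> emeasure C2 (A \<times> E)"
      unfolding un using Ejm inc by (intro Lim_emeasure_incseq) (auto simp: sets_C)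
    ultimately show ?thesis unfolding eq by (rule LIMSEQ_unique)
  qed
  have top_local: "counting_measures \<in> local_events"
    using sets.top[of counting_measure_algebra]
    by (auto simp: local_events_def depends_below_def points_counting)
  let ?gen = "{a \<times> b |a b. a \<in> sets (borel :: 'b measure) \<and> b \<in> local_events}"
  have gen: "sets ?BC = sigma_sets (UNIV \<times> counting_measures) ?gen"
  proof -
    have "sets ?BC = sets (sigma (space borel \<times> space counting_measure_algebra) ?gen)"
    proof (rule sets_pair_eq)
      show "sets (borel :: 'b measure) = sigma_sets (space borel) (sets borel)" by (rule sets.sigma_sets_eq[symmetric])
      show "sets (counting_measure_algebra :: 'b measure measure) = sigma_sets (space counting_measure_algebra) local_events"
        using sets_counting_measure_algebra_local by simp
      show "countable {UNIV :: 'b set}" "{UNIV :: 'b set} \<subseteq> sets borel" "\<Union> {UNIV} = space (borel :: 'b measure)" by auto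
      show "countable {counting_measures :: 'b measure set}" "{counting_measures :: 'b measure set} \<subseteq> local_events"
         "\<Union> {counting_measures :: 'b measure set} = space counting_measure_algebra" using top_local by auto
      show "local_events \<subseteq> Pow (space counting_measure_algebra)"
        unfolding local_events_def using sets.sets_into_space by blast
    qed auto
    also have "\<dots> = sigma_sets (UNIV \<times> counting_measures) ?gen"
      using sets.sets_into_space[of _ counting_measure_algebra]
      by (subst sets_measure_of) (auto simp: local_events_def)
    finally show ?thesis .
  qed
  have "C2 = C1"
  proof (rule measure_eqI_generator_eq)
    show "Int_stable ?gen"
    proof (rule Int_stableI)
      fix X Y assume "X \<in> ?gen" "Y \<in> ?gen"
      then obtain a b a' b' where "X = a \<times> b" "Y = a' \<times> b'" "a \<in> sets borel" "a' \<in> sets borel"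
        "b \<in> local_events" "b' \<in> local_events" by blast
      then show "X \<inter> Y \<in> ?gen"
        by (auto simp: Times_Int_Times intro!: exI[of _ "a \<inter> a'"] exI[of _ "b \<inter> b'"] local_events_Int)
    qed
    show "?gen \<subseteq> Pow (UNIV \<times> counting_measures)"
      using sets.sets_into_space[of _ counting_measure_algebra] by (auto simp: local_events_def)
    show "emeasure C2 X = emeasure C1 X" if "X \<in> ?gen" for X using that rect by auto
    show "sets C2 = sigma_sets (UNIV \<times> counting_measures) ?gen" "sets C1 = sigma_sets (UNIV \<times> counting_measures) ?gen"
      using sets_C gen by auto
    show "range (\<lambda>i::nat. UNIV \<times> counting_measures) \<subseteq> ?gen" using top_local by (auto intro!: exI[of _ UNIV] exI[of _ counting_measures])
    show "(\<Union>i::nat. UNIV \<times> counting_measures) = UNIV \<times> counting_measures" by simp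
    fix i :: nat
    have "emeasure C2 (UNIV \<times> counting_measures) \<le> (\<integral>\<^sup>+z. 1 \<partial>C2)"
      using emeasure_space[of C2 "UNIV \<times> counting_measures"] by simp
    also have "\<dots> = (\<integral>\<^sup>+w. \<integral>\<^sup>+x. 1 * \<kappa> x (cfg m w) * indicator (D k) x \<partial>M \<partial>P)"
      by (rule C2) simp
    also have "\<dots> \<le> (\<integral>\<^sup>+w. \<integral>\<^sup>+x. indicator (D k) x \<partial>M \<partial>P)"
      using \<kappa>_le_1 by (intro nn_integral_mono) (auto split: split_indicator)
    also have "\<dots> = emeasure M (D k)" by (simp add: sets_M P.emeasure_space_1)
    also have "\<dots> < \<infinity>" by (rule finite_D)
    finally show "emeasure C2 (UNIV \<times> counting_measures) \<noteq> \<infinity>" by simp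
  qed
  then have "(\<integral>\<^sup>+z. case_prod f z \<partial>C1) = (\<integral>\<^sup>+z. case_prod f z \<partial>C2)" by simp
  then show ?thesis unfolding C1[OF f] C2[OF f] by simp
qed

theorem infinite_volume_gnz:
  "\<exists>P r. prob_space P \<and> sets P = sets config_space \<and>
    (\<forall>k n x w. r k \<le> n \<longrightarrow> x \<in> D k \<longrightarrow> \<kappa> x (cfg n w) = \<kappa> x (cfg (r k) w)) \<and>
    (\<forall>f. case_prod f \<in> borel_measurable (borel \<Otimes>\<^sub>M counting_measure_algebra) \<longrightarrow> (\<forall>k.
      (\<integral>\<^sup>+w. (\<Sum>i<fst (w k). f (snd (w k) i) (points w) * indicator (D k) (snd (w k) i)) \<partial>P) =
      (\<integral>\<^sup>+w. \<integral>\<^sup>+x. f x (points (insert_at k x w)) * \<kappa> x (cfg (r k) w) * indicator (D k) x \<partial>M \<partial>P)))"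
proof -
  obtain P F where P: "prob_space P" "sets P = sets config_space" and F: "F \<noteq> bot" "F \<le> sequentially"
    and lim: "\<And>m B. B \<in> sets config_space \<Longrightarrow> depends_below m (\<lambda>w. w \<in> B) \<Longrightarrow>
      ((\<lambda>n. measure (gibbs n) B) \<longlongrightarrow> measure P B) F"
    using infinite_volume_limit by (elim exE conjE) (rule that, assumption+, elim allE impE, assumption+)
  define r where "r k = (SOME r. \<forall>m\<ge>r. \<forall>n\<ge>m. \<forall>x\<in>D k. \<forall>w. \<kappa> x (cfg n w) = \<kappa> x (cfg m w))" for k
  have r: "\<forall>m\<ge>r k. \<forall>n\<ge>m. \<forall>x\<in>D k. \<forall>w. \<kappa> x (cfg n w) = \<kappa> x (cfg m w)" for k
    unfolding r_def by (rule someI_ex[OF \<kappa>_cfg_stable])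
  have stable: "\<kappa> x (cfg n w) = \<kappa> x (cfg (r k) w)" if "r k \<le> n" "x \<in> D k" for k n x w
    by (rule r[THEN spec, THEN mp, OF order_refl, THEN spec, THEN mp, OF that(1), THEN bspec, OF that(2), THEN spec])
  show ?thesis
  proof (intro exI[of _ P] exI[of _ r] conjI P allI impI)
    show "\<kappa> x (cfg n w) = \<kappa> x (cfg (r k) w)" if "r k \<le> n" "x \<in> D k" for k n x w
      using that by (rule stable)
    fix f :: "'b \<Rightarrow> 'b measure \<Rightarrow> ennreal" and k
    assume f: "case_prod f \<in> borel_measurable (borel \<Otimes>\<^sub>M counting_measure_algebra)"
    show "(\<integral>\<^sup>+w. (\<Sum>i<fst (w k). f (snd (w k) i) (points w) * indicator (D k) (snd (w k) i)) \<partial>P) =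
      (\<integral>\<^sup>+w. \<integral>\<^sup>+x. f x (points (insert_at k x w)) * \<kappa> x (cfg (r k) w) * indicator (D k) x \<partial>M \<partial>P)"
      by (rule limit_gnz_shell[OF P F _ _ f]) (rule lim, assumption+, rule stable, assumption+)
  qed
qed

end

context gibbs_shells begin

lemma measurable_shell_sum:
  assumes [measurable]: "case_prod g \<in> borel_measurable (borel \<Otimes>\<^sub>M config_space)"
  shows "(\<lambda>w. \<Sum>i<fst (w k). g (snd (w k) i) w * indicator (D k) (snd (w k) i) :: ennreal) \<in> borel_measurable config_space"
proof (rule measurable_compose_countable[where f="\<lambda>n w. \<Sum>i<n. g (snd (w k) i) w * indicator (D k) (snd (w k) i)" and g="\<lambda>w. fst (w k)"])
  fix n
  have [measurable]: "(\<lambda>w. g (snd (w k) i) w) \<in> borel_measurable config_space" for i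
  proof -
    have "(\<lambda>w. (snd (w k) i, w)) \<in> measurable config_space (borel \<Otimes>\<^sub>M config_space)" by measurable
    from measurable_compose[OF this assms] show ?thesis by simp
  qed
  show "(\<lambda>w. \<Sum>i<n. g (snd (w k) i) w * indicator (D k) (snd (w k) i)) \<in> borel_measurable config_space"
    by measurable
qed measurable

theorem gibbs_process_exists:
  fixes \<Lambda> :: "'b measure" and \<theta> :: "'b \<Rightarrow> ennreal" and \<K> :: "'b \<Rightarrow> 'b measure \<Rightarrow> ennreal"
  assumes sets_\<Lambda>: "sets \<Lambda> = sets borel" and \<theta>: "\<theta> \<in> borel_measurable borel" and M: "M = density \<Lambda> \<theta>"
    and \<K>: "AE x in \<Lambda>. \<forall>k w. x \<in> D k \<longrightarrow> (\<exists>m. \<forall>n\<ge>m. \<K> x (points w) = \<kappa> x (cfg n w) * \<theta> x)"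
  shows "\<exists>(P :: 'b measure measure) \<eta>. gibbs_process P \<eta> \<K> \<Lambda>"
proof -
  obtain P r where P: "prob_space P" "sets P = sets config_space"
    and r: "\<forall>k n x w. r k \<le> n \<longrightarrow> x \<in> D k \<longrightarrow> \<kappa> x (cfg n w) = \<kappa> x (cfg (r k) w)"
    and gnz: "\<forall>f. case_prod f \<in> borel_measurable (borel \<Otimes>\<^sub>M counting_measure_algebra) \<longrightarrow> (\<forall>k.
      (\<integral>\<^sup>+w. (\<Sum>i<fst (w k). f (snd (w k) i) (points w) * indicator (D k) (snd (w k) i)) \<partial>P) =
      (\<integral>\<^sup>+w. \<integral>\<^sup>+x. f x (points (insert_at k x w)) * \<kappa> x (cfg (r k) w) * indicator (D k) x \<partial>M \<partial>P))"
    using infinite_volume_gnz by (elim exE conjE) (rule that)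
  interpret P: prob_space P by fact
  have space_P: "space P = UNIV" using sets_eq_imp_space_eq[OF P(2)] by simp
  note P(2)[measurable_cong]
  \<comment> \<open>The law of the point process is taken on the largest sigma-field that makes \<open>points\<close> measurable.
    A function of counting measures is then measurable as soon as its composition with \<open>points\<close> is,
    so that \<open>\<K>\<close> only has to be measurable as a function of codes.\<close>
  let ?F = "{E. E \<subseteq> counting_measures \<and> points -` E \<in> sets P}"
  have alg: "sigma_algebra counting_measures ?F"
    unfolding sigma_algebra_iff2
  proof (intro conjI ballI allI impI)
    show "?F \<subseteq> Pow counting_measures" by auto
    show "{} \<in> ?F" by simp
    show "counting_measures - E \<in> ?F" if "E \<in> ?F" for E
    proof -
      have "points -` (counting_measures - E) = space P - points -` E" by (auto simp: points_counting space_P)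
      then show ?thesis using that by auto
    qed
    show "(\<Union>i. A i) \<in> ?F" if "range A \<subseteq> ?F" for A :: "nat \<Rightarrow> 'b measure set"
      using that by (auto simp: vimage_UN image_subset_iff)
  qed
  define N where "N = measure_of counting_measures ?F (\<lambda>_. 0)"
  have sets_N: "sets N = ?F" and space_N: "space N = counting_measures"
    using alg by (simp_all add: N_def sigma_algebra.sets_measure_of_eq sigma_algebra.space_measure_of_eq)
  have pN: "points \<in> measurable P N"
    by (rule measurableI) (auto simp: space_N sets_N points_counting space_P)
  have N_borel: "g \<in> borel_measurable N" if "(\<lambda>w. g (points w)) \<in> borel_measurable config_space" for g :: "'b measure \<Rightarrow> ennreal"
  proof (rule measurableI)
    fix S :: "ennreal set" assume S: "S \<in> sets borel"
    have "points -` (g -` S \<inter> space N) = (\<lambda>w. g (points w)) -` S \<inter> space config_space"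
      by (auto simp: space_N points_counting)
    then show "g -` S \<inter> space N \<in> sets N"
      using measurable_sets[OF that S] by (auto simp: sets_N space_N P(2))
  qed simp
  let ?P = "distr P N points"
  have int_P: "(\<integral>\<^sup>+\<mu>. g \<mu> \<partial>?P) = (\<integral>\<^sup>+w. g (points w) \<partial>P)"
    if "(\<lambda>w. g (points w)) \<in> borel_measurable config_space" for g :: "'b measure \<Rightarrow> ennreal"
    using N_borel[OF that] by (subst nn_integral_distr[OF pN]) simp_all
  have "gibbs_process ?P (\<lambda>\<mu>. \<mu>) \<K> \<Lambda>"
    unfolding gibbs_process_def point_process_def
  proof (intro conjI allI impI)
    show "prob_space ?P" by (rule P.prob_space_distr[OF pN])
    show "(\<lambda>\<mu>. \<mu>) \<in> measurable ?P counting_measure_algebra"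
    proof (rule measurableI)
      fix E :: "'b measure set" assume E: "E \<in> sets counting_measure_algebra"
      have "E \<subseteq> counting_measures" using sets.sets_into_space[OF E] by simp
      moreover have "points -` E \<in> sets P" using measurable_sets[OF measurable_points E] P(2) by simp
      ultimately show "(\<lambda>\<mu>. \<mu>) -` E \<inter> space ?P \<in> sets ?P" by (auto simp: space_N sets_N Int_absorb2)
    qed (simp add: space_N)
    fix f :: "'b \<Rightarrow> 'b measure \<Rightarrow> ennreal"
    assume f[measurable]: "case_prod f \<in> borel_measurable (borel \<Otimes>\<^sub>M counting_measure_algebra)"
    have fx: "(\<lambda>x. f x \<mu>) \<in> borel_measurable borel" if "\<mu> \<in> counting_measures" for \<mu>
    proof -
      have "(\<lambda>x. (x, \<mu>)) \<in> measurable borel (borel \<Otimes>\<^sub>M counting_measure_algebra)"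
        using that by (intro measurable_Pair) auto
      from measurable_compose[OF this f] show ?thesis by simp
    qed
    let ?S = "\<lambda>k w. \<Sum>i<fst (w k). f (snd (w k) i) (points w) * indicator (D k) (snd (w k) i)"
    let ?I = "\<lambda>k w. \<integral>\<^sup>+x. f x (points (insert_at k x w)) * \<kappa> x (cfg (r k) w) * indicator (D k) x \<partial>M"
    have S_meas: "?S k \<in> borel_measurable config_space" for k
    proof (rule measurable_shell_sum)
      have "(\<lambda>z. (fst z, points (snd z))) \<in> measurable (borel \<Otimes>\<^sub>M config_space) (borel \<Otimes>\<^sub>M counting_measure_algebra)"
        by measurable
      from measurable_compose[OF this f]
      show "(\<lambda>(x, w). f x (points w)) \<in> borel_measurable (borel \<Otimes>\<^sub>M config_space)" by (simp add: case_prod_beta')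
    qed
    have fins: "(\<lambda>z. f (snd z) (points (insert_at k (snd z) (fst z)))) \<in> borel_measurable (config_space \<Otimes>\<^sub>M borel)" for k
    proof -
      have "(\<lambda>z. (snd z, points (insert_at k (snd z) (fst z)))) \<in> measurable (config_space \<Otimes>\<^sub>M borel) (borel \<Otimes>\<^sub>M counting_measure_algebra)"
        by measurable
      from measurable_compose[OF this f] show ?thesis by simp
    qed
    have integrand: "(\<lambda>z. f (snd z) (points (insert_at k (snd z) (fst z))) * \<kappa> (snd z) (cfg (r k) (fst z)) * indicator (D k) (snd z))
       \<in> borel_measurable (config_space \<Otimes>\<^sub>M M)" for k
    proof -
      note fins[measurable]
      have "(\<lambda>z. f (snd z) (points (insert_at k (snd z) (fst z))) * \<kappa> (snd z) (cfg (r k) (fst z)) * indicator (D k) (snd z))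
       \<in> borel_measurable (config_space \<Otimes>\<^sub>M borel)" by measurable
      then show ?thesis
        by (subst measurable_cong_sets[OF sets_pair_measure_cong[OF refl sets_M] refl])
    qed
    have I_meas: "?I k \<in> borel_measurable config_space" for k
      by (rule M.borel_measurable_nn_integral) (use integrand[of k] in \<open>simp add: case_prod_beta'\<close>)
    have lhs: "(\<integral>\<^sup>+x. f x (points w) \<partial>points w) = (\<Sum>k. ?S k w)" for w
      by (rule nn_integral_points[OF fx[OF points_counting]])
    have rhs: "(\<integral>\<^sup>+x. f x (add_measure (points w) (return borel x)) * \<K> x (points w) \<partial>\<Lambda>) = (\<Sum>k. ?I k w)" for w
    proof -
      let ?h = "\<lambda>k x. f x (points (insert_at k x w)) * \<kappa> x (cfg (r k) w) * indicator (D k) x"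
      have h: "?h k \<in> borel_measurable borel" for k
      proof -
        have "(\<lambda>x. (w, x)) \<in> measurable M (config_space \<Otimes>\<^sub>M M)" by simp
        from measurable_compose[OF this integrand[of k]]
        show ?thesis by (simp add: measurable_cong_sets[OF sets_M refl])
      qed
      have "(\<integral>\<^sup>+x. f x (add_measure (points w) (return borel x)) * \<K> x (points w) \<partial>\<Lambda>) = (\<integral>\<^sup>+x. (\<Sum>k. \<theta> x * ?h k x) \<partial>\<Lambda>)"
      proof (rule nn_integral_cong_AE, rule AE_mp[OF \<K>], intro AE_I2 impI)
        fix x
        assume a: "\<forall>k w. x \<in> D k \<longrightarrow> (\<exists>m. \<forall>n\<ge>m. \<K> x (points w) = \<kappa> x (cfg n w) * \<theta> x)"
        obtain k where k: "x \<in> D k" using cover by blast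
        obtain m where m: "\<And>n. n \<ge> m \<Longrightarrow> \<K> x (points w) = \<kappa> x (cfg n w) * \<theta> x"
          using a k by blast
        have "\<K> x (points w) = \<kappa> x (cfg (max m (r k)) w) * \<theta> x" by (rule m) simp
        also have "\<kappa> x (cfg (max m (r k)) w) = \<kappa> x (cfg (r k) w)"
          using r k by (simp only: max.cobounded2 simp_thms)
        finally have K: "\<K> x (points w) = \<kappa> x (cfg (r k) w) * \<theta> x" .
        have "(\<Sum>j. \<theta> x * ?h j x) = (\<Sum>j\<in>{k}. \<theta> x * ?h j x)"
        proof (rule suminf_finite)
          fix j assume "j \<notin> {k}"
          then have "D j \<inter> D k = {}" using disj by (simp add: disjoint_family_on_def)
          then have "x \<notin> D j" using k by blast
          then show "\<theta> x * ?h j x = 0" by simp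
        qed simp
        then show "f x (add_measure (points w) (return borel x)) * \<K> x (points w) = (\<Sum>j. \<theta> x * ?h j x)"
          using k by (simp add: K points_insert_at mult_ac)
      qed
      also have "\<dots> = (\<Sum>k. \<integral>\<^sup>+x. \<theta> x * ?h k x \<partial>\<Lambda>)"
        using h \<theta> by (intro nn_integral_suminf) (simp add: measurable_cong_sets[OF sets_\<Lambda> refl])
      also have "\<dots> = (\<Sum>k. ?I k w)"
        unfolding M using h \<theta> by (subst nn_integral_density) (simp_all add: measurable_cong_sets[OF sets_\<Lambda> refl])
      finally show ?thesis .
    qed
    have S_meas': "?S k \<in> borel_measurable P" and I_meas': "?I k \<in> borel_measurable P" for k
      using S_meas I_meas by (simp_all only: measurable_cong_sets[OF P(2) refl])
    have "(\<integral>\<^sup>+\<mu>. (\<integral>\<^sup>+x. f x \<mu> \<partial>\<mu>) \<partial>?P) = (\<integral>\<^sup>+w. (\<integral>\<^sup>+x. f x (points w) \<partial>points w) \<partial>P)"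
      by (rule int_P, unfold lhs) (rule borel_measurable_suminf_order, rule S_meas)
    also have "\<dots> = (\<Sum>k. \<integral>\<^sup>+w. ?S k w \<partial>P)"
      unfolding lhs by (rule nn_integral_suminf[OF S_meas'])
    also have "\<dots> = (\<Sum>k. \<integral>\<^sup>+w. ?I k w \<partial>P)"
      using gnz f by (intro suminf_cong) blast
    also have "\<dots> = (\<integral>\<^sup>+w. (\<Sum>k. ?I k w) \<partial>P)"
      by (rule nn_integral_suminf[OF I_meas', symmetric])
    also have "\<dots> = (\<integral>\<^sup>+w. (\<integral>\<^sup>+x. f x (add_measure (points w) (return borel x)) * \<K> x (points w) \<partial>\<Lambda>) \<partial>P)"
      unfolding rhs ..
    also have "\<dots> = (\<integral>\<^sup>+\<mu>. (\<integral>\<^sup>+x. f x (add_measure \<mu> (return borel x)) * \<K> x \<mu> \<partial>\<Lambda>) \<partial>?P)"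
      by (rule int_P[symmetric], unfold rhs) (rule borel_measurable_suminf_order, rule I_meas)
    finally show "(\<integral>\<^sup>+\<mu>. (\<integral>\<^sup>+x. f x \<mu> \<partial>\<mu>) \<partial>?P) =
      (\<integral>\<^sup>+\<mu>. (\<integral>\<^sup>+x. f x (add_measure \<mu> (return borel x)) * \<K> x \<mu> \<partial>\<Lambda>) \<partial>?P)" .
  qed
  then show ?thesis by blast
qed

end


section \<open>Potentials, energies and Papangelou intensities\<close>

lemma e2ennreal_diff_cancel: "enn2ereal (e2ennreal a) - enn2ereal (e2ennreal (- a)) = a"
  by (cases "a \<ge> 0") (auto simp: enn2ereal_e2ennreal e2ennreal_neg zero_ennreal.rep_eq)

lemma ereal_sum_not_MInf: "(\<And>i. i \<in> I \<Longrightarrow> f i \<noteq> -\<infinity>) \<Longrightarrow> (\<Sum>i\<in>I. f i) \<noteq> (-\<infinity> :: ereal)"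
  by (induction I rule: infinite_finite_induct) auto

text \<open>
  The integral with respect to a finite counting measure, in terms of positive and negative parts,
  is an ordinary sum.
\<close>

lemma sum_ereal_parts:
  fixes f :: "'i \<Rightarrow> ereal"
  assumes "finite I" "\<And>i. i \<in> I \<Longrightarrow> f i \<noteq> -\<infinity>"
  shows "enn2ereal (\<Sum>i\<in>I. e2ennreal (f i)) - enn2ereal (\<Sum>i\<in>I. e2ennreal (- f i)) = (\<Sum>i\<in>I. f i)"
  using assms
proof (induction I)
  case (insert i I)
  let ?p = "enn2ereal (\<Sum>i\<in>I. e2ennreal (f i))" and ?n = "enn2ereal (\<Sum>i\<in>I. e2ennreal (- f i))"
  let ?a = "enn2ereal (e2ennreal (f i))" and ?b = "enn2ereal (e2ennreal (- f i))"
  have n: "?n < \<infinity>"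
  proof -
    have "e2ennreal (- f i) < top" if "i \<in> I" for i
      using insert.prems[of i] that by (cases "f i") (auto simp: e2ennreal_neg)
    then have "(\<Sum>i\<in>I. e2ennreal (- f i)) < top" using insert.hyps(1) by (simp add: ennreal_sum_less_top)
    then show ?thesis by (cases "\<Sum>i\<in>I. e2ennreal (- f i)") auto
  qed
  have b: "?b < \<infinity>" using insert.prems[of i] by (cases "f i") (auto simp: e2ennreal_neg)
  have "enn2ereal (\<Sum>i\<in>insert i I. e2ennreal (f i)) - enn2ereal (\<Sum>i\<in>insert i I. e2ennreal (- f i)) = (?a + ?p) - (?b + ?n)"
    using insert.hyps by (simp add: plus_ennreal.rep_eq)
  also have "\<dots> = (?a - ?b) + (?p - ?n)"
    using n b by (cases ?a; cases ?p; cases ?b; cases ?n) auto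
  also have "\<dots> = f i + (\<Sum>i\<in>I. f i)"
    using insert by (simp add: e2ennreal_diff_cancel)
  finally show ?case using insert.hyps by simp
qed (simp add: zero_ennreal.rep_eq)

lemma ereal_mult_sum:
  fixes f :: "'i \<Rightarrow> ereal"
  assumes "\<And>i. i \<in> I \<Longrightarrow> f i \<noteq> -\<infinity>" "c > 0"
  shows "ereal c * (\<Sum>i\<in>I. f i) = (\<Sum>i\<in>I. ereal c * f i)"
  using assms(1)
proof (induction I rule: infinite_finite_induct)
  case (insert i I)
  have "(\<Sum>i\<in>I. f i) \<noteq> -\<infinity>" using insert by (intro ereal_sum_not_MInf) auto
  then have "ereal c * (f i + (\<Sum>i\<in>I. f i)) = ereal c * f i + ereal c * (\<Sum>i\<in>I. f i)"
    using insert.prems[of i] \<open>c > 0\<close> by (cases "f i"; cases "\<Sum>i\<in>I. f i") (auto simp: distrib_left)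
  then show ?case using insert by simp
qed auto

lemma ereal_exp_minus_add:
  "a \<noteq> -\<infinity> \<Longrightarrow> b \<noteq> -\<infinity> \<Longrightarrow> ereal_exp (- (a + b)) = ereal_exp (- a) * ereal_exp (- b)"
  by (cases a; cases b) (auto simp: ereal_exp_def exp_add[symmetric] ennreal_mult'[symmetric])

lemma measurable_ereal_exp[measurable]: "ereal_exp \<in> borel_measurable borel"
  unfolding ereal_exp_def[abs_def] by measurable

lemma card_injections:
  assumes "finite J" "card J = m"
  shows "card {t \<in> {..<m} \<rightarrow>\<^sub>E J. inj_on t {..<m}} = fact m"
proof -
  have im: "t ` {..<m} = J" if "t \<in> {..<m} \<rightarrow>\<^sub>E J" "inj_on t {..<m}" for t
    using that assms by (intro card_subset_eq) (auto simp: card_image)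
  have "bij_betw (\<lambda>t. map t [0..<m]) {t \<in> {..<m} \<rightarrow>\<^sub>E J. inj_on t {..<m}} (permutations_of_set J)"
  proof (rule bij_betw_byWitness[where f'="\<lambda>xs. \<lambda>i\<in>{..<m}. xs ! i"])
    show "\<forall>t\<in>{t \<in> {..<m} \<rightarrow>\<^sub>E J. inj_on t {..<m}}. (\<lambda>i\<in>{..<m}. map t [0..<m] ! i) = t"
      by (auto simp: fun_eq_iff PiE_iff extensional_def)
    have len: "length xs = m" if "xs \<in> permutations_of_set J" for xs
      using that assms by (auto simp: permutations_of_set_def distinct_card)
    show "\<forall>xs\<in>permutations_of_set J. map (\<lambda>i\<in>{..<m}. xs ! i) [0..<m] = xs"
      using len by (auto intro!: nth_equalityI)
    show "(\<lambda>t. map t [0..<m]) ` {t \<in> {..<m} \<rightarrow>\<^sub>E J. inj_on t {..<m}} \<subseteq> permutations_of_set J"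
      using im by (auto simp: permutations_of_set_def distinct_map atLeast0LessThan)
    show "(\<lambda>xs. \<lambda>i\<in>{..<m}. xs ! i) ` permutations_of_set J \<subseteq> {t \<in> {..<m} \<rightarrow>\<^sub>E J. inj_on t {..<m}}"
      using len by (auto simp: permutations_of_set_def inj_on_def nth_eq_iff_index_eq split: if_splits)
  qed
  then show ?thesis using assms by (simp add: bij_betw_same_card)
qed

text \<open>
  A set with \<open>m\<close> elements is the range of \<open>fact m\<close> injective tuples; this cancels the factorials in
  the Papangelou intensity.
\<close>

lemma sum_injections:
  fixes f :: "'i set \<Rightarrow> ereal"
  assumes "finite I"
  shows "(\<Sum>t\<in>{t \<in> {..<m} \<rightarrow>\<^sub>E I. inj_on t {..<m}}. f (t ` {..<m}))
    = (\<Sum>J\<in>{J. J \<subseteq> I \<and> card J = m}. f J * ereal (fact m))"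
proof -
  let ?T = "{t \<in> {..<m} \<rightarrow>\<^sub>E I. inj_on t {..<m}}" and ?S = "{J. J \<subseteq> I \<and> card J = m}"
  have fT: "finite ?T" using assms by (intro finite_subset[of ?T "{..<m} \<rightarrow>\<^sub>E I"] finite_PiE) auto
  have "(\<Sum>t\<in>?T. f (t ` {..<m})) = (\<Sum>J\<in>?S. \<Sum>t\<in>{t \<in> ?T. t ` {..<m} = J}. f (t ` {..<m}))"
  proof (rule sum.group[OF fT, symmetric])
    show "finite ?S" using assms by simp
    show "(\<lambda>t. t ` {..<m}) ` ?T \<subseteq> ?S"
    proof (rule image_subsetI)
      fix t assume "t \<in> ?T"
      then have "t ` {..<m} \<subseteq> I" "card (t ` {..<m}) = m" by (auto simp: card_image)
      then show "t ` {..<m} \<in> ?S" by simp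
    qed
  qed
  also have "\<dots> = (\<Sum>J\<in>?S. f J * ereal (fact m))"
  proof (rule sum.cong[OF refl])
    fix J assume J: "J \<in> ?S"
    then have fJ: "finite J" using assms finite_subset by auto
    have im: "t ` {..<m} = J" if "t \<in> {..<m} \<rightarrow>\<^sub>E J" "inj_on t {..<m}" for t
      using that fJ J by (intro card_subset_eq) (auto simp: card_image)
    have "{t \<in> ?T. t ` {..<m} = J} = {t \<in> {..<m} \<rightarrow>\<^sub>E J. inj_on t {..<m}}"
      using J im by (auto simp: PiE_iff)
    then have "card {t \<in> ?T. t ` {..<m} = J} = fact m" using card_injections[of J m] J fJ by simp
    moreover have "(\<Sum>t\<in>{t \<in> ?T. t ` {..<m} = J}. f (t ` {..<m})) = (\<Sum>t\<in>{t \<in> ?T. t ` {..<m} = J}. f J)"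
      by (rule sum.cong) auto
    ultimately show "(\<Sum>t\<in>{t \<in> ?T. t ` {..<m} = J}. f (t ` {..<m})) = f J * ereal (fact m)"
      by (simp add: sum_constant_ereal)
  qed
  finally show ?thesis .
qed

locale potential =
  fixes V :: "nat \<Rightarrow> (nat \<Rightarrow> 'b::metric_space) \<Rightarrow> ereal" and R :: real
  assumes V_measurable: "\<And>n. 2 \<le> n \<Longrightarrow> V n \<in> borel_measurable (PiM {..<n} (\<lambda>_. borel))"
    and V_not_MInf: "\<And>n K. 2 \<le> n \<Longrightarrow> K \<in> space (PiM {..<n} (\<lambda>_. borel)) \<Longrightarrow> V n K \<noteq> -\<infinity>"
    and V_symmetric: "\<And>n K \<pi>. 2 \<le> n \<Longrightarrow> K \<in> space (PiM {..<n} (\<lambda>_. borel)) \<Longrightarrow>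
          \<pi> permutes {..<n} \<Longrightarrow> V n (K \<circ> \<pi>) = V n K"
    and R_pos: "0 < R"
    and V_range: "\<And>n K. 2 \<le> n \<Longrightarrow> K \<in> space (PiM {..<n} (\<lambda>_. borel)) \<Longrightarrow>
          R < Max {dist (K i) (K j) | i j. i < j \<and> j < n} \<Longrightarrow> V n K = 0"
begin

definition tuple :: "'b list \<Rightarrow> nat \<Rightarrow> 'b" where
  "tuple xs = (\<lambda>i\<in>{..<length xs}. xs ! i)"

lemma tuple_space: "length xs = n \<Longrightarrow> tuple xs \<in> space (PiM {..<n} (\<lambda>_. borel))"
  by (auto simp: tuple_def space_PiM)

text \<open>
  The potentials of all orders as one function of multisets, which is possible by symmetry. Single
  points have no potential.
\<close>

definition mset_potential :: "'b multiset \<Rightarrow> ereal" where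
  "mset_potential S = (if size S < 2 then 0 else V (size S) (tuple (SOME xs. mset xs = S)))"

lemma V_tuple_cong:
  assumes "mset xs = mset ys" "2 \<le> length xs"
  shows "V (length xs) (tuple xs) = V (length ys) (tuple ys)"
proof -
  obtain p where p: "p permutes {..<length ys}" "permute_list p ys = xs"
    using mset_eq_permutation[OF assms(1)] .
  have len: "length xs = length ys" using p(2) by auto
  have "tuple ys \<circ> p = tuple xs"
  proof
    fix i
    show "(tuple ys \<circ> p) i = tuple xs i"
      using p permutes_in_image[OF p(1), of i] permutes_not_in[OF p(1), of i]
      by (auto simp: tuple_def len permute_list_nth)
  qed
  moreover have "V (length ys) (tuple ys \<circ> p) = V (length ys) (tuple ys)"
    using assms len p by (intro V_symmetric tuple_space) auto
  ultimately show ?thesis using len by simp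
qed

lemma mset_potential_mset: "2 \<le> length xs \<Longrightarrow> mset_potential (mset xs) = V (length xs) (tuple xs)"
proof -
  assume l: "2 \<le> length xs"
  have e: "mset (SOME ys. mset ys = mset xs) = mset xs" by (rule someI) simp
  have "length (SOME ys. mset ys = mset xs) = length xs" using arg_cong[OF e, of size] by simp
  then show ?thesis using V_tuple_cong[OF e[symmetric] l] l by (simp add: mset_potential_def)
qed

lemma mset_potential_not_MInf: "mset_potential S \<noteq> -\<infinity>"
proof (cases "size S < 2")
  case False
  obtain xs where xs: "mset xs = S" using ex_mset by blast
  then have "2 \<le> length xs" using False by auto
  then show ?thesis unfolding xs[symmetric] using V_not_MInf[of "length xs" "tuple xs"] by (simp add: mset_potential_mset tuple_space)
qed (simp add: mset_potential_def)

lemma mset_potential_far: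
  assumes "x \<in># S" "y \<in># S" "dist x y > R"
  shows "mset_potential S = 0"
proof -
  obtain xs where xs: "mset xs = S" using ex_mset by blast
  obtain i j where i: "i < length xs" "xs ! i = x" and j: "j < length xs" "xs ! j = y"
    using assms xs by (metis in_set_conv_nth set_mset_mset)
  have "x \<noteq> y" using assms(3) R_pos by auto
  then have ne: "i \<noteq> j" using i j by auto
  then have l: "2 \<le> length xs" using i j by linarith
  define a b where "a = min i j" and "b = max i j"
  have ab: "a < b" "b < length xs" "dist (xs ! a) (xs ! b) = dist x y"
    using i j ne by (auto simp: a_def b_def min_def max_def dist_commute)
  let ?S = "{dist (tuple xs i) (tuple xs j) |i j. i < j \<and> j < length xs}"
  have "?S \<subseteq> (\<lambda>(i, j). dist (tuple xs i) (tuple xs j)) ` ({..<length xs} \<times> {..<length xs})"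
    by force
  then have fin: "finite ?S" by (rule finite_subset) auto
  have "dist (tuple xs a) (tuple xs b) \<in> ?S" using ab by blast
  then have "dist (tuple xs a) (tuple xs b) \<le> Max ?S" by (rule Max_ge[OF fin])
  moreover have "dist (tuple xs a) (tuple xs b) = dist x y" using ab by (simp add: tuple_def)
  ultimately have "R < Max ?S" using assms(3) by linarith
  then show ?thesis
    unfolding xs[symmetric] mset_potential_mset[OF l] using l by (intro V_range tuple_space) auto
qed

text \<open>
  The sum of the potential over all clusters that consist of \<open>T\<close> and some of the points in \<open>S\<close>.
  A fold avoids numbering the points of \<open>S\<close>; its steps commute because both orders of two points
  produce the same four clusters.
\<close>

definition cluster_energy :: "'b multiset \<Rightarrow> 'b multiset \<Rightarrow> ereal" where
  "cluster_energy S = fold_mset (\<lambda>y h T. h T + h (add_mset y T)) mset_potential S"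

lemma cluster_energy_empty[simp]: "cluster_energy {#} = mset_potential" by (simp add: cluster_energy_def)

lemma cluster_energy_add: "cluster_energy (add_mset y S) T = cluster_energy S T + cluster_energy S (add_mset y T)"
proof -
  let ?f = "\<lambda>y (h :: 'b multiset \<Rightarrow> ereal) T. h T + h (add_mset y T)"
  interpret comp_fun_commute ?f
    by standard (auto simp: fun_eq_iff add_mset_commute add_ac)
  show ?thesis by (simp add: cluster_energy_def)
qed

lemma cluster_energy_not_MInf: "cluster_energy S T \<noteq> -\<infinity>"
  by (induction S arbitrary: T) (auto simp: mset_potential_not_MInf cluster_energy_add)

lemma cluster_energy_far:
  assumes "x \<in># T" "y \<in># T" "dist x y > R" shows "cluster_energy S T = 0"
  using assms by (induction S arbitrary: T) (auto simp: mset_potential_far cluster_energy_add)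

definition energy :: "'b \<Rightarrow> 'b multiset \<Rightarrow> ereal" where
  "energy x S = cluster_energy S {#x#}"

lemma energy_add: "energy x (add_mset y S) = energy x S + cluster_energy S {#x, y#}"
  by (simp add: energy_def cluster_energy_add add_mset_commute)

lemma energy_not_MInf: "energy x S \<noteq> -\<infinity>" by (simp add: energy_def cluster_energy_not_MInf)

lemma energy_far: "dist x y > R \<Longrightarrow> energy x (add_mset y S) = energy x S"
  by (simp add: energy_add cluster_energy_far[of x _ y])

text \<open>
  Every cluster that contains \<open>x\<close> and a point further than \<open>R\<close> from it has potential zero.
\<close>

lemma energy_filter: "energy x (filter_mset (\<lambda>y. dist x y \<le> R) S) = energy x S"
proof -
  have *: "energy x (T + U) = energy x T" if "\<And>y. y \<in># U \<Longrightarrow> \<not> dist x y \<le> R" for T U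
    using that
  proof (induction U)
    case (add y U)
    have "dist x y > R" using add.prems[of y] by simp
    then show ?case using add by (simp add: energy_far)
  qed simp
  have "S = filter_mset (\<lambda>y. dist x y \<le> R) S + filter_mset (\<lambda>y. \<not> dist x y \<le> R) S"
    by (rule multiset_partition)
  then show ?thesis using *[of "filter_mset (\<lambda>y. \<not> dist x y \<le> R) S" "filter_mset (\<lambda>y. dist x y \<le> R) S"]
    by simp
qed

text \<open>
  The Papangelou intensity as a function of a finite configuration.
\<close>

definition activity :: "'b \<Rightarrow> 'b multiset \<Rightarrow> ennreal" where
  "activity x S = ereal_exp (- energy x S)"

text \<open>
  Both sides contain the energies of \<open>x\<close> and of \<open>y\<close> with respect to \<open>S\<close> and the energy of all
  clusters that contain \<open>x\<close>, \<open>y\<close> and points of \<open>S\<close>.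
\<close>

lemma activity_cocycle: "activity x S * activity y (add_mset x S) = activity y S * activity x (add_mset y S)"
  unfolding activity_def energy_add
  by (simp add: ereal_exp_minus_add energy_not_MInf cluster_energy_not_MInf add_mset_commute mult_ac)

text \<open>
  Each point is either left out of the cluster or joins it; this is one step of the recursion.
\<close>

lemma cluster_energy_subsets:
  assumes "finite I"
  shows "cluster_energy (image_mset X (mset_set I)) T = (\<Sum>J\<in>Pow I. mset_potential (T + image_mset X (mset_set J)))"
  using assms
proof (induction I arbitrary: T)
  case (insert a I)
  have "(\<Sum>J\<in>Pow (insert a I). mset_potential (T + image_mset X (mset_set J))) =
    (\<Sum>J\<in>Pow I. mset_potential (T + image_mset X (mset_set J))) + (\<Sum>J\<in>insert a ` Pow I. mset_potential (T + image_mset X (mset_set J)))"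
    unfolding Pow_insert using insert by (intro sum.union_disjoint) auto
  also have "(\<Sum>J\<in>insert a ` Pow I. mset_potential (T + image_mset X (mset_set J))) =
    (\<Sum>J\<in>Pow I. mset_potential (T + image_mset X (mset_set (insert a J))))"
  proof -
    have "inj_on (insert a) (Pow I)"
      using insert.hyps(2) by (intro inj_onI) (metis Pow_iff insert_ident subsetD)
    then show ?thesis by (simp add: sum.reindex)
  qed
  also have "\<dots> = (\<Sum>J\<in>Pow I. mset_potential (add_mset (X a) T + image_mset X (mset_set J)))"
  proof (rule sum.cong[OF refl])
    fix J assume "J \<in> Pow I"
    then have "finite J" "a \<notin> J" using insert finite_subset by auto
    then show "mset_potential (T + image_mset X (mset_set (insert a J))) = mset_potential (add_mset (X a) T + image_mset X (mset_set J))"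
      by simp
  qed
  finally show ?case using insert by (simp add: cluster_energy_add)
qed simp

end

lemma enumerates_emeasure:
  assumes "enumerates k K \<mu>" "B \<in> sets borel"
  shows "emeasure \<mu> B = emeasure (count_space {j. enat j < k}) {j. enat j < k \<and> K j \<in> B}"
proof -
  have "emeasure \<mu> B = emeasure (count_space {j. enat j < k}) (K -` B \<inter> {j. enat j < k})"
    using assms unfolding enumerates_def by (simp add: emeasure_distr)
  also have "K -` B \<inter> {j. enat j < k} = {j. enat j < k \<and> K j \<in> B}" by auto
  finally show ?thesis .
qed

text \<open>
  Unfolds the choice of an enumeration in the definition of the factorial measure.
\<close>

lemma factorial_measure_enumerated:
  fixes \<mu> :: "'b::metric_space measure"
  assumes "\<exists>k K. enumerates k K \<mu>"
  obtains k K where "enumerates k K \<mu>"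
    "\<And>m. factorial_measure m \<mu> = distr (count_space {t \<in> {..<m} \<rightarrow>\<^sub>E {j. enat j < k}. inj_on t {..<m}})
          (PiM {..<m} (\<lambda>_. borel)) (\<lambda>t. \<lambda>i\<in>{..<m}. K (t i))"
proof -
  obtain k K where kK: "(SOME (k, K). enumerates k K \<mu>) = (k, K)" by (cases "SOME (k, K). enumerates k K \<mu>")
  have "\<exists>z. (\<lambda>(k, K). enumerates k K \<mu>) z" using assms by auto
  then have "(\<lambda>(k, K). enumerates k K \<mu>) (SOME (k, K). enumerates k K \<mu>)" by (rule someI_ex)
  then have "enumerates k K \<mu>" unfolding kK by simp
  moreover have "factorial_measure m \<mu> = distr (count_space {t \<in> {..<m} \<rightarrow>\<^sub>E {j. enat j < k}. inj_on t {..<m}})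
          (PiM {..<m} (\<lambda>_. borel)) (\<lambda>t. \<lambda>i\<in>{..<m}. K (t i))" for m
    unfolding factorial_measure_def kK by simp
  ultimately show thesis by (rule that)
qed

context potential begin

lemma mset_potential_small: "size S < 2 \<Longrightarrow> mset_potential S = 0" by (simp add: mset_potential_def)

lemma V_cons:
  assumes "1 \<le> m"
  shows "V (m + 1) (case_nat x (\<lambda>i\<in>{..<m}. y i)) = mset_potential (add_mset x (image_mset y (mset_set {..<m})))"
proof -
  let ?xs = "x # map y [0..<m]"
  have "tuple ?xs = case_nat x (\<lambda>i\<in>{..<m}. y i)"
    by (auto simp: fun_eq_iff tuple_def split: nat.split)
  moreover have "mset_potential (mset ?xs) = V (length ?xs) (tuple ?xs)" using assms by (intro mset_potential_mset) simp
  moreover have "mset ?xs = add_mset x (image_mset y (mset_set {..<m}))"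
    by (simp add: atLeast0LessThan)
  ultimately show ?thesis by simp
qed

text \<open>
  Tuples with an entry further than \<open>R\<close> from \<open>x\<close> contribute zero, so the integral over the factorial
  measure is a sum over the injective tuples of nearby indices.
\<close>

lemma interaction_eq:
  fixes \<mu> :: "'b measure"
  assumes fm: "factorial_measure m \<mu> = distr (count_space {t \<in> {..<m} \<rightarrow>\<^sub>E I. inj_on t {..<m}})
          (PiM {..<m} (\<lambda>_. borel)) (\<lambda>t. \<lambda>i\<in>{..<m}. X (t i))"
    and m: "1 \<le> m" and fin: "finite {j \<in> I. dist x (X j) \<le> R}"
  shows "interaction V (m + 1) x \<mu> = (\<Sum>J\<in>{J. J \<subseteq> {j \<in> I. dist x (X j) \<le> R} \<and> card J = m}.
     mset_potential (add_mset x (image_mset X (mset_set J))) * ereal (fact m))"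
proof -
  let ?I = "{j \<in> I. dist x (X j) \<le> R}"
  let ?T = "\<lambda>I. {t \<in> {..<m} \<rightarrow>\<^sub>E I. inj_on t {..<m}}"
  let ?\<phi> = "\<lambda>J. mset_potential (add_mset x (image_mset X (mset_set J)))"
  let ?U = "\<lambda>t. \<lambda>i\<in>{..<m}. X (t i)"
  have fT: "finite (?T ?I)" using fin by (intro finite_subset[of "?T ?I" "{..<m} \<rightarrow>\<^sub>E ?I"] finite_PiE) auto
  have VT: "V (m + 1) (case_nat x (?U t)) = ?\<phi> (t ` {..<m})" if "t \<in> ?T I" for t
  proof -
    have "image_mset t (mset_set {..<m}) = mset_set (t ` {..<m})"
      using that by (intro image_mset_mset_set) auto
    then have "image_mset (\<lambda>i. X (t i)) (mset_set {..<m}) = image_mset X (mset_set (t ` {..<m}))"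
      by (simp add: multiset.map_comp[symmetric, unfolded comp_def] image_mset.compositionality[symmetric])
    then show ?thesis using V_cons[OF m, of x "\<lambda>i. X (t i)"] by simp
  qed
  have zero: "?\<phi> (t ` {..<m}) = 0" if t: "t \<in> ?T I" "t \<notin> ?T ?I" for t
  proof -
    obtain i where i: "i < m" "dist x (X (t i)) > R"
      using t by (auto simp: PiE_iff not_le)
    then show ?thesis by (intro mset_potential_far[of x _ "X (t i)"]) auto
  qed
  have meas: "(\<lambda>L. V (m + 1) (case_nat x L)) \<in> borel_measurable (PiM {..<m} (\<lambda>_. borel))"
  proof (rule measurable_compose[OF _ V_measurable])
    show "(\<lambda>L. case_nat x L) \<in> measurable (PiM {..<m} (\<lambda>_. borel)) (PiM {..<m + 1} (\<lambda>_. borel))"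
    proof (rule measurable_PiM_single')
      fix i assume "i \<in> {..<m + 1}"
      then show "(\<lambda>L. case_nat x L i) \<in> measurable (PiM {..<m} (\<lambda>_. borel)) borel"
        by (cases i) auto
    next
      show "case_nat x \<in> space (PiM {..<m} (\<lambda>_. borel)) \<rightarrow> (\<Pi>\<^sub>E i\<in>{..<m + 1}. space borel)"
        by (auto simp: space_PiM PiE_iff extensional_def split: nat.split)
    qed
  qed (use m in simp)
  have int: "(\<integral>\<^sup>+L. e2ennreal (s * V (m + 1) (case_nat x L)) \<partial>factorial_measure m \<mu>)
    = (\<Sum>t\<in>?T ?I. e2ennreal (s * ?\<phi> (t ` {..<m})))" for s :: ereal
  proof -
    have [measurable]: "?U \<in> measurable (count_space (?T I)) (PiM {..<m} (\<lambda>_. borel))"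
      by (auto simp: space_PiM)
    have [measurable]: "(\<lambda>L. e2ennreal (s * V (m + 1) (case_nat x L))) \<in> borel_measurable (PiM {..<m} (\<lambda>_. borel))"
      using meas by measurable
    have "(\<integral>\<^sup>+L. e2ennreal (s * V (m + 1) (case_nat x L)) \<partial>factorial_measure m \<mu>)
      = (\<integral>\<^sup>+t. e2ennreal (s * V (m + 1) (case_nat x (?U t))) \<partial>count_space (?T I))"
      unfolding fm by (rule nn_integral_distr) measurable
    also have "\<dots> = (\<integral>\<^sup>+t. e2ennreal (s * ?\<phi> (t ` {..<m})) \<partial>count_space (?T I))"
      by (intro nn_integral_cong) (simp only: space_count_space VT)
    also have "\<dots> = (\<Sum>t\<in>?T ?I. e2ennreal (s * ?\<phi> (t ` {..<m})))"
    proof (rule nn_integral_count_space'[OF fT])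
      show "?T ?I \<subseteq> ?T I" by (auto simp: PiE_iff)
      show "e2ennreal (s * ?\<phi> (t ` {..<m})) = 0" if "t \<in> ?T I" "t \<notin> ?T ?I" for t
        using zero[OF that] by (simp add: e2ennreal_neg)
    qed
    finally show ?thesis .
  qed
  have "interaction V (m + 1) x \<mu> = enn2ereal (\<Sum>t\<in>?T ?I. e2ennreal (?\<phi> (t ` {..<m})))
     - enn2ereal (\<Sum>t\<in>?T ?I. e2ennreal (- ?\<phi> (t ` {..<m})))"
    using int[of 1] int[of "-1"] by (simp add: interaction_def ereal_integral_def)
  also have "\<dots> = (\<Sum>t\<in>?T ?I. ?\<phi> (t ` {..<m}))"
    by (rule sum_ereal_parts[OF fT]) (rule mset_potential_not_MInf)
  also have "\<dots> = (\<Sum>J\<in>{J. J \<subseteq> ?I \<and> card J = m}. ?\<phi> J * ereal (fact m))"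
    by (rule sum_injections[OF fin])
  finally show ?thesis .
qed

text \<open>
  The enumeration that enters the factorial measures is arbitrary, but the multiset of its points near
  \<open>x\<close> is determined by the masses of singletons. On this finite multiset the series over the orders
  of the potentials is a finite sum over all nonempty sets of nearby points.
\<close>

lemma papangelou_eq_activity:
  assumes en: "\<exists>k K. enumerates k K \<mu>"
    and S: "\<And>y. dist x y \<le> R \<Longrightarrow> emeasure \<mu> {y} = of_nat (count S y)"
    and fin: "emeasure \<mu> (cball x R) \<noteq> \<infinity>"
  shows "papangelou V x \<mu> = activity x S"
proof -
  obtain k K where kK: "enumerates k K \<mu>"
    and fm: "\<And>m. factorial_measure m \<mu> = distr (count_space {t \<in> {..<m} \<rightarrow>\<^sub>E {j. enat j < k}. inj_on t {..<m}})
          (PiM {..<m} (\<lambda>_. borel)) (\<lambda>t. \<lambda>i\<in>{..<m}. K (t i))"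
    by (rule factorial_measure_enumerated[OF en]) (rule that; assumption)
  let ?I = "{j \<in> {j. enat j < k}. dist x (K j) \<le> R}"
  let ?\<phi> = "\<lambda>J. mset_potential (add_mset x (image_mset K (mset_set J)))"
  have finI: "finite ?I"
  proof (rule ccontr)
    assume inf: "infinite ?I"
    have "{j. enat j < k \<and> K j \<in> cball x R} = ?I" by auto
    then have "emeasure \<mu> (cball x R) = emeasure (count_space {j. enat j < k}) ?I"
      using enumerates_emeasure[OF kK, of "cball x R"] by simp
    also have "\<dots> = \<infinity>" using inf by (subst emeasure_count_space_infinite) auto
    finally show False using fin by simp
  qed
  have "image_mset K (mset_set ?I) = filter_mset (\<lambda>y. dist x y \<le> R) S"
  proof (rule multiset_eqI)
    fix y
    show "count (image_mset K (mset_set ?I)) y = count (filter_mset (\<lambda>y. dist x y \<le> R) S) y"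
    proof (cases "dist x y \<le> R")
      case True
      have e: "{j. enat j < k \<and> K j \<in> {y}} = {j \<in> ?I. K j = y}" using True by auto
      have "of_nat (count S y) = emeasure (count_space {j. enat j < k}) {j \<in> ?I. K j = y}"
        using S[OF True] enumerates_emeasure[OF kK, of "{y}"] unfolding e by simp
      also have "\<dots> = of_nat (card {j \<in> ?I. K j = y})"
        using finI by (subst emeasure_count_space_finite) (auto intro: finite_subset[OF _ finI])
      finally have "count S y = card {j \<in> ?I. K j = y}" by simp
      moreover have "count (image_mset K (mset_set ?I)) y = card {j \<in> ?I. K j = y}"
        using finI by (simp add: count_image_mset' conj_commute) (rule arg_cong[where f=card], auto)
      ultimately show ?thesis using True by simp
    next
      case False
      then show ?thesis using finI by (auto simp: not_in_iff[symmetric])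
    qed
  qed
  then have energy: "(\<Sum>J\<in>Pow ?I. ?\<phi> J) = energy x S"
    using cluster_energy_subsets[OF finI, of K "{#x#}"] energy_filter[of x S] by (simp add: energy_def)
  have term_eq: "ereal (1 / fact (n + 1)) * interaction V (n + 2) x \<mu> = (\<Sum>J\<in>{J. J \<subseteq> ?I \<and> card J = n + 1}. ?\<phi> J)" for n
  proof -
    have "interaction V (n + 2) x \<mu> = (\<Sum>J\<in>{J. J \<subseteq> ?I \<and> card J = n + 1}. ?\<phi> J * ereal (fact (n + 1)))"
      using interaction_eq[OF fm _ finI, of "n + 1"] by (simp only: add.assoc) simp
    then have "ereal (1 / fact (n + 1)) * interaction V (n + 2) x \<mu> =
      (\<Sum>J\<in>{J. J \<subseteq> ?I \<and> card J = n + 1}. ereal (1 / fact (n + 1)) * (?\<phi> J * ereal (fact (n + 1))))"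
    proof (simp only:, intro ereal_mult_sum)
      have ne: "a * ereal c \<noteq> -\<infinity>" if "a \<noteq> -\<infinity>" "c > 0" for a c using that by (cases a) auto
      show "?\<phi> J * ereal (fact (n + 1)) \<noteq> -\<infinity>" for J
        by (rule ne[OF mset_potential_not_MInf fact_gt_zero])
    qed simp
    also have "\<dots> = (\<Sum>J\<in>{J. J \<subseteq> ?I \<and> card J = n + 1}. ?\<phi> J)"
    proof (rule sum.cong[OF refl])
      fix J
      show "ereal (1 / fact (n + 1)) * (?\<phi> J * ereal (fact (n + 1))) = ?\<phi> J"
        by (cases "?\<phi> J") (auto simp del: fact_Suc)
    qed
    finally show ?thesis .
  qed
  have "(\<Sum>n. ereal (1 / fact (n + 1)) * interaction V (n + 2) x \<mu>) = (\<Sum>n<card ?I. \<Sum>J\<in>{J. J \<subseteq> ?I \<and> card J = n + 1}. ?\<phi> J)"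
    unfolding term_eq
  proof (rule suminf_finite)
    fix n assume n: "n \<notin> {..<card ?I}"
    have "card J \<noteq> n + 1" if "J \<subseteq> ?I" for J
      using card_mono[OF finI that] n by simp
    then have "{J. J \<subseteq> ?I \<and> card J = n + 1} = {}" by blast
    then show "(\<Sum>J\<in>{J. J \<subseteq> ?I \<and> card J = n + 1}. ?\<phi> J) = 0" by (simp only: sum.empty)
  qed simp
  also have "\<dots> = (\<Sum>J\<in>Pow ?I - {{}}. ?\<phi> J)"
  proof -
    have "(\<Sum>J\<in>Pow ?I - {{}}. ?\<phi> J) = (\<Sum>n<card ?I. \<Sum>J\<in>{J \<in> Pow ?I - {{}}. card J - 1 = n}. ?\<phi> J)"
    proof (rule sum.group[symmetric])
      show "finite (Pow ?I - {{}})" using finI by simp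
      show "(\<lambda>J. card J - 1) ` (Pow ?I - {{}}) \<subseteq> {..<card ?I}"
      proof (rule image_subsetI)
        fix J assume J: "J \<in> Pow ?I - {{}}"
        then have "J \<subseteq> ?I" by blast
        moreover have "J \<noteq> {}" using J by blast
        ultimately have "0 < card J" "card J \<le> card ?I"
          using finite_subset[OF _ finI] card_mono[OF finI] by (simp_all only: card_gt_0_iff simp_thms)
        then have "card J - 1 < card ?I" by linarith
        then show "card J - 1 \<in> {..<card ?I}" by (simp only: lessThan_iff)
      qed
    qed simp
    also have "\<dots> = (\<Sum>n<card ?I. \<Sum>J\<in>{J. J \<subseteq> ?I \<and> card J = n + 1}. ?\<phi> J)"
    proof (intro sum.cong refl set_eqI)
      fix n J
      have "card J > 0" if "J \<subseteq> ?I" "J \<noteq> {}"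
        using that finite_subset[OF that(1) finI] by (simp add: card_gt_0_iff)
      then show "J \<in> {J \<in> Pow ?I - {{}}. card J - 1 = n} \<longleftrightarrow> J \<in> {J. J \<subseteq> ?I \<and> card J = n + 1}"
        by (cases "J = {}") auto
    qed
    finally show ?thesis ..
  qed
  also have "\<dots> = (\<Sum>J\<in>Pow ?I. ?\<phi> J)"
  proof -
    have "?\<phi> {} = 0" by (simp add: mset_potential_small)
    moreover have "(\<Sum>J\<in>Pow ?I. ?\<phi> J) = ?\<phi> {} + (\<Sum>J\<in>Pow ?I - {{}}. ?\<phi> J)"
      using finI by (intro sum.remove) auto
    ultimately show ?thesis by (simp only: add_0)
  qed
  finally show ?thesis unfolding papangelou_def activity_def energy by simp
qed

lemma measurable_activity:
  "(\<lambda>(x, ys). activity x (mset (map ys [0..<l]))) \<in> borel_measurable (borel \<Otimes>\<^sub>M PiM UNIV (\<lambda>_::nat. borel))"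
proof -
  let ?B = "borel \<Otimes>\<^sub>M PiM UNIV (\<lambda>_::nat. borel) :: ('b \<times> (nat \<Rightarrow> 'b)) measure"
  have term_meas: "(\<lambda>z. mset_potential (add_mset (fst z) (image_mset (snd z) (mset_set J)))) \<in> borel_measurable ?B" if J: "finite J" for J :: "nat set"
  proof (cases "J = {}")
    case True then show ?thesis by (simp add: mset_potential_small)
  next
    case False
    let ?js = "sorted_list_of_set J"
    let ?xs = "\<lambda>z :: 'b \<times> (nat \<Rightarrow> 'b). fst z # map (snd z) ?js"
    have l: "2 \<le> Suc (card J)" using J False by (cases "card J") auto
    have "mset_set J = mset ?js" using J mset_set_set[of ?js] by simp
    then have "add_mset (fst z) (image_mset (snd z) (mset_set J)) = mset (?xs z)" for z
      by simp
    moreover have "mset_potential (mset (?xs z)) = V (Suc (card J)) (tuple (?xs z))" for z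
      using l by (subst mset_potential_mset) auto
    moreover have "(\<lambda>z. tuple (?xs z)) \<in> measurable ?B (PiM {..<Suc (card J)} (\<lambda>_. borel))"
    proof (rule measurable_PiM_single')
      fix i assume i: "i \<in> {..<Suc (card J)}"
      show "(\<lambda>z. tuple (?xs z) i) \<in> measurable ?B borel"
        using i by (cases i) (auto simp: tuple_def)
    next
      show "(\<lambda>z. tuple (?xs z)) \<in> space ?B \<rightarrow> (\<Pi>\<^sub>E i\<in>{..<Suc (card J)}. space borel)"
        by (auto simp: tuple_def PiE_iff extensional_def)
    qed
    then have "(\<lambda>z. V (Suc (card J)) (tuple (?xs z))) \<in> borel_measurable ?B"
      by (rule measurable_compose[OF _ V_measurable[OF l]])
    ultimately show ?thesis by simp
  qed
  have "(\<lambda>z. \<Sum>J\<in>Pow {..<l}. mset_potential (add_mset (fst z) (image_mset (snd z) (mset_set J)))) \<in> borel_measurable ?B"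
    by (intro borel_measurable_ereal_sum term_meas) (auto intro: finite_subset)
  moreover have "energy x (mset (map ys [0..<l])) = (\<Sum>J\<in>Pow {..<l}. mset_potential (add_mset x (image_mset ys (mset_set J))))" for x ys
    using cluster_energy_subsets[of "{..<l}" ys "{#x#}"] by (simp add: energy_def atLeast0LessThan)
  ultimately have [measurable]: "(\<lambda>z. energy (fst z) (mset (map (snd z) [0..<l]))) \<in> borel_measurable ?B" by simp
  have "(\<lambda>z. ereal_exp (- energy (fst z) (mset (map (snd z) [0..<l])))) \<in> borel_measurable ?B" by measurable
  then show ?thesis by (simp add: activity_def case_prod_beta')
qed

end

section \<open>Existence of the Gibbs process\<close>

context potential begin

lemma finite_sum_diracs_counting:
  "distr (count_space {j. enat j < enat (length xs)}) borel ((!) xs) \<in> counting_measures" (is "?\<mu> \<in> _")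
  "emeasure (distr (count_space {j. enat j < enat (length xs)}) borel ((!) xs)) B \<noteq> \<infinity>"
  "emeasure (distr (count_space {j. enat j < enat (length xs)}) borel ((!) xs)) {y} = of_nat (count (mset xs) y)"
  for xs :: "'b list"
proof -
  let ?I = "{j. enat j < enat (length xs)}"
  let ?\<mu> = "distr (count_space ?I) borel ((!) xs)"
  have fin: "finite ?I" by simp
  have em: "emeasure ?\<mu> B = of_nat (card {j \<in> ?I. xs ! j \<in> B})" if "B \<in> sets borel" for B
  proof -
    have "emeasure ?\<mu> B = emeasure (count_space ?I) ((!) xs -` B \<inter> ?I)" using that by (simp add: emeasure_distr)
    also have "(!) xs -` B \<inter> ?I = {j \<in> ?I. xs ! j \<in> B}" by auto
    also have "emeasure (count_space ?I) \<dots> = of_nat (card \<dots>)" by (subst emeasure_count_space_finite) auto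
    finally show ?thesis .
  qed
  show "?\<mu> \<in> counting_measures" unfolding counting_measures_def
    by (intro CollectI conjI ballI impI) (simp, simp only: em of_nat_in_Nats)
  show "emeasure ?\<mu> B \<noteq> \<infinity>" using em[of B] by (cases "B \<in> sets borel") (auto simp: emeasure_notin_sets)
  have "count (mset xs) y = card {j \<in> ?I. xs ! j \<in> {y}}"
    by (simp add: count_mset count_list_eq_length_filter length_filter_conv_card eq_commute)
  then show "emeasure ?\<mu> {y} = of_nat (count (mset xs) y)" using em[of "{y}"] by simp
qed

text \<open>
  Every finite configuration is realized by a counting measure; this transfers the bound in local
  stability to finite configurations.
\<close>

lemma papangelou_mset: "\<exists>\<mu>\<in>counting_measures. papangelou V x \<mu> = activity x S"
proof -
  obtain xs where xs: "mset xs = S" using ex_mset by blast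
  let ?\<mu> = "distr (count_space {j. enat j < enat (length xs)}) borel ((!) xs)"
  have "enumerates (enat (length xs)) ((!) xs) ?\<mu>" by (simp add: enumerates_def)
  then have "papangelou V x ?\<mu> = activity x S"
    using finite_sum_diracs_counting(2,3)[of xs] xs by (intro papangelou_eq_activity) blast+
  then show ?thesis using finite_sum_diracs_counting(1)[of xs] by blast
qed

theorem gibbs_process_exists:
  assumes sets_\<Lambda>: "sets \<Lambda> = sets borel" and stable: "locally_stable (papangelou V) \<Lambda>"
  shows "\<exists>(P :: 'b measure measure) \<eta>. gibbs_process P \<eta> (papangelou V) \<Lambda>"
proof -
  obtain \<theta> :: "'b \<Rightarrow> real" where \<theta>_nonneg: "\<And>x. 0 \<le> \<theta> x" and \<theta>_int: "locally_integrable \<Lambda> \<theta>"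
    and bound: "AE x in \<Lambda>. (SUP \<mu>\<in>counting_measures. papangelou V x \<mu>) \<le> ennreal (\<theta> x)"
    using stable unfolding locally_stable_def by blast
  have act_le: "activity x S \<le> ennreal (\<theta> x)"
    if "(SUP \<mu>\<in>counting_measures. papangelou V x \<mu>) \<le> ennreal (\<theta> x)" for x S
    using that papangelou_mset[of x S] by (metis SUP_upper order_trans)
  obtain N where N: "N \<in> null_sets \<Lambda>"
    and bound_N: "{x \<in> space \<Lambda>. \<not> (SUP \<mu>\<in>counting_measures. papangelou V x \<mu>) \<le> ennreal (\<theta> x)} \<subseteq> N"
    using bound unfolding eventually_ae_filter by blast
  have space_\<Lambda>: "space \<Lambda> = UNIV" using sets_eq_imp_space_eq[OF sets_\<Lambda>] by simp
  have good: "activity x S \<le> ennreal (\<theta> x)" if "x \<notin> N" for x S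
    using that bound_N by (intro act_le) (auto simp: space_\<Lambda>)
  have N_borel[measurable]: "N \<in> sets borel" using N sets_\<Lambda> by auto
  \<comment> \<open>The shells are taken around an arbitrary centre.\<close>
  define o0 :: 'b where "o0 = undefined"
  define D where "D k = {y. real k \<le> dist o0 y \<and> dist o0 y < real k + 1}" for k :: nat
  have D_ball: "(\<Union>j<m. D j) = {y. dist o0 y < real m}" for m
  proof (intro set_eqI iffI)
    fix y assume "y \<in> (\<Union>j<m. D j)"
    then obtain j where "j < m" "dist o0 y < real j + 1" by (auto simp: D_def)
    then show "y \<in> {y. dist o0 y < real m}" by auto
  next
    fix y assume y: "y \<in> {y. dist o0 y < real m}"
    define j where "j = nat \<lfloor>dist o0 y\<rfloor>"
    have "real j \<le> dist o0 y" "dist o0 y < real j + 1" by (auto simp: j_def)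
    moreover from this y have "j < m" by auto
    ultimately show "y \<in> (\<Union>j<m. D j)" by (auto simp: D_def)
  qed
  have D_borel: "D k \<in> sets borel" for k
  proof -
    have "D k = ball o0 (real k + 1) - ball o0 (real k)" by (auto simp: D_def)
    then show ?thesis by simp
  qed
  have D_bdd: "bounded (D k)" for k
    unfolding bounded_def D_def by (intro exI[of _ o0] exI[of _ "real k + 1"]) auto
  have disj: "disjoint_family D"
    unfolding disjoint_family_on_def
  proof (intro ballI impI)
    fix i j :: nat assume "i \<noteq> j"
    then show "D i \<inter> D j = {}" by (cases i j rule: linorder_cases) (auto simp: D_def)
  qed
  have cover: "(\<Union>k. D k) = UNIV"
  proof (intro set_eqI iffI UNIV_I)
    fix y
    obtain m :: nat where "dist o0 y < real m" using reals_Archimedean2 by blast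
    then have "y \<in> (\<Union>j<m. D j)" unfolding D_ball by simp
    then show "y \<in> (\<Union>k. D k)" by auto
  qed
  have \<theta>_D: "(\<lambda>x. indicator (D k) x * \<theta> x) \<in> borel_measurable borel" "integrable \<Lambda> (\<lambda>x. indicator (D k) x * \<theta> x)" for k
  proof -
    show i: "integrable \<Lambda> (\<lambda>x. indicator (D k) x * \<theta> x)"
      using \<theta>_int D_borel[of k] D_bdd[of k] by (auto simp: locally_integrable_def set_integrable_def)
    then show "(\<lambda>x. indicator (D k) x * \<theta> x) \<in> borel_measurable borel"
      using measurable_cong_sets[OF sets_\<Lambda> refl] by blast
  qed
  have \<theta>_sum: "ennreal (\<theta> x) = (\<Sum>k. ennreal (indicator (D k) x * \<theta> x))" for x
  proof -
    obtain k where k: "x \<in> D k" using cover by blast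
    have "(\<Sum>j. ennreal (indicator (D j) x * \<theta> x)) = (\<Sum>j\<in>{k}. ennreal (indicator (D j) x * \<theta> x))"
    proof (rule suminf_finite)
      fix j assume "j \<notin> {k}"
      then have "D j \<inter> D k = {}" using disj by (simp add: disjoint_family_on_def)
      then have "x \<notin> D j" using k by blast
      then show "ennreal (indicator (D j) x * \<theta> x) = 0" by simp
    qed simp
    then show ?thesis using k by simp
  qed
  have \<theta>_borel[measurable]: "(\<lambda>x. ennreal (\<theta> x)) \<in> borel_measurable borel"
    unfolding \<theta>_sum by (intro borel_measurable_suminf_order measurable_compose[OF \<theta>_D(1) measurable_ennreal])
  define M where "M = density \<Lambda> (\<lambda>x. ennreal (\<theta> x))"
  have sets_M: "sets M = sets borel" by (simp add: M_def sets_\<Lambda>)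
  have M_fin: "emeasure M (D k) < \<infinity>" for k
  proof -
    have "emeasure M (D k) = (\<integral>\<^sup>+x. ennreal (\<theta> x) * indicator (D k) x \<partial>\<Lambda>)"
      unfolding M_def using D_borel
      by (subst emeasure_density) (simp_all add: sets_\<Lambda> measurable_cong_sets[OF sets_\<Lambda> refl])
    also have "\<dots> = (\<integral>\<^sup>+x. ennreal (indicator (D k) x * \<theta> x) \<partial>\<Lambda>)"
      by (intro nn_integral_cong) (auto split: split_indicator)
    also have "\<dots> = ennreal (\<integral>x. indicator (D k) x * \<theta> x \<partial>\<Lambda>)"
      by (rule nn_integral_eq_integral[OF \<theta>_D(2)]) (simp add: \<theta>_nonneg)
    finally show ?thesis by simp
  qed
  \<comment> \<open>Dividing by \<open>\<theta>\<close> makes the intensity at most 1 everywhere. The value 0, taken on the exceptional null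
    set and where \<open>\<theta>\<close> vanishes, keeps the cocycle identity intact.\<close>
  define a where "a x = (if x \<notin> N \<and> \<theta> x > 0 then 1 / ennreal (\<theta> x) else 0)" for x
  have a_borel[measurable]: "a \<in> borel_measurable borel"
  proof -
    have "(\<lambda>x. if x \<notin> N \<and> ennreal (\<theta> x) > 0 then 1 / ennreal (\<theta> x) else 0) \<in> borel_measurable borel" by measurable
    then show ?thesis unfolding a_def[abs_def] by simp
  qed
  define \<kappa> where "\<kappa> x S = a x * activity x S" for x S
  have \<kappa>_\<theta>: "\<kappa> x S * ennreal (\<theta> x) = activity x S" if "x \<notin> N" for x S
  proof (cases "\<theta> x > 0")
    case True
    have "1 / ennreal (\<theta> x) * activity x S * ennreal (\<theta> x) = activity x S * ennreal (\<theta> x) / ennreal (\<theta> x)"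
      by (simp add: divide_ennreal_def mult_ac)
    also have "\<dots> = activity x S" using True by (intro mult_divide_eq_ennreal) auto
    finally show ?thesis using True that by (simp add: \<kappa>_def a_def)
  next
    case False
    then have "\<theta> x = 0" using \<theta>_nonneg[of x] by linarith
    then show ?thesis using good[OF that, of S] by simp
  qed
  interpret gibbs_shells M D \<kappa>
  proof
    show "bounded B \<Longrightarrow> \<exists>m. B \<subseteq> (\<Union>k<m. D k)" for B
    proof -
      assume "bounded B"
      then obtain e where e: "\<And>y. y \<in> B \<Longrightarrow> dist o0 y \<le> e" using bounded_any_center[of B o0] by blast
      obtain m :: nat where "e < real m" using reals_Archimedean2 by blast
      then show ?thesis unfolding D_ball using e by (intro exI[of _ m]) (auto intro: le_less_trans)
    qed
    show "\<kappa> x S \<le> 1" for x S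
    proof (cases "x \<notin> N \<and> \<theta> x > 0")
      case True
      then have "\<kappa> x S \<le> 1 / ennreal (\<theta> x) * ennreal (\<theta> x)"
        unfolding \<kappa>_def a_def using good[of x S] by (auto intro!: mult_left_mono)
      also have "\<dots> = 1" using True mult_divide_eq_ennreal[of "ennreal (\<theta> x)" 1] by (simp add: divide_ennreal_def mult.commute)
      finally show ?thesis .
    next
      case False
      then have "a x = 0" unfolding a_def by (rule if_not_P)
      then show ?thesis by (simp add: \<kappa>_def)
    qed
    show "\<kappa> x S * \<kappa> y (add_mset x S) = \<kappa> y S * \<kappa> x (add_mset y S)" for x y S
    proof -
      have "\<kappa> x S * \<kappa> y (add_mset x S) = a x * a y * (activity x S * activity y (add_mset x S))"
        by (simp add: \<kappa>_def mult_ac)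
      also have "\<dots> = a x * a y * (activity y S * activity x (add_mset y S))"
        by (simp only: activity_cocycle)
      also have "\<dots> = \<kappa> y S * \<kappa> x (add_mset y S)" by (simp add: \<kappa>_def mult_ac)
      finally show ?thesis .
    qed
    show "\<exists>m. \<forall>x\<in>D k. \<forall>S y. y \<notin> (\<Union>j<m. D j) \<longrightarrow> \<kappa> x (add_mset y S) = \<kappa> x S" for k
    proof -
      obtain m :: nat where m: "real k + 1 + R < real m" using reals_Archimedean2 by blast
      have "\<kappa> x (add_mset y S) = \<kappa> x S" if "x \<in> D k" "y \<notin> (\<Union>j<m. D j)" for x S y
      proof -
        have "dist o0 y \<ge> real m" using that(2) unfolding D_ball by simp
        moreover have "dist o0 x < real k + 1" using that(1) by (simp add: D_def)
        moreover have "dist o0 y \<le> dist o0 x + dist x y" by (rule dist_triangle)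
        ultimately have "dist x y > R" using m by linarith
        then show ?thesis by (simp add: \<kappa>_def activity_def energy_far)
      qed
      then show ?thesis by blast
    qed
    show "(\<lambda>(x, ys). \<kappa> x (mset (map ys [0..<l]))) \<in> borel_measurable (borel \<Otimes>\<^sub>M PiM UNIV (\<lambda>_::nat. borel))" for l
    proof -
      have [measurable]: "(\<lambda>z. activity (fst z) (mset (map (snd z) [0..<l]))) \<in> borel_measurable (borel \<Otimes>\<^sub>M PiM UNIV (\<lambda>_::nat. borel))"
        using measurable_activity[of l] by (simp add: case_prod_beta')
      have "(\<lambda>z. a (fst z) * activity (fst z) (mset (map (snd z) [0..<l]))) \<in> borel_measurable (borel \<Otimes>\<^sub>M PiM UNIV (\<lambda>_::nat. borel))"
        by measurable
      then show ?thesis by (simp add: \<kappa>_def case_prod_beta')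
    qed
  qed (fact sets_M D_borel disj cover M_fin D_bdd)+
  show ?thesis
  proof (rule gibbs_process_exists[OF sets_\<Lambda> \<theta>_borel M_def])
    show "AE x in \<Lambda>. \<forall>k w. x \<in> D k \<longrightarrow> (\<exists>m. \<forall>n\<ge>m. papangelou V x (points w) = \<kappa> x (cfg n w) * ennreal (\<theta> x))"
    proof (rule AE_mp[OF AE_not_in[OF N]], intro AE_I2 impI allI)
      fix x k w assume x: "x \<notin> N" "x \<in> D k"
      have "bounded (cball x R)" by simp
      then obtain m where m: "cball x R \<subseteq> (\<Union>k<m. D k)" using bounded_cover by blast
      have "papangelou V x (points w) = \<kappa> x (cfg n w) * ennreal (\<theta> x)" if n: "m \<le> n" for n
      proof -
        have sub: "cball x R \<subseteq> (\<Union>k<n. D k)" using m n by (auto simp: D_ball)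
        have "papangelou V x (points w) = activity x (cfg n w)"
        proof (rule papangelou_eq_activity[OF enumerates_points])
          show "emeasure (points w) (cball x R) \<noteq> \<infinity>"
            using emeasure_points_bounded[OF _ sub] by simp
          fix y assume "dist x y \<le> R"
          then have "{y} \<subseteq> (\<Union>k<n. D k)" using sub by auto
          then have "emeasure (points w) {y} = of_nat (size (filter_mset (\<lambda>z. z \<in> {y}) (cfg n w)))"
            by (intro emeasure_points_bounded) auto
          moreover have "size (filter_mset (\<lambda>z. z \<in> {y}) S) = count S y" for S
            by (induction S) auto
          ultimately show "emeasure (points w) {y} = of_nat (count (cfg n w) y)" by simp
        qed
        then show ?thesis using \<kappa>_\<theta>[OF x(1)] by simp
      qed
      then show "\<exists>m. \<forall>n\<ge>m. papangelou V x (points w) = \<kappa> x (cfg n w) * ennreal (\<theta> x)" by blast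
    qed
  qed
qed

end

theorem mainTheorem5:
  fixes c :: "(real ^ 'd) compacts \<Rightarrow> real ^ 'd"
    and Q :: "(real ^ 'd) compacts measure"
    and z :: real
    and V :: "nat \<Rightarrow> (nat \<Rightarrow> (real ^ 'd) compacts) \<Rightarrow> ereal"
  assumes c_measurable: "c \<in> borel_measurable borel"
    and c_translate: "\<And>K x. c (translate K x) = c K + x"
    and Q_prob: "prob_space Q"
    and Q_sets: "sets Q = sets borel"
    and Q_centred: "emeasure Q {K. c K = 0} = 1"
    and Q_integrable: "\<And>C :: (real ^ 'd) compacts.
          (\<integral>\<^sup>+L. emeasure lborel (set_of_compacts L + uminus ` set_of_compacts C) \<partial>Q) < \<infinity>"
    and z_pos: "0 < z"
    and V_measurable: "\<And>n. 2 \<le> n \<Longrightarrow> V n \<in> borel_measurable (PiM {..<n} (\<lambda>_. borel))"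
    and V_not_MInf: "\<And>n K. 2 \<le> n \<Longrightarrow> K \<in> space (PiM {..<n} (\<lambda>_. borel)) \<Longrightarrow> V n K \<noteq> -\<infinity>"
    and V_symmetric: "\<And>n K \<pi>. 2 \<le> n \<Longrightarrow> K \<in> space (PiM {..<n} (\<lambda>_. borel)) \<Longrightarrow>
          \<pi> permutes {..<n} \<Longrightarrow> V n (K \<circ> \<pi>) = V n K"
    and V_finite_range: "\<exists>R>0. \<forall>n\<ge>2. \<forall>K\<in>space (PiM {..<n} (\<lambda>_. borel)).
          R < Max {dist (K i) (K j) | i j. i < j \<and> j < n} \<longrightarrow> V n K = 0"
    and V_summable: "\<And>K \<mu>. \<mu> \<in> counting_measures \<Longrightarrow>
          (\<Sum>n. ereal (1 / fact (n + 1)) * max (- interaction V (n + 2) K \<mu>) 0) < \<infinity>"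
    and stable: "locally_stable (papangelou V) (particle_measure z Q)"
  shows "\<exists>(P :: (real ^ 'd) compacts measure measure) \<eta>.
           gibbs_process P \<eta> (papangelou V) (particle_measure z Q)"
proof -
  obtain R where "R > 0" and R: "\<forall>n\<ge>2. \<forall>K\<in>space (PiM {..<n} (\<lambda>_. borel)).
          R < Max {dist (K i) (K j) | i j. i < j \<and> j < n} \<longrightarrow> V n K = 0"
    using V_finite_range by blast
  interpret potential V R
    by (rule potential.intro[OF V_measurable V_not_MInf V_symmetric \<open>R > 0\<close> R[rule_format]])
  show ?thesis
  proof (rule gibbs_process_exists[OF _ stable])
    show "sets (particle_measure z Q) = sets borel"
      unfolding particle_measure_def by (simp add: sets.sigma_sets_eq[of borel, simplified])
  qed
qed

end
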